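(* Let $M$ be a smooth $n$-dimensional manifold, let $S\in\mathfrak{X}(T_0M)$ be a spray, let $p>1$ be an integer and let $\sigma\in\Lambda^1(T_0M)$ be a semi-basic $1$-form, homogeneous of order $p$. The spray $S$ is of Finslerian type with covariant force field $\sigma$ if and only if there exists a non-trivial, semi-basic $1$-form $\theta\in\Lambda^1(T_0M)$, homogeneous of order $p-1$, that satisfies the two conditions (1) $d_J\theta=0$; (2) $\nabla d_v\theta=d_v\sigma-\frac12 i_{\mathbb{F}+J}d_J\sigma$.
   Context: $TM$ is the tangent bundle with projection $\pi:TM\to M$, induced local coordinates $(x^i,y^i)$, and $T_0M=TM\setminus\{0\}$ is the slit tangent bundle; all objects are smooth on $T_0M$. The Liouville vector field is $\mathbb{C}=y^i\frac{\partial}{\partial y^i}$ and the tangent structure is $J=\frac{\partial}{\partial y^i}\otimes dx^i$. A semispray is a vector field $S$ with $JS=\mathbb{C}$; locally $S=y^i\frac{\partial}{\partial x^i}-2G^i(x,y)\frac{\partial}{\partial y^i}$. A spray is a semispray $S\in\mathfrak{X}(T_0M)$ with $[\mathbb{C},S]=S$. A function or form $\alpha$ is homogeneous of order $p$ if $\mathcal{L}_{\mathbb{C}}\alpha=p\,\alpha$. A form is semi-basic if it vanishes whenever one of its arguments is vertical; a semi-basic $1$-form is locally $\theta=\theta_i(x,y)dx^i$, and it is non-trivial if the matrix $\partial\theta_i/\partial y^j$ is not identically zero. A Lagrangian is a smooth function $L$ whose Hessian $\frac{\partial^2L}{\partial y^i\partial y^j}$ is not identically zero. For a vector-valued $1$-form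 $K$ (a $(1,1)$-tensor), $i_K$ is the derivation of degree $0$ on forms, $(i_K\alpha)(X_1,\dots,X_k)=\sum_a\alpha(X_1,\dots,KX_a,\dots,X_k)$ ($i_Kf=0$ on functions), and $d_K=i_K\circ d-d\circ i_K$. Let $[S,K]=\mathcal{L}_SK$. The horizontal and vertical projectors are $h=\frac12(\mathrm{Id}-[S,J])$, $v=\frac12(\mathrm{Id}+[S,J])$; locally $h=\frac{\delta}{\delta x^i}\otimes dx^i$, $v=\frac{\partial}{\partial y^i}\otimes\delta y^i$, with $\frac{\delta}{\delta x^i}=\frac{\partial}{\partial x^i}-N^j_i\frac{\partial}{\partial y^j}$, $\delta y^i=dy^i+N^i_jdx^j$, $N^i_j=\frac{\partial G^i}{\partial y^j}$. The almost complex structure is $\mathbb{F}=h\circ[S,h]-J$, locally $\mathbb{F}=\frac{\delta}{\delta x^i}\otimes\delta y^i-\frac{\partial}{\partial y^i}\otimes dx^i$; the Jacobi endomorphism is $\Phi=v\circ[S,h]$. The dynamical covariant derivative is given by $\nabla f=S(f)$ on functions, $\nabla X=h[S,hX]+v[S,vX]$ on vector fields, and on forms $\nabla=\mathcal{L}_S-i_{\mathbb{F}+J-\Phi}$. The Lagrange differential is $\delta_SL=\mathcal{L}_Sd_JL-dL=\left\{S\left(\frac{\partial L}{\partial y^i}\right)-\frac{\partial L}{\partial x^i}\right\}dx^i$. Definition: the spray $S$ is of Finslerian type with covariant force field $\sigma$ (where $\sigma$ is homogeneous of order $p$) if there exists a Lagrangian $L\in C^\infty(T_0M)$, homogeneous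 of order $p$, such that $\delta_SL=\sigma$. *)

theory Defs
  imports "HOL-Analysis.Analysis"
begin

section \<open>Smooth maps between open sets of Euclidean spaces\<close>

primrec C_on :: "nat \<Rightarrow> 'e::real_normed_vector set \<Rightarrow> ('e \<Rightarrow> 'b::real_normed_vector) \<Rightarrow> bool" where
  "C_on 0 U f \<longleftrightarrow> continuous_on U f"
| "C_on (Suc k) U f \<longleftrightarrow>
     (\<forall>x\<in>U. f differentiable (at x)) \<and> (\<forall>a. C_on k U (\<lambda>x. frechet_derivative f (at x) a))"

definition smooth_on :: "'e::real_normed_vector set \<Rightarrow> ('e \<Rightarrow> 'b::real_normed_vector) \<Rightarrow> bool" where
  "smooth_on U f \<longleftrightarrow> (\<forall>k. C_on k U f)"


section \<open>Smooth manifolds\<close>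

text \<open>A chart is a pair of a domain and a coordinate map (of which only the values on the domain
  matter). A smooth structure is given by an atlas, not necessarily maximal.\<close>

type_synonym ('p, 'e) chart = "'p set \<times> ('p \<Rightarrow> 'e)"
type_synonym ('p, 'e) atlas = "('p, 'e) chart set"

definition smooth_manifold :: "'p topology \<Rightarrow> ('p, 'e::euclidean_space) atlas \<Rightarrow> bool" where
  "smooth_manifold T A \<longleftrightarrow>
     Hausdorff_space T \<and> second_countable T \<and>
     (\<Union>(U, \<phi>)\<in>A. U) = topspace T \<and>
     (\<forall>(U, \<phi>)\<in>A. openin T U \<and> open (\<phi> ` U) \<and>
        homeomorphic_map (subtopology T U) (top_of_set (\<phi> ` U)) \<phi>) \<and>
     (\<forall>(U, \<phi>)\<in>A. \<forall>(V, \<psi>)\<in>A. smooth_on (\<phi> ` (U \<inter> V)) (\<psi> \<circ> inv_into U \<phi>))"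

text \<open>In what follows everything is expressed through the atlas alone; for a smooth manifold,
  \<open>open_in_atlas\<close> gives back the open sets of the topology.\<close>

definition carrier_of :: "('p, 'e) atlas \<Rightarrow> 'p set" where
  "carrier_of A = (\<Union>(U, \<phi>)\<in>A. U)"

definition open_in_atlas :: "('p, 'e::euclidean_space) atlas \<Rightarrow> 'p set \<Rightarrow> bool" where
  "open_in_atlas A W \<longleftrightarrow> W \<subseteq> carrier_of A \<and> (\<forall>(U, \<phi>)\<in>A. open (\<phi> ` (U \<inter> W)))"

definition smooth_fun :: "('p, 'e::euclidean_space) atlas \<Rightarrow> 'p set \<Rightarrow> ('p \<Rightarrow> real) \<Rightarrow> bool" where
  "smooth_fun A W f \<longleftrightarrow> (\<forall>(U, \<phi>)\<in>A. smooth_on (\<phi> ` (U \<inter> W)) (f \<circ> inv_into U \<phi>))"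

definition smooth_near :: "('p, 'e::euclidean_space) atlas \<Rightarrow> 'p \<Rightarrow> ('p \<Rightarrow> real) \<Rightarrow> bool" where
  "smooth_near A u f \<longleftrightarrow> (\<exists>W. open_in_atlas A W \<and> u \<in> W \<and> smooth_fun A W f)"

text \<open>A tangent vector at \<open>u\<close> is the operator of directional derivative, in a chart around \<open>u\<close>,
  on the functions that are smooth near \<open>u\<close>. Functions that are not smooth near \<open>u\<close> are sent to
  0, which makes equality of tangent vectors the equality of operators.\<close>

type_synonym 'p tvec = "('p \<Rightarrow> real) \<Rightarrow> real"
type_synonym 'p vfield = "'p \<Rightarrow> 'p tvec"

definition coord_vec ::
  "('p, 'e::euclidean_space) atlas \<Rightarrow> ('p, 'e) chart \<Rightarrow> 'p \<Rightarrow> 'e \<Rightarrow> 'p tvec" where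
  "coord_vec A c u a = (\<lambda>f. if smooth_near A u f
     then frechet_derivative (f \<circ> inv_into (fst c) (snd c)) (at (snd c u)) a else 0)"

definition tangent_space :: "('p, 'e::euclidean_space) atlas \<Rightarrow> 'p \<Rightarrow> 'p tvec set" where
  "tangent_space A u = {coord_vec A c u a | c a. c \<in> A \<and> u \<in> fst c}"

text \<open>The smooth vector fields on an open set \<open>W\<close>; the values outside \<open>W\<close> are irrelevant.\<close>

definition vfields :: "('p, 'e::euclidean_space) atlas \<Rightarrow> 'p set \<Rightarrow> 'p vfield set" where
  "vfields A W = {X. (\<forall>u\<in>W. X u \<in> tangent_space A u) \<and>
     (\<forall>V f. open_in_atlas A V \<and> V \<subseteq> W \<and> smooth_fun A V f \<longrightarrow> smooth_fun A V (\<lambda>u. X u f))}"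

definition lie_bracket :: "('p, 'e::euclidean_space) atlas \<Rightarrow> 'p vfield \<Rightarrow> 'p vfield \<Rightarrow> 'p vfield" where
  "lie_bracket A X Y = (\<lambda>u f. if smooth_near A u f
     then X u (\<lambda>w. Y w f) - Y u (\<lambda>w. X w f) else 0)"


section \<open>Forms and vector-valued 1-forms\<close>

text \<open>A form takes a list of vector fields, defined on any open set, to a function; a 0-form is a
  function, being evaluated on the empty list. A vector-valued 1-form is an operator on vector
  fields. All operators below are local, so they apply to vector fields on any open set.\<close>

type_synonym 'p form = "'p vfield list \<Rightarrow> 'p \<Rightarrow> real"
type_synonym 'p vform = "'p vfield \<Rightarrow> 'p vfield"

definition fun_form :: "('p \<Rightarrow> real) \<Rightarrow> 'p form" where
  "fun_form f = (\<lambda>Xs. f)"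

text \<open>Over every open set \<open>W\<close>, a \<open>k\<close>-form is an alternating multilinear map over the ring of
  smooth functions on \<open>W\<close>. The first clause makes it independent of irrelevant values of the
  vector fields outside \<open>W\<close>, hence compatible with restriction.\<close>

definition k_form :: "('p, 'e::euclidean_space) atlas \<Rightarrow> nat \<Rightarrow> 'p form \<Rightarrow> bool" where
  "k_form A k \<omega> \<longleftrightarrow>
     (\<forall>W Xs. open_in_atlas A W \<and> length Xs = k \<and> set Xs \<subseteq> vfields A W \<longrightarrow>
       (\<forall>Ys. length Ys = k \<and> (\<forall>i<k. \<forall>u\<in>W. (Xs ! i) u = (Ys ! i) u) \<longrightarrow>
          (\<forall>u\<in>W. \<omega> Xs u = \<omega> Ys u)) \<and>
       smooth_fun A W (\<omega> Xs) \<and>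
       (\<forall>i<k. \<forall>X\<in>vfields A W. \<forall>Y\<in>vfields A W. \<forall>f. smooth_fun A W f \<longrightarrow>
          (\<forall>u\<in>W. \<omega> (Xs[i := (\<lambda>w g. f w * X w g + Y w g)]) u =
                 f u * \<omega> (Xs[i := X]) u + \<omega> (Xs[i := Y]) u)) \<and>
       (\<forall>i j. i < j \<and> j < k \<and> Xs ! i = Xs ! j \<longrightarrow> (\<forall>u\<in>W. \<omega> Xs u = 0)))"

definition form_eq :: "('p, 'e::euclidean_space) atlas \<Rightarrow> nat \<Rightarrow> 'p form \<Rightarrow> 'p form \<Rightarrow> bool" where
  "form_eq A k \<omega> \<eta> \<longleftrightarrow>
     (\<forall>W Xs. open_in_atlas A W \<and> length Xs = k \<and> set Xs \<subseteq> vfields A W \<longrightarrow>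
        (\<forall>u\<in>W. \<omega> Xs u = \<eta> Xs u))"

definition omit :: "nat \<Rightarrow> 'x list \<Rightarrow> 'x list" where
  "omit i xs = take i xs @ drop (Suc i) xs"

text \<open>Convention without numerical factor:
  \<open>d\<omega>(X, Y) = X(\<omega>(Y)) - Y(\<omega>(X)) - \<omega>([X, Y])\<close> for a 1-form.\<close>

definition ext_d :: "('p, 'e::euclidean_space) atlas \<Rightarrow> 'p form \<Rightarrow> 'p form" where
  "ext_d A \<omega> = (\<lambda>Xs u.
     (\<Sum>i<length Xs. (- 1) ^ i * (Xs ! i) u (\<omega> (omit i Xs))) +
     (\<Sum>j<length Xs. \<Sum>i<j. (- 1) ^ (i + j) *
        \<omega> (lie_bracket A (Xs ! i) (Xs ! j) # omit i (omit j Xs)) u))"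

definition lie_form :: "('p, 'e::euclidean_space) atlas \<Rightarrow> 'p vfield \<Rightarrow> 'p form \<Rightarrow> 'p form" where
  "lie_form A X \<omega> = (\<lambda>Xs u. X u (\<omega> Xs) -
     (\<Sum>a<length Xs. \<omega> (Xs[a := lie_bracket A X (Xs ! a)]) u))"

definition i_deriv :: "'p vform \<Rightarrow> 'p form \<Rightarrow> 'p form" where
  "i_deriv K \<omega> = (\<lambda>Xs u. \<Sum>a<length Xs. \<omega> (Xs[a := K (Xs ! a)]) u)"

definition d_deriv :: "('p, 'e::euclidean_space) atlas \<Rightarrow> 'p vform \<Rightarrow> 'p form \<Rightarrow> 'p form" where
  "d_deriv A K \<omega> = (\<lambda>Xs u. i_deriv K (ext_d A \<omega>) Xs u - ext_d A (i_deriv K \<omega>) Xs u)"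

text \<open>\<open>[S, K] = \<L>\<^sub>S K\<close>.\<close>

definition lie_vform :: "('p, 'e::euclidean_space) atlas \<Rightarrow> 'p vfield \<Rightarrow> 'p vform \<Rightarrow> 'p vform" where
  "lie_vform A S K = (\<lambda>X u f. lie_bracket A S (K X) u f - K (lie_bracket A S X) u f)"


section \<open>The slit tangent bundle\<close>

text \<open>Points of the slit tangent bundle are pairs of a base point and a nonzero tangent vector.
  The base manifold is modelled on \<open>real^'n\<close>, so its dimension is \<open>CARD('n)\<close>.\<close>

type_synonym 'm tpt = "'m \<times> 'm tvec"

definition xcoord :: "('m, real^'n) chart \<Rightarrow> 'n \<Rightarrow> 'm tpt \<Rightarrow> real" where
  "xcoord c i u = snd c (fst u) $ i"

definition ycoord :: "('m, real^'n) chart \<Rightarrow> 'n \<Rightarrow> 'm tpt \<Rightarrow> real" where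
  "ycoord c i u = snd u (\<lambda>q. snd c q $ i)"

definition slit_chart ::
  "('m, real^'n) atlas \<Rightarrow> ('m, real^'n) chart \<Rightarrow> ('m tpt, (real^'n) \<times> (real^'n)) chart" where
  "slit_chart A c =
     ({(q, w). q \<in> fst c \<and> w \<in> tangent_space A q \<and> w \<noteq> (\<lambda>f. 0)},
      \<lambda>u. (\<chi> i. xcoord c i u, \<chi> i. ycoord c i u))"

definition slit_bundle :: "('m, real^'n) atlas \<Rightarrow> ('m tpt, (real^'n) \<times> (real^'n)) atlas" where
  "slit_bundle A = slit_chart A ` A"

abbreviation slit_points :: "('m, real^'n) atlas \<Rightarrow> 'm tpt set" where
  "slit_points A \<equiv> carrier_of (slit_bundle A)"

text \<open>The coordinate vector fields \<open>\<partial>/\<partial>x\<^sup>i\<close> and \<open>\<partial>/\<partial>y\<^sup>i\<close> of an induced chart.\<close>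

definition dx_field :: "('m, real^'n) atlas \<Rightarrow> ('m, real^'n) chart \<Rightarrow> 'n \<Rightarrow> 'm tpt vfield" where
  "dx_field A c i = (\<lambda>u. coord_vec (slit_bundle A) (slit_chart A c) u (axis i 1, 0))"

definition dy_field :: "('m, real^'n) atlas \<Rightarrow> ('m, real^'n) chart \<Rightarrow> 'n \<Rightarrow> 'm tpt vfield" where
  "dy_field A c i = (\<lambda>u. coord_vec (slit_bundle A) (slit_chart A c) u (0, axis i 1))"

text \<open>The Liouville field \<open>y\<^sup>i \<partial>/\<partial>y\<^sup>i\<close> and the tangent structure \<open>\<partial>/\<partial>y\<^sup>i \<otimes> dx\<^sup>i\<close> do not depend on
  the chart in which they are written; some chart is picked at each base point.\<close>

definition chart_at :: "('m, 'e) atlas \<Rightarrow> 'm \<Rightarrow> ('m, 'e) chart" where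
  "chart_at A q = (SOME c. c \<in> A \<and> q \<in> fst c)"

definition liouville :: "('m, real^'n) atlas \<Rightarrow> 'm tpt vfield" where
  "liouville A = (\<lambda>u f. let c = chart_at A (fst u) in
     \<Sum>i\<in>UNIV. ycoord c i u * dy_field A c i u f)"

definition tangent_structure :: "('m, real^'n) atlas \<Rightarrow> 'm tpt vform" where
  "tangent_structure A X = (\<lambda>u f. let c = chart_at A (fst u) in
     \<Sum>i\<in>UNIV. X u (xcoord c i) * dy_field A c i u f)"

text \<open>Vertical vector fields are those killed by the differential of the bundle projection.\<close>

definition vertical :: "('m, real^'n) atlas \<Rightarrow> 'm tpt set \<Rightarrow> 'm tpt vfield \<Rightarrow> bool" where
  "vertical A W X \<longleftrightarrow> X \<in> vfields (slit_bundle A) W \<and> (\<forall>u\<in>W. \<forall>g. X u (g \<circ> fst) = 0)"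

definition semi_basic :: "('m, real^'n) atlas \<Rightarrow> nat \<Rightarrow> 'm tpt form \<Rightarrow> bool" where
  "semi_basic A k \<omega> \<longleftrightarrow>
     (\<forall>W Xs. open_in_atlas (slit_bundle A) W \<and> length Xs = k \<and>
        set Xs \<subseteq> vfields (slit_bundle A) W \<and> (\<exists>i<k. vertical A W (Xs ! i)) \<longrightarrow>
        (\<forall>u\<in>W. \<omega> Xs u = 0))"

definition homogeneous_form :: "('m, real^'n) atlas \<Rightarrow> nat \<Rightarrow> real \<Rightarrow> 'm tpt form \<Rightarrow> bool" where
  "homogeneous_form A k r \<omega> \<longleftrightarrow>
     form_eq (slit_bundle A) k (lie_form (slit_bundle A) (liouville A) \<omega>) (\<lambda>Xs u. r * \<omega> Xs u)"

text \<open>For a 1-form \<open>\<theta> = \<theta>\<^sub>i dx\<^sup>i\<close>, the coefficient \<open>\<theta>\<^sub>i\<close> is \<open>\<theta>(\<partial>/\<partial>x\<^sup>i)\<close>.\<close>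

definition nontrivial_1form :: "('m, real^'n) atlas \<Rightarrow> 'm tpt form \<Rightarrow> bool" where
  "nontrivial_1form A \<theta> \<longleftrightarrow>
     (\<exists>c\<in>A. \<exists>u\<in>fst (slit_chart A c). \<exists>i j. dy_field A c j u (\<theta> [dx_field A c i]) \<noteq> 0)"

definition lagrangian :: "('m, real^'n) atlas \<Rightarrow> ('m tpt \<Rightarrow> real) \<Rightarrow> bool" where
  "lagrangian A L \<longleftrightarrow> smooth_fun (slit_bundle A) (slit_points A) L \<and>
     (\<exists>c\<in>A. \<exists>u\<in>fst (slit_chart A c). \<exists>i j.
        dy_field A c j u (\<lambda>w. dy_field A c i w L) \<noteq> 0)"


section \<open>Sprays\<close>

definition semispray :: "('m, real^'n) atlas \<Rightarrow> 'm tpt vfield \<Rightarrow> bool" where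
  "semispray A S \<longleftrightarrow> S \<in> vfields (slit_bundle A) (slit_points A) \<and>
     (\<forall>u\<in>slit_points A. tangent_structure A S u = liouville A u)"

definition spray :: "('m, real^'n) atlas \<Rightarrow> 'm tpt vfield \<Rightarrow> bool" where
  "spray A S \<longleftrightarrow> semispray A S \<and>
     (\<forall>u\<in>slit_points A. lie_bracket (slit_bundle A) (liouville A) S u = S u)"

definition hor :: "('m, real^'n) atlas \<Rightarrow> 'm tpt vfield \<Rightarrow> 'm tpt vform" where
  "hor A S X = (\<lambda>u f. (X u f - lie_vform (slit_bundle A) S (tangent_structure A) X u f) / 2)"

definition ver :: "('m, real^'n) atlas \<Rightarrow> 'm tpt vfield \<Rightarrow> 'm tpt vform" where
  "ver A S X = (\<lambda>u f. (X u f + lie_vform (slit_bundle A) S (tangent_structure A) X u f) / 2)"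

definition almost_complex :: "('m, real^'n) atlas \<Rightarrow> 'm tpt vfield \<Rightarrow> 'm tpt vform" where
  "almost_complex A S X = (\<lambda>u f. hor A S (lie_vform (slit_bundle A) S (hor A S) X) u f -
     tangent_structure A X u f)"

definition jacobi_endo :: "('m, real^'n) atlas \<Rightarrow> 'm tpt vfield \<Rightarrow> 'm tpt vform" where
  "jacobi_endo A S X = ver A S (lie_vform (slit_bundle A) S (hor A S) X)"

definition F_plus_J :: "('m, real^'n) atlas \<Rightarrow> 'm tpt vfield \<Rightarrow> 'm tpt vform" where
  "F_plus_J A S X = (\<lambda>u f. almost_complex A S X u f + tangent_structure A X u f)"

text \<open>The dynamical covariant derivative on forms,
  \<open>\<nabla> = \<L>\<^sub>S - i\<close> with the insertion of \<open>\<F> + J - \<Phi>\<close>.\<close>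

definition dyn_cov :: "('m, real^'n) atlas \<Rightarrow> 'm tpt vfield \<Rightarrow> 'm tpt form \<Rightarrow> 'm tpt form" where
  "dyn_cov A S \<omega> = (\<lambda>Xs u. lie_form (slit_bundle A) S \<omega> Xs u -
     i_deriv (\<lambda>X w f. F_plus_J A S X w f - jacobi_endo A S X w f) \<omega> Xs u)"

definition lagrange_diff ::
  "('m, real^'n) atlas \<Rightarrow> 'm tpt vfield \<Rightarrow> ('m tpt \<Rightarrow> real) \<Rightarrow> 'm tpt form" where
  "lagrange_diff A S L = (\<lambda>Xs u.
     lie_form (slit_bundle A) S (d_deriv (slit_bundle A) (tangent_structure A) (fun_form L)) Xs u -
     ext_d (slit_bundle A) (fun_form L) Xs u)"

definition finslerian_type ::
  "('m, real^'n) atlas \<Rightarrow> 'm tpt vfield \<Rightarrow> real \<Rightarrow> 'm tpt form \<Rightarrow> bool" where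
  "finslerian_type A S r \<sigma> \<longleftrightarrow>
     (\<exists>L. lagrangian A L \<and> homogeneous_form A 0 r (fun_form L) \<and>
        form_eq (slit_bundle A) 1 (lagrange_diff A S L) \<sigma>)"

end

theory Submission
  imports Defs
begin

text \<open>In the frame \<open>\<delta>/\<delta>x\<^sup>i\<close>, \<open>\<partial>/\<partial>y\<^sup>i\<close> adapted to the spray, condition (1) says that
  \<open>g\<^sub>i\<^sub>j = \<partial>\<theta>\<^sub>i/\<partial>y\<^sup>j\<close> is symmetric, and both sides of condition (2) have only mixed components, so that
  (2) reads \<open>S(g\<^sub>i\<^sub>j) - N\<^sup>k\<^sub>i g\<^sub>k\<^sub>j - N\<^sup>k\<^sub>j g\<^sub>i\<^sub>k = (\<partial>\<sigma>\<^sub>i/\<partial>y\<^sup>j + \<partial>\<sigma>\<^sub>j/\<partial>y\<^sup>i) / 2\<close>. If \<open>\<theta> = d\<^sub>J L\<close>, the left-hand side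
  is the symmetrised \<open>y\<close>-derivative of the Lagrange differential \<open>\<delta>\<^sub>S L\<close>, so \<open>\<delta>\<^sub>S L = \<sigma>\<close> implies (2).
  Conversely, Euler's identity and the symmetry of \<open>g\<close> give \<open>\<theta> = d\<^sub>J L\<close> for \<open>L = \<theta>(S) / p\<close>; then
  \<open>\<rho> = \<delta>\<^sub>S L - \<sigma>\<close> has an antisymmetric matrix \<open>\<partial>\<rho>\<^sub>i/\<partial>y\<^sup>j\<close> and is homogeneous of order \<open>p > 1\<close>, which
  forces \<open>\<rho> = 0\<close>.\<close>

section \<open>Smooth maps\<close>

text \<open>Forms and (1,1)-tensors are bare operators on vector fields over open sets, so none of
  them is pointwise by construction. Each operator in the theorem must be shown local and linear
  over smooth functions before an identity of forms becomes an identity of coefficients in a chart.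
  The derivative terms that threaten linearity cancel in \<open>d\<close>, in the Lie derivative of
  a form and in \<open>[S, K]\<close>. Only mixed components survive in (2) for three reasons:
  \<nabla> preserves both halves of the adapted frame, with the same coefficients \<open>N\<close>
  on each; \<open>d\<^sub>v \<theta>\<close> vanishes on two frame fields of the same half; and
  \<open>\<F> + J\<close> turns a vertical frame field into a horizontal one, which carries the
  horizontal block of \<open>d\<^sub>J \<sigma>\<close> into the mixed block. There the factor 1/2
  removes exactly the antisymmetric part of
  \<open>\<partial>\<sigma>\<^sub>i/\<partial>y\<^sup>j\<close>. Condition (2) therefore leaves the
  antisymmetric part of the derivative of \<open>\<delta>\<^sub>S L - \<sigma>\<close> undetermined,
  and homogeneity has to supply what is missing.\<close>

lemma C_on_cong_imp:
  assumes "open U"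
  shows "(\<And>x. x \<in> U \<Longrightarrow> f x = g x) \<Longrightarrow> C_on k U f \<Longrightarrow> C_on k U g"
proof (induction k arbitrary: f g)
  case 0
  then show ?case using continuous_on_eq by (auto simp: C_on.simps)
next
  case (Suc k)
  have d: "f differentiable (at x)" if "x \<in> U" for x
    using Suc.prems(2) that by simp
  have e: "frechet_derivative f (at x) = frechet_derivative g (at x)" if "x \<in> U" for x
    using frechet_derivative_transform_within_open[OF d[OF that] assms that Suc.prems(1)] by blast
  have "g differentiable (at x)" if "x \<in> U" for x
    using has_derivative_transform_within_open[where g = g,
        OF d[OF that, unfolded frechet_derivative_works] assms that Suc.prems(1)]
    unfolding differentiable_def by blast
  moreover have "C_on k U (\<lambda>x. frechet_derivative g (at x) a)" for a
    by (rule Suc.IH[of "\<lambda>x. frechet_derivative f (at x) a"]) (use e Suc.prems(2) in auto)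
  ultimately show ?case by simp
qed

lemma C_on_cong:
  assumes "open U" "\<And>x. x \<in> U \<Longrightarrow> f x = g x"
  shows "C_on k U f \<longleftrightarrow> C_on k U g"
  using C_on_cong_imp[OF assms(1), of f g] C_on_cong_imp[OF assms(1), of g f] assms(2) by auto

text \<open>Uniqueness of the derivative lets an explicit formula \<open>F\<close> stand for
  \<open>frechet_derivative\<close>; openness of \<open>U\<close> makes it enough that the formula
  holds on \<open>U\<close>.\<close>

lemma C_on_SucI:
  assumes "open U" "\<And>x. x \<in> U \<Longrightarrow> (f has_derivative F x) (at x)" "\<And>a. C_on k U (\<lambda>x. F x a)"
  shows "C_on (Suc k) U f"
proof -
  have "frechet_derivative f (at x) = F x" if "x \<in> U" for x
    using frechet_derivative_at[OF assms(2)[OF that]] by simp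
  then have "C_on k U (\<lambda>x. frechet_derivative f (at x) a)" for a
    using C_on_cong[OF assms(1), of "\<lambda>x. frechet_derivative f (at x) a" "\<lambda>x. F x a" k] assms(3) by auto
  then show ?thesis using assms(2) by (auto simp: differentiable_def)
qed

lemma C_on_SucD:
  assumes "C_on (Suc k) U f"
  shows "\<And>x. x \<in> U \<Longrightarrow> (f has_derivative frechet_derivative f (at x)) (at x)"
    and "\<And>a. C_on k U (\<lambda>x. frechet_derivative f (at x) a)"
  using assms frechet_derivative_works by auto

lemma C_on_mono: "V \<subseteq> U \<Longrightarrow> C_on k U f \<Longrightarrow> C_on k V f"
  by (induction k arbitrary: f) (auto intro: continuous_on_subset)

text \<open>\<open>C_on (Suc k)\<close> does not list continuity of the map itself; in the base case
  it comes from differentiability at each point.\<close>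

lemma C_on_Suc_imp: "C_on (Suc k) U f \<Longrightarrow> C_on k U f"
proof (induction k arbitrary: f)
  case 0
  then show ?case
    by (auto intro!: continuous_at_imp_continuous_on differentiable_imp_continuous_within)
next
  case (Suc k)
  then show ?case by (subst C_on.simps) (use C_on_SucD[OF Suc.prems] Suc.IH Suc.prems in auto)
qed

lemma C_on_Union:
  "(\<And>x. x \<in> U \<Longrightarrow> \<exists>V. open V \<and> x \<in> V \<and> C_on k V f) \<Longrightarrow> C_on k U f"
proof (induction k arbitrary: f)
  case 0
  then show ?case
    by (simp add: continuous_at_imp_continuous_on) (metis continuous_at_imp_continuous_on continuous_on_eq_continuous_at)
next
  case (Suc k)
  have "f differentiable (at x)" if "x \<in> U" for x
    using Suc.prems[OF that] by auto
  moreover have "C_on k U (\<lambda>x. frechet_derivative f (at x) a)" for a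
    by (rule Suc.IH) (use Suc.prems in fastforce)
  ultimately show ?case by simp
qed

lemma C_on_const: "C_on k U (\<lambda>x. c)"
  by (induction k arbitrary: c) simp_all

lemma C_on_linear:
  assumes "bounded_linear f" "open U"
  shows "C_on k U f"
proof (cases k)
  case 0
  then show ?thesis using assms by (simp add: linear_continuous_on)
next
  case (Suc j)
  have "C_on (Suc j) U f"
    by (rule C_on_SucI[where F = "\<lambda>x. f"])
       (use assms in \<open>auto intro: bounded_linear_imp_has_derivative C_on_const\<close>)
  then show ?thesis using Suc by simp
qed

lemma C_on_add:
  "open U \<Longrightarrow> C_on k U f \<Longrightarrow> C_on k U g \<Longrightarrow> C_on k U (\<lambda>x. f x + g x)"
proof (induction k arbitrary: f g)
  case 0
  then show ?case by (simp add: continuous_on_add)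
next
  case (Suc k)
  show ?case
    by (rule C_on_SucI[where F = "\<lambda>x a. frechet_derivative f (at x) a + frechet_derivative g (at x) a"])
       (intro Suc.prems(1) has_derivative_add Suc.IH C_on_SucD[OF Suc.prems(2)]
          C_on_SucD[OF Suc.prems(3)] | assumption)+
qed

lemma C_on_bilinear:
  assumes "bounded_bilinear B" "open U"
  shows "C_on k U f \<Longrightarrow> C_on k U g \<Longrightarrow> C_on k U (\<lambda>x. B (f x) (g x))"
proof (induction k arbitrary: f g)
  case 0
  then show ?case using bounded_bilinear.continuous_on[OF assms(1)] by auto
next
  case (Suc k)
  show ?case
  proof (rule C_on_SucI[OF assms(2)])
    fix x assume "x \<in> U"
    then show "((\<lambda>x. B (f x) (g x)) has_derivative
      (\<lambda>a. B (f x) (frechet_derivative g (at x) a) + B (frechet_derivative f (at x) a) (g x))) (at x)"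
      by (intro bounded_bilinear.FDERIV[OF assms(1)] C_on_SucD(1)[OF Suc.prems(1)]
          C_on_SucD(1)[OF Suc.prems(2)])
  next
    fix a
    show "C_on k U (\<lambda>x. B (f x) (frechet_derivative g (at x) a) + B (frechet_derivative f (at x) a) (g x))"
      by (intro C_on_add assms Suc.IH C_on_SucD(2)[OF Suc.prems(1)] C_on_SucD(2)[OF Suc.prems(2)]
          C_on_Suc_imp[OF Suc.prems(1)] C_on_Suc_imp[OF Suc.prems(2)])
  qed
qed

lemma C_on_linear_image:
  assumes "bounded_linear L" "open U"
  shows "C_on k U f \<Longrightarrow> C_on k U (\<lambda>x. L (f x))"
proof (induction k arbitrary: f)
  case 0
  then show ?case using assms by (simp add: bounded_linear.continuous_on)
next
  case (Suc k)
  show ?case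
    by (rule C_on_SucI[where F = "\<lambda>x a. L (frechet_derivative f (at x) a)"])
       (intro assms bounded_linear.has_derivative[OF assms(1)] Suc.IH C_on_SucD[OF Suc.prems] | assumption)+
qed

lemma C_on_sum:
  assumes "open U" "\<And>i. i \<in> I \<Longrightarrow> C_on k U (f i)"
  shows "C_on k U (\<lambda>x. \<Sum>i\<in>I. f i x)"
  using assms(2)
proof (induction I rule: infinite_finite_induct)
  case (insert i I)
  then show ?case by (simp add: C_on_add[OF assms(1)])
qed (simp_all add: C_on_const)

text \<open>By the chain rule the outer derivative is taken in a direction that varies with the
  point, whereas \<open>C_on\<close> speaks of fixed directions. Expanding that direction in
  \<open>Basis\<close> gives a finite sum of products to which the induction hypothesis
  applies.\<close>

lemma C_on_compose:
  fixes f :: "'a::real_normed_vector \<Rightarrow> 'b::euclidean_space" and g :: "'b \<Rightarrow> 'c::real_normed_vector"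
  assumes "open U" "open V" "f ` U \<subseteq> V"
  shows "C_on k U f \<Longrightarrow> C_on k V g \<Longrightarrow> C_on k U (g \<circ> f)"
proof (induction k arbitrary: g)
  case 0
  then show ?case
    using assms(3) continuous_on_compose[of U f g] continuous_on_subset[of V g "f ` U"] by simp
next
  case (Suc k)
  let ?D = "\<lambda>x. frechet_derivative f (at x)" and ?E = "\<lambda>y. frechet_derivative g (at y)"
  have fx: "f x \<in> V" if "x \<in> U" for x using assms(3) that by auto
  have lin: "linear (?E y)" if "y \<in> V" for y
    using C_on_SucD(1)[OF Suc.prems(2) that] has_derivative_linear by blast
  show ?case
  proof (rule C_on_SucI[OF assms(1), where F = "\<lambda>x a. ?E (f x) (?D x a)"])
    fix x assume x: "x \<in> U"
    show "(g \<circ> f has_derivative (\<lambda>a. ?E (f x) (?D x a))) (at x)"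
      using diff_chain_at[OF C_on_SucD(1)[OF Suc.prems(1) x] C_on_SucD(1)[OF Suc.prems(2) fx[OF x]]]
      by (simp add: o_def)
  next
    fix a
    have 1: "C_on k U (\<lambda>x. \<Sum>b\<in>Basis. (?D x a \<bullet> b) *\<^sub>R ((\<lambda>y. ?E y b) \<circ> f) x)"
      by (intro C_on_sum C_on_bilinear[OF bounded_bilinear_scaleR] assms
          C_on_linear_image[OF bounded_linear_inner_left] C_on_SucD(2)[OF Suc.prems(1)]
          Suc.IH C_on_Suc_imp[OF Suc.prems(1)] C_on_SucD(2)[OF Suc.prems(2)])
    have 2: "?E (f x) (?D x a) = (\<Sum>b\<in>Basis. (?D x a \<bullet> b) *\<^sub>R ((\<lambda>y. ?E y b) \<circ> f) x)" if "x \<in> U" for x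
    proof -
      have "?E (f x) (?D x a) = ?E (f x) (\<Sum>b\<in>Basis. (?D x a \<bullet> b) *\<^sub>R b)"
        by (simp add: euclidean_representation)
      also have "\<dots> = (\<Sum>b\<in>Basis. (?D x a \<bullet> b) *\<^sub>R ?E (f x) b)"
        by (simp add: linear_sum[OF lin[OF fx[OF that]]] linear_cmul[OF lin[OF fx[OF that]]])
      finally show ?thesis by simp
    qed
    show "C_on k U (\<lambda>x. ?E (f x) (?D x a))"
      using C_on_cong_imp[OF assms(1) _ 1] 2 by auto
  qed
qed

lemma smooth_on_cong:
  "open U \<Longrightarrow> (\<And>x. x \<in> U \<Longrightarrow> f x = g x) \<Longrightarrow> smooth_on U f \<longleftrightarrow> smooth_on U g"
  unfolding smooth_on_def using C_on_cong[of U f g] by auto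

lemma smooth_on_mono: "smooth_on U f \<Longrightarrow> V \<subseteq> U \<Longrightarrow> smooth_on V f"
  unfolding smooth_on_def using C_on_mono by blast

lemma smooth_on_local:
  assumes "\<And>x. x \<in> U \<Longrightarrow> \<exists>V. open V \<and> x \<in> V \<and> smooth_on V f"
  shows "smooth_on U f"
  unfolding smooth_on_def
proof
  fix k show "C_on k U f" by (rule C_on_Union) (use assms in \<open>auto simp: smooth_on_def\<close>)
qed

lemma smooth_on_const [simp]: "smooth_on U (\<lambda>x. c)"
  by (simp add: smooth_on_def C_on_const)

lemma smooth_on_linear: "bounded_linear f \<Longrightarrow> open U \<Longrightarrow> smooth_on U f"
  by (simp add: smooth_on_def C_on_linear)

lemma smooth_on_linear_image:
  "bounded_linear L \<Longrightarrow> open U \<Longrightarrow> smooth_on U f \<Longrightarrow> smooth_on U (\<lambda>x. L (f x))"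
  by (simp add: smooth_on_def C_on_linear_image)

lemma smooth_on_add:
  "open U \<Longrightarrow> smooth_on U f \<Longrightarrow> smooth_on U g \<Longrightarrow> smooth_on U (\<lambda>x. f x + g x)"
  by (simp add: smooth_on_def C_on_add)

lemma smooth_on_scaleR:
  "open U \<Longrightarrow> smooth_on U f \<Longrightarrow> smooth_on U g \<Longrightarrow> smooth_on U (\<lambda>x. f x *\<^sub>R g x)"
  by (simp add: smooth_on_def C_on_bilinear[OF bounded_bilinear_scaleR])

lemma smooth_on_mult:
  fixes f g :: "'a::real_normed_vector \<Rightarrow> real"
  shows "open U \<Longrightarrow> smooth_on U f \<Longrightarrow> smooth_on U g \<Longrightarrow> smooth_on U (\<lambda>x. f x * g x)"
  using smooth_on_scaleR[of U f g] by simp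

lemma smooth_on_sum:
  "open U \<Longrightarrow> (\<And>i. i \<in> I \<Longrightarrow> smooth_on U (f i)) \<Longrightarrow> smooth_on U (\<lambda>x. \<Sum>i\<in>I. f i x)"
  by (simp add: smooth_on_def C_on_sum)

lemma smooth_on_compose:
  fixes f :: "'a::real_normed_vector \<Rightarrow> 'b::euclidean_space"
  shows "open U \<Longrightarrow> open V \<Longrightarrow> f ` U \<subseteq> V \<Longrightarrow> smooth_on U f \<Longrightarrow> smooth_on V g \<Longrightarrow> smooth_on U (g \<circ> f)"
  by (simp add: smooth_on_def C_on_compose)

lemma smooth_on_has_derivative:
  "smooth_on U f \<Longrightarrow> x \<in> U \<Longrightarrow> (f has_derivative frechet_derivative f (at x)) (at x)"
  using C_on_SucD(1)[of 0 U f] unfolding smooth_on_def by blast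

lemma smooth_on_frechet_derivative:
  "smooth_on U f \<Longrightarrow> smooth_on U (\<lambda>x. frechet_derivative f (at x) a)"
  using C_on_SucD(2) unfolding smooth_on_def by blast

text \<open>Two applications of the mean value theorem, along \<open>a\<close> and then along
  \<open>b\<close>. The bound on the intermediate point is what allows a passage to the limit at
  \<open>x\<close>.\<close>

lemma mixed_difference_mean_value:
  fixes f :: "'a::real_normed_vector \<Rightarrow> real"
  assumes f: "\<And>y. y \<in> ball x d \<Longrightarrow> (f has_derivative Df y) (at y)"
    and g: "\<And>y. y \<in> ball x d \<Longrightarrow> ((\<lambda>z. Df z a) has_derivative Dg y) (at y)"
    and t: "t > 0" "t * (norm a + norm b) < d"
  shows "\<exists>y\<in>ball x d. norm (y - x) \<le> t * (norm a + norm b) \<and>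
     f (x + t *\<^sub>R a + t *\<^sub>R b) - f (x + t *\<^sub>R a) - f (x + t *\<^sub>R b) + f x = t * t * Dg y b"
proof -
  have est: "norm (s *\<^sub>R a + r *\<^sub>R b) \<le> t * (norm a + norm b)"
    if "0 \<le> s" "s \<le> t" "0 \<le> r" "r \<le> t" for s r
  proof -
    have "norm (s *\<^sub>R a + r *\<^sub>R b) \<le> s * norm a + r * norm b"
      using norm_triangle_ineq[of "s *\<^sub>R a" "r *\<^sub>R b"] that by simp
    also have "\<dots> \<le> t * norm a + t * norm b"
      using that by (intro add_mono mult_right_mono) auto
    finally show ?thesis by (simp add: distrib_left)
  qed
  have inb: "x + s *\<^sub>R a + r *\<^sub>R b \<in> ball x d" if "0 \<le> s" "s \<le> t" "0 \<le> r" "r \<le> t" for s r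
  proof -
    have "dist x (x + s *\<^sub>R a + r *\<^sub>R b) = norm (s *\<^sub>R a + r *\<^sub>R b)"
      by (simp add: dist_norm norm_minus_commute add.assoc add.commute)
    then show ?thesis using est[OF that] t(2) by simp
  qed
  have line: "((\<lambda>s. F (z + s *\<^sub>R c)) has_real_derivative F' c) (at s)"
    if "(F has_derivative F') (at (z + s *\<^sub>R c))" for F :: "'a \<Rightarrow> real" and F' z c s
  proof -
    have "((\<lambda>s. z + s *\<^sub>R c) has_derivative (\<lambda>s. s *\<^sub>R c)) (at s)"
      by (auto intro!: derivative_eq_intros)
    from has_derivative_compose[OF this that]
    have "((\<lambda>s. F (z + s *\<^sub>R c)) has_derivative (\<lambda>s. F' (s *\<^sub>R c))) (at s)" .
    moreover have "(\<lambda>s. F' (s *\<^sub>R c)) = (*) (F' c)"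
      using has_derivative_linear[OF that] by (auto simp: linear_cmul fun_eq_iff)
    ultimately show ?thesis by (simp add: has_field_derivative_def)
  qed
  \<comment> \<open>The increment of \<open>f\<close> in direction \<open>b\<close>, as a function
    of the progress along \<open>a\<close>; the mixed difference is its total change.\<close>
  let ?g = "\<lambda>s. f ((x + t *\<^sub>R b) + s *\<^sub>R a) - f (x + s *\<^sub>R a)"
  have "\<exists>s. 0 < s \<and> s < t \<and> ?g t - ?g 0 =
      (t - 0) * (Df ((x + t *\<^sub>R b) + s *\<^sub>R a) a - Df (x + s *\<^sub>R a) a)"
  proof (rule MVT2[OF t(1)])
    fix s assume s: "0 \<le> s" "s \<le> t"
    show "DERIV ?g s :> Df ((x + t *\<^sub>R b) + s *\<^sub>R a) a - Df (x + s *\<^sub>R a) a"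
      by (intro DERIV_diff line f)
         (use inb[OF s, of t] inb[OF s, of 0] t(1) in \<open>simp_all add: algebra_simps\<close>)
  qed
  then obtain s where s: "0 < s" "s < t"
    "?g t - ?g 0 = t * (Df ((x + t *\<^sub>R b) + s *\<^sub>R a) a - Df (x + s *\<^sub>R a) a)" by auto
  let ?h = "\<lambda>r. Df ((x + s *\<^sub>R a) + r *\<^sub>R b) a"
  have "\<exists>r. 0 < r \<and> r < t \<and> ?h t - ?h 0 = (t - 0) * Dg ((x + s *\<^sub>R a) + r *\<^sub>R b) b"
  proof (rule MVT2[OF t(1)])
    fix r assume r: "0 \<le> r" "r \<le> t"
    show "DERIV ?h r :> Dg ((x + s *\<^sub>R a) + r *\<^sub>R b) b"
      by (rule line[where F = "\<lambda>z. Df z a"]) (use inb[OF _ _ r, of s] s g in auto)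
  qed
  then obtain r where r: "0 < r" "r < t" "?h t - ?h 0 = t * Dg ((x + s *\<^sub>R a) + r *\<^sub>R b) b" by auto
  let ?y = "x + s *\<^sub>R a + r *\<^sub>R b"
  have "f (x + t *\<^sub>R a + t *\<^sub>R b) - f (x + t *\<^sub>R a) - f (x + t *\<^sub>R b) + f x = ?g t - ?g 0"
    by (simp add: algebra_simps)
  also have "\<dots> = t * (?h t - ?h 0)" using s(3) by (simp add: algebra_simps)
  also have "\<dots> = t * t * Dg ?y b" using r(3) by simp
  finally show ?thesis
    using inb[of s r] est[of s r] s r by (intro bexI[of _ ?y]) (auto simp: add.assoc)
qed

text \<open>The mixed difference is symmetric in \<open>a\<close> and \<open>b\<close>, so both
  second derivatives take a common value, each at some point close to \<open>x\<close>. Continuity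
  of the second derivatives then identifies them at \<open>x\<close>.\<close>

lemma frechet_derivative_commute:
  fixes f :: "'a::real_normed_vector \<Rightarrow> real"
  assumes "open U" "smooth_on U f" "x \<in> U"
  shows "frechet_derivative (\<lambda>y. frechet_derivative f (at y) a) (at x) b =
         frechet_derivative (\<lambda>y. frechet_derivative f (at y) b) (at x) a"
proof -
  define P where "P a b y = frechet_derivative (\<lambda>y. frechet_derivative f (at y) a) (at y) b" for a b y
  have sm: "smooth_on U (P a b)" for a b
    unfolding P_def by (intro smooth_on_frechet_derivative assms)
  have cont: "isCont (P a b) x" for a b
    using sm[of a b] assms(1,3) unfolding smooth_on_def
    by (metis C_on.simps(1) continuous_on_eq_continuous_at)
  obtain d0 where d0: "d0 > 0" "ball x d0 \<subseteq> U" using assms by (metis openE)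
  have "\<bar>P a b x - P b a x\<bar> \<le> e" if e: "e > 0" for e
  proof -
    obtain d1 where d1: "d1 > 0" "\<And>y. norm (y - x) < d1 \<Longrightarrow> \<bar>P a b y - P a b x\<bar> < e / 2"
      using cont[of a b] e unfolding continuous_at_eps_delta dist_norm real_norm_def
      by (meson half_gt_zero)
    obtain d2 where d2: "d2 > 0" "\<And>y. norm (y - x) < d2 \<Longrightarrow> \<bar>P b a y - P b a x\<bar> < e / 2"
      using cont[of b a] e unfolding continuous_at_eps_delta dist_norm real_norm_def
      by (meson half_gt_zero)
    define d where "d = min d0 (min d1 d2)"
    have d: "d > 0" "d \<le> d0" "d \<le> d1" "d \<le> d2" using d0 d1 d2 by (auto simp: d_def)
    \<comment> \<open>The summand 1 keeps the denominator positive when \<open>a\<close> and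
      \<open>b\<close> are both zero.\<close>
    define t where "t = d / (2 * (norm a + norm b + 1))"
    have t: "t > 0" using d by (simp add: t_def add_nonneg_pos)
    have "t * (norm a + norm b) < t * (2 * (norm a + norm b + 1))"
      using t norm_ge_zero[of a] norm_ge_zero[of b] by (intro mult_strict_left_mono) (simp_all del: norm_ge_zero)
    also have "\<dots> = d" proof -
      have "norm a + norm b + 1 \<noteq> 0" using norm_ge_zero[of a] norm_ge_zero[of b] by linarith
      then show ?thesis unfolding t_def by simp
    qed
    finally have td: "t * (norm a + norm b) < d" .
    have in_U: "y \<in> U" if "y \<in> ball x d" for y using that d(2) d0(2) by auto
    have 1: "(f has_derivative frechet_derivative f (at y)) (at y)" if "y \<in> ball x d" for y
      using smooth_on_has_derivative[OF assms(2) in_U[OF that]] .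
    have 2: "((\<lambda>z. frechet_derivative f (at z) a) has_derivative
        frechet_derivative (\<lambda>z. frechet_derivative f (at z) a) (at y)) (at y)"
      if "y \<in> ball x d" for y a
      using smooth_on_has_derivative[OF smooth_on_frechet_derivative[OF assms(2)] in_U[OF that]] .
    obtain y where y: "norm (y - x) \<le> t * (norm a + norm b)"
      "f (x + t *\<^sub>R a + t *\<^sub>R b) - f (x + t *\<^sub>R a) - f (x + t *\<^sub>R b) + f x = t * t * P a b y"
      using mixed_difference_mean_value[OF 1 2 t td] unfolding P_def by blast
    obtain z where z: "norm (z - x) \<le> t * (norm b + norm a)"
      "f (x + t *\<^sub>R b + t *\<^sub>R a) - f (x + t *\<^sub>R b) - f (x + t *\<^sub>R a) + f x = t * t * P b a z"
      using mixed_difference_mean_value[OF 1 2 t, where b = a] td unfolding P_def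
      by (metis add.commute)
    have comm: "x + t *\<^sub>R b + t *\<^sub>R a = x + t *\<^sub>R a + t *\<^sub>R b" by simp
    have "t * t * P a b y = t * t * P b a z"
      using y(2) z(2)[unfolded comm] by linarith
    then have eq: "P a b y = P b a z" using t by simp
    have "\<bar>P a b y - P a b x\<bar> < e / 2" using y(1) td d by (intro d1(2)) auto
    moreover have "\<bar>P b a z - P b a x\<bar> < e / 2" using z(1) td d by (intro d2(2)) (auto simp: add.commute)
    ultimately show ?thesis using eq by linarith
  qed
  from this[of "\<bar>P a b x - P b a x\<bar> / 2"] have "P a b x = P b a x" by (cases "P a b x = P b a x") auto
  then show ?thesis by (simp add: P_def)
qed

section \<open>Tangent vectors and vector fields\<close>

lemma open_in_atlas_iff:
  "open_in_atlas B W \<longleftrightarrow> W \<subseteq> carrier_of B \<and> (\<forall>c\<in>B. open (snd c ` (fst c \<inter> W)))"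
  by (auto simp: open_in_atlas_def split_beta)

lemma smooth_fun_iff:
  "smooth_fun B W f \<longleftrightarrow> (\<forall>c\<in>B. smooth_on (snd c ` (fst c \<inter> W)) (f \<circ> inv_into (fst c) (snd c)))"
  by (auto simp: smooth_fun_def split_beta)

lemma carrier_of_iff: "u \<in> carrier_of B \<longleftrightarrow> (\<exists>c\<in>B. u \<in> fst c)"
  by (auto simp: carrier_of_def split_beta)

text \<open>Only chart-level properties are recorded, so that the slit bundle, which is given by its
  induced charts and carries no separately defined topology, can be an instance.\<close>

locale smooth_atlas =
  fixes B :: "('p, 'e::euclidean_space) atlas"
  assumes chart_inj: "c \<in> B \<Longrightarrow> inj_on (snd c) (fst c)"
    and chart_overlap: "c \<in> B \<Longrightarrow> d \<in> B \<Longrightarrow> open (snd c ` (fst c \<inter> fst d))"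
    and chart_smooth: "c \<in> B \<Longrightarrow> d \<in> B \<Longrightarrow>
      smooth_on (snd c ` (fst c \<inter> fst d)) (snd d \<circ> inv_into (fst c) (snd c))"
begin

abbreviation opn :: "'p set \<Rightarrow> bool" where "opn \<equiv> open_in_atlas B"
abbreviation smth :: "'p set \<Rightarrow> ('p \<Rightarrow> real) \<Rightarrow> bool" where "smth \<equiv> smooth_fun B"
abbreviation vf :: "'p set \<Rightarrow> 'p vfield set" where "vf \<equiv> vfields B"
abbreviation TS :: "'p \<Rightarrow> 'p tvec set" where "TS \<equiv> tangent_space B"
abbreviation brk :: "'p vfield \<Rightarrow> 'p vfield \<Rightarrow> 'p vfield" where "brk \<equiv> lie_bracket B"
abbreviation cv :: "('p, 'e) chart \<Rightarrow> 'p \<Rightarrow> 'e \<Rightarrow> 'p tvec" where "cv \<equiv> coord_vec B"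
abbreviation cinv :: "('p, 'e) chart \<Rightarrow> 'e \<Rightarrow> 'p" where "cinv c \<equiv> inv_into (fst c) (snd c)"

lemma cinv [simp]: "c \<in> B \<Longrightarrow> u \<in> fst c \<Longrightarrow> cinv c (snd c u) = u"
  using chart_inj by (rule inv_into_f_f)

lemma open_atlas_chart: "c \<in> B \<Longrightarrow> opn (fst c)"
  using chart_overlap by (auto simp: open_in_atlas_iff carrier_of_iff)

lemma open_atlas_carrier: "opn (carrier_of B)"
proof -
  have "fst c \<inter> carrier_of B = fst c \<inter> fst c" if "c \<in> B" for c
    using that by (auto simp: carrier_of_iff)
  then show ?thesis using chart_overlap unfolding open_in_atlas_iff by (metis order_refl)
qed

lemma open_atlas_Int:
  assumes "opn V" "opn W" shows "opn (V \<inter> W)"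
proof -
  have "snd c ` (fst c \<inter> (V \<inter> W)) = snd c ` (fst c \<inter> V) \<inter> snd c ` (fst c \<inter> W)" if "c \<in> B" for c
    using inj_on_image_Int[OF chart_inj[OF that], of "fst c \<inter> V" "fst c \<inter> W"] by (auto simp: Int_ac)
  then show ?thesis using assms by (auto simp: open_in_atlas_iff open_Int)
qed

lemma open_atlas_image: "opn V \<Longrightarrow> c \<in> B \<Longrightarrow> open (snd c ` (fst c \<inter> V))"
  by (simp add: open_in_atlas_iff)

lemma open_atlas_carrierD: "opn V \<Longrightarrow> u \<in> V \<Longrightarrow> \<exists>c\<in>B. u \<in> fst c"
  by (auto simp: open_in_atlas_iff carrier_of_iff subset_iff)

lemma smooth_fun_chartD: "smth V f \<Longrightarrow> c \<in> B \<Longrightarrow> smooth_on (snd c ` (fst c \<inter> V)) (f \<circ> cinv c)"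
  by (simp add: smooth_fun_iff)

lemma smooth_fun_mono: "smth W f \<Longrightarrow> V \<subseteq> W \<Longrightarrow> smth V f"
  unfolding smooth_fun_iff by (meson Int_mono image_mono order_refl smooth_on_mono)

lemma smooth_fun_cong:
  assumes "opn W" "\<And>u. u \<in> W \<Longrightarrow> f u = g u"
  shows "smth W f \<longleftrightarrow> smth W g"
proof -
  have "smooth_on (snd c ` (fst c \<inter> W)) (f \<circ> cinv c) = smooth_on (snd c ` (fst c \<inter> W)) (g \<circ> cinv c)"
    if c: "c \<in> B" for c
    by (rule smooth_on_cong[OF open_atlas_image[OF assms(1) c]]) (use c assms(2) in auto)
  then show ?thesis unfolding smooth_fun_iff by blast
qed

lemma smooth_fun_const [simp]: "smth W (\<lambda>u. k)"
  by (simp add: smooth_fun_iff o_def)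

lemma smooth_fun_add: "opn W \<Longrightarrow> smth W f \<Longrightarrow> smth W g \<Longrightarrow> smth W (\<lambda>u. f u + g u)"
  unfolding smooth_fun_iff o_def by (intro ballI smooth_on_add open_atlas_image) auto

lemma smooth_fun_mult: "opn W \<Longrightarrow> smth W f \<Longrightarrow> smth W g \<Longrightarrow> smth W (\<lambda>u. f u * g u)"
  unfolding smooth_fun_iff o_def by (intro ballI smooth_on_mult open_atlas_image) auto

lemma smooth_fun_diff: "opn W \<Longrightarrow> smth W f \<Longrightarrow> smth W g \<Longrightarrow> smth W (\<lambda>u. f u - g u)"
  using smooth_fun_add[of W f "\<lambda>u. -1 * g u"] smooth_fun_mult[of W "\<lambda>u. -1" g] by simp

lemma smooth_fun_sum: "opn W \<Longrightarrow> (\<And>i. i \<in> I \<Longrightarrow> smth W (f i)) \<Longrightarrow> smth W (\<lambda>u. \<Sum>i\<in>I. f i u)"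
  unfolding smooth_fun_iff o_def by (intro ballI smooth_on_sum open_atlas_image) auto

lemma smooth_fun_local:
  assumes "\<And>u. u \<in> W \<Longrightarrow> \<exists>V. opn V \<and> u \<in> V \<and> smth V f"
  shows "smth W f"
  unfolding smooth_fun_iff
proof (intro ballI smooth_on_local)
  fix c x assume c: "c \<in> B" and "x \<in> snd c ` (fst c \<inter> W)"
  then obtain u where u: "u \<in> fst c" "u \<in> W" "x = snd c u" by auto
  from assms[OF u(2)] obtain V where V: "opn V" "u \<in> V" "smth V f" by auto
  show "\<exists>V. open V \<and> x \<in> V \<and> smooth_on V (f \<circ> cinv c)"
    by (rule exI[of _ "snd c ` (fst c \<inter> V)"])
       (use open_atlas_image[OF V(1) c] smooth_fun_chartD[OF V(3) c] V(2) u in simp)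
qed

text \<open>\<open>smooth_fun\<close> tests every chart of the atlas. Smooth transition maps reduce
  this to a single chart whose domain contains \<open>V\<close>.\<close>

lemma smooth_fun_chartI:
  assumes c: "c \<in> B" and V: "opn V" "V \<subseteq> fst c" and f: "smooth_on (snd c ` V) (f \<circ> cinv c)"
  shows "smth V f"
  unfolding smooth_fun_iff
proof
  fix d assume d: "d \<in> B"
  let ?U = "snd d ` (fst d \<inter> V)"
  have oU: "open ?U" using open_atlas_image[OF V(1) d] .
  have oV: "open (snd c ` V)" using open_atlas_image[OF V(1) c] V(2) by (simp add: Int_absorb1)
  have "smooth_on ?U (snd c \<circ> cinv d)"
    by (rule smooth_on_mono[OF chart_smooth[OF d c]]) (use V in auto)
  then have "smooth_on ?U ((f \<circ> cinv c) \<circ> (snd c \<circ> cinv d))"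
    by (intro smooth_on_compose[OF oU oV _ _ f]) (use d in auto)
  then show "smooth_on ?U (f \<circ> cinv d)"
    by (subst smooth_on_cong[OF oU, where g = "(f \<circ> cinv c) \<circ> (snd c \<circ> cinv d)"])
       (use c d V in \<open>auto simp: subset_iff\<close>)
qed

lemma smooth_fun_coord:
  assumes "c \<in> B" "bounded_linear L"
  shows "smth (fst c) (\<lambda>u. L (snd c u))"
proof -
  have "smooth_on (snd d ` (fst d \<inter> fst c)) (\<lambda>x. L ((snd c \<circ> cinv d) x))" if "d \<in> B" for d
    using smooth_on_linear_image[OF assms(2) chart_overlap chart_smooth] that assms(1) by blast
  then show ?thesis by (simp add: smooth_fun_iff o_def)
qed

section \<open>Germs of smooth functions and tangent vectors as derivations\<close>

abbreviation near :: "'p \<Rightarrow> ('p \<Rightarrow> real) \<Rightarrow> bool" where "near \<equiv> smooth_near B"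

lemma nearI: "opn W \<Longrightarrow> u \<in> W \<Longrightarrow> smth W f \<Longrightarrow> near u f"
  by (auto simp: smooth_near_def)

lemma near_obtain:
  assumes "near u f" "opn V" "u \<in> V"
  obtains W where "opn W" "u \<in> W" "W \<subseteq> V" "smth W f"
proof -
  from assms(1) obtain W where "opn W" "u \<in> W" "smth W f" by (auto simp: smooth_near_def)
  then show thesis using that[of "W \<inter> V"] open_atlas_Int assms smooth_fun_mono[of W f "W \<inter> V"] by auto
qed

lemma near_cong:
  assumes "opn V" "u \<in> V" "\<And>w. w \<in> V \<Longrightarrow> f w = g w"
  shows "near u f \<longleftrightarrow> near u g"
proof -
  have "near u k" if "near u h" "\<And>w. w \<in> V \<Longrightarrow> h w = k w" for h k
  proof -
    obtain W where W: "opn W" "u \<in> W" "W \<subseteq> V" "smth W h"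
      using near_obtain[OF \<open>near u h\<close> assms(1,2)] .
    then show ?thesis using smooth_fun_cong[OF W(1), of h k] that(2) nearI by blast
  qed
  from this[of f g] this[of g f] assms(3) show ?thesis by auto
qed

lemma near_const [simp]: "u \<in> carrier_of B \<Longrightarrow> near u (\<lambda>w. k)"
  using nearI[OF open_atlas_carrier] by simp

lemma near_coord: "c \<in> B \<Longrightarrow> u \<in> fst c \<Longrightarrow> bounded_linear L \<Longrightarrow> near u (\<lambda>w. L (snd c w))"
  using nearI[OF open_atlas_chart _ smooth_fun_coord] by blast

lemma near_both:
  assumes "near u f" "near u g"
  obtains W where "opn W" "u \<in> W" "smth W f" "smth W g"
proof -
  from assms(2) obtain V where V: "opn V" "u \<in> V" "smth V g" by (auto simp: smooth_near_def)
  from near_obtain[OF assms(1) V(1,2)] obtain W where "opn W" "u \<in> W" "W \<subseteq> V" "smth W f" .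
  then show thesis using that V(3) smooth_fun_mono by blast
qed

lemma near_add: "near u f \<Longrightarrow> near u g \<Longrightarrow> near u (\<lambda>w. f w + g w)"
  by (erule near_both) (auto intro: nearI smooth_fun_add)

lemma near_mult: "near u f \<Longrightarrow> near u g \<Longrightarrow> near u (\<lambda>w. f w * g w)"
  by (erule near_both) (auto intro: nearI smooth_fun_mult)

lemma near_carrier: "near u f \<Longrightarrow> u \<in> carrier_of B"
  by (auto simp: smooth_near_def open_in_atlas_iff)

lemma near_sum: "u \<in> carrier_of B \<Longrightarrow> (\<And>i. i \<in> I \<Longrightarrow> near u (f i)) \<Longrightarrow> near u (\<lambda>w. \<Sum>i\<in>I. f i w)"
  by (induction I rule: infinite_finite_induct) (auto intro: near_add)

lemma near_has_derivative:
  assumes "near u f" "c \<in> B" "u \<in> fst c"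
  shows "(f \<circ> cinv c has_derivative frechet_derivative (f \<circ> cinv c) (at (snd c u))) (at (snd c u))"
proof -
  from assms(1) obtain W where "opn W" "u \<in> W" "smth W f" by (auto simp: smooth_near_def)
  then show ?thesis using smooth_fun_chartD[OF _ assms(2)] smooth_on_has_derivative assms(3) by blast
qed

lemma cv_eqI:
  assumes "near u f" "c \<in> B" "u \<in> fst c" "(f \<circ> cinv c has_derivative D) (at (snd c u))"
  shows "cv c u a f = D a"
  using frechet_derivative_at[OF assms(4)] assms(1) by (simp add: coord_vec_def)

text \<open>Functions that agree near \<open>u\<close> are both smooth near \<open>u\<close> or both
  not; in the second case both sides are the default value 0.\<close>

lemma cv_cong:
  assumes "c \<in> B" "u \<in> fst c" "opn V" "u \<in> V" "\<And>w. w \<in> V \<Longrightarrow> f w = g w"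
  shows "cv c u a f = cv c u a g"
proof (cases "near u f")
  case True
  have "(g \<circ> cinv c has_derivative frechet_derivative (f \<circ> cinv c) (at (snd c u))) (at (snd c u))"
    by (rule has_derivative_transform_within_open[OF near_has_derivative[OF True assms(1,2)]
          open_atlas_image[OF assms(3,1)]]) (use assms in auto)
  then have "cv c u a g = frechet_derivative (f \<circ> cinv c) (at (snd c u)) a"
    using cv_eqI[of u g c "frechet_derivative (f \<circ> cinv c) (at (snd c u))" a]
      near_cong[OF assms(3-4), of f g] True assms by blast
  then show ?thesis using True by (simp add: coord_vec_def)
next
  case False
  then show ?thesis using near_cong[OF assms(3-4), of f g] assms(5) by (simp add: coord_vec_def)
qed

lemma cv_add:
  assumes "near u f" "near u g" "c \<in> B" "u \<in> fst c"
  shows "cv c u a (\<lambda>w. f w + g w) = cv c u a f + cv c u a g"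
  using cv_eqI[OF near_add[OF assms(1,2)] assms(3,4), of
      "\<lambda>a. frechet_derivative (f \<circ> cinv c) (at (snd c u)) a + frechet_derivative (g \<circ> cinv c) (at (snd c u)) a" a]
    has_derivative_add[OF near_has_derivative[OF assms(1,3,4)] near_has_derivative[OF assms(2,3,4)]]
  by (simp add: coord_vec_def assms o_def)

lemma cv_mult:
  assumes "near u f" "near u g" "c \<in> B" "u \<in> fst c"
  shows "cv c u a (\<lambda>w. f w * g w) = f u * cv c u a g + cv c u a f * g u"
  using cv_eqI[OF near_mult[OF assms(1,2)] assms(3,4), of
      "\<lambda>a. f u * frechet_derivative (g \<circ> cinv c) (at (snd c u)) a + frechet_derivative (f \<circ> cinv c) (at (snd c u)) a * g u" a]
    has_derivative_mult[OF near_has_derivative[OF assms(1,3,4)] near_has_derivative[OF assms(2,3,4)]]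
  by (simp add: coord_vec_def assms o_def)

lemma cv_const [simp]: "cv c u a (\<lambda>w. k) = 0"
  by (simp add: coord_vec_def o_def)

lemma cv_coord:
  assumes "c \<in> B" "u \<in> fst c" "bounded_linear L"
  shows "cv c u a (\<lambda>w. L (snd c w)) = L a"
proof (rule cv_eqI[OF near_coord[OF assms] assms(1,2)])
  show "((\<lambda>w. L (snd c w)) \<circ> cinv c has_derivative L) (at (snd c u))"
    by (rule has_derivative_transform_within_open[OF bounded_linear_imp_has_derivative[OF assms(3)]
          chart_overlap[OF assms(1,1)]]) (use assms in auto)
qed

text \<open>The chain rule through the transition map. A tangent vector thus has coordinates in
  every chart around its point, and since both operators send functions not smooth near
  \<open>u\<close> to 0, the equality is one of operators.\<close>

lemma cv_transition:
  assumes "c \<in> B" "d \<in> B" "u \<in> fst c" "u \<in> fst d"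
  shows "cv d u a = cv c u (frechet_derivative (snd c \<circ> cinv d) (at (snd d u)) a)"
proof
  fix f
  show "cv d u a f = cv c u (frechet_derivative (snd c \<circ> cinv d) (at (snd d u)) a) f"
  proof (cases "near u f")
    case True
    have 1: "((snd c \<circ> cinv d) has_derivative frechet_derivative (snd c \<circ> cinv d) (at (snd d u))) (at (snd d u))"
      using smooth_on_has_derivative[OF chart_smooth[OF assms(2,1)]] assms by blast
    have 2: "(f \<circ> cinv c has_derivative frechet_derivative (f \<circ> cinv c) (at (snd c u))) (at ((snd c \<circ> cinv d) (snd d u)))"
      using near_has_derivative[OF True assms(1,3)] assms by simp
    have "(f \<circ> cinv d has_derivative (frechet_derivative (f \<circ> cinv c) (at (snd c u)) \<circ>
        frechet_derivative (snd c \<circ> cinv d) (at (snd d u)))) (at (snd d u))"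
      by (rule has_derivative_transform_within_open[OF diff_chain_at[OF 1 2]
          chart_overlap[OF assms(2,1)]]) (use assms in auto)
    from cv_eqI[OF True assms(2,4) this] True show ?thesis by (simp add: coord_vec_def)
  qed (simp add: coord_vec_def)
qed

lemma TS_obtain:
  assumes "t \<in> TS u" "c \<in> B" "u \<in> fst c"
  obtains a where "t = cv c u a"
  using assms cv_transition unfolding tangent_space_def by blast

lemma TS_carrier: "t \<in> TS u \<Longrightarrow> u \<in> carrier_of B"
  unfolding tangent_space_def carrier_of_iff by blast

lemma cv_TS: "c \<in> B \<Longrightarrow> u \<in> fst c \<Longrightarrow> cv c u a \<in> TS u"
  unfolding tangent_space_def by blast

lemma tv_cong: "t \<in> TS u \<Longrightarrow> opn V \<Longrightarrow> u \<in> V \<Longrightarrow> (\<And>w. w \<in> V \<Longrightarrow> f w = g w) \<Longrightarrow> t f = t g"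
  using cv_cong unfolding tangent_space_def by blast

lemma tv_far: "t \<in> TS u \<Longrightarrow> \<not> near u f \<Longrightarrow> t f = 0"
  by (auto simp: tangent_space_def coord_vec_def)

lemma tv_add: "t \<in> TS u \<Longrightarrow> near u f \<Longrightarrow> near u g \<Longrightarrow> t (\<lambda>w. f w + g w) = t f + t g"
  using cv_add by (auto simp: tangent_space_def)

lemma tv_mult: "t \<in> TS u \<Longrightarrow> near u f \<Longrightarrow> near u g \<Longrightarrow> t (\<lambda>w. f w * g w) = f u * t g + t f * g u"
  using cv_mult by (auto simp: tangent_space_def)

lemma tv_const [simp]: "t \<in> TS u \<Longrightarrow> t (\<lambda>w. k) = 0"
  by (auto simp: tangent_space_def)

lemma tv_cmult: "t \<in> TS u \<Longrightarrow> near u f \<Longrightarrow> t (\<lambda>w. k * f w) = k * t f"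
  using tv_mult[of t u "\<lambda>w. k" f] TS_carrier by simp

lemma near_cmult: "near u f \<Longrightarrow> near u (\<lambda>w. k * f w)"
  using near_mult[of u "\<lambda>w. k" f] near_carrier by simp

lemma tv_diff: "t \<in> TS u \<Longrightarrow> near u f \<Longrightarrow> near u g \<Longrightarrow> t (\<lambda>w. f w - g w) = t f - t g"
  using tv_add[of t u f "\<lambda>w. -1 * g w"] tv_cmult[of t u g "-1"] near_cmult[of u g "-1"] by simp

lemma tv_sum:
  assumes "t \<in> TS u" "\<And>i. i \<in> I \<Longrightarrow> near u (f i)"
  shows "t (\<lambda>w. \<Sum>i\<in>I. f i w) = (\<Sum>i\<in>I. t (f i))"
  using assms(2)
proof (induction I rule: infinite_finite_induct)
  case (insert i I)
  then show ?case
    using tv_add[OF assms(1), of "f i" "\<lambda>w. \<Sum>i\<in>I. f i w"] near_sum[OF TS_carrier[OF assms(1)], of I f]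
    by auto
qed (use assms(1) in auto)

lemma cv_lincomb:
  assumes "c \<in> B" "u \<in> fst c"
  shows "cv c u (\<Sum>i\<in>I. k i *\<^sub>R a i) f = (\<Sum>i\<in>I. k i * cv c u (a i) f)"
proof (cases "near u f")
  case True
  have "linear (frechet_derivative (f \<circ> cinv c) (at (snd c u)))"
    using near_has_derivative[OF True assms] has_derivative_linear by blast
  then show ?thesis using True by (simp add: coord_vec_def linear_sum linear_cmul)
qed (simp add: coord_vec_def)

lemma cv_inner: "c \<in> B \<Longrightarrow> u \<in> fst c \<Longrightarrow> cv c u a (\<lambda>w. snd c w \<bullet> b) = a \<bullet> b"
  using cv_coord[OF _ _ bounded_linear_inner_left] by blast

lemma tv_expand:
  assumes "t \<in> TS u" "c \<in> B" "u \<in> fst c"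
  shows "t f = (\<Sum>b\<in>Basis. t (\<lambda>w. snd c w \<bullet> b) * cv c u b f)"
proof -
  obtain a where a: "t = cv c u a" using TS_obtain[OF assms] .
  show ?thesis
    using cv_lincomb[OF assms(2,3), of "\<lambda>b. a \<bullet> b" "\<lambda>b. b" Basis f]
    by (simp add: euclidean_representation a cv_inner[OF assms(2,3)])
qed

lemma lincomb_TS:
  assumes "c \<in> B" "u \<in> fst c"
  shows "(\<lambda>f. \<Sum>i\<in>I. k i * cv c u (a i) f) \<in> TS u"
proof -
  have "(\<lambda>f. \<Sum>i\<in>I. k i * cv c u (a i) f) = cv c u (\<Sum>i\<in>I. k i *\<^sub>R a i)"
    by (simp add: cv_lincomb[OF assms] fun_eq_iff)
  then show ?thesis using cv_TS[OF assms] by simp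
qed

text \<open>The two vectors may be given in different charts, so both are first expanded in a common
  one.\<close>

lemma TS_add_cmult:
  assumes "t \<in> TS u" "s \<in> TS u"
  shows "(\<lambda>f. k * t f + s f) \<in> TS u"
proof -
  obtain c where c: "c \<in> B" "u \<in> fst c" using TS_carrier[OF assms(1)] by (auto simp: carrier_of_iff)
  have "(\<lambda>f. k * t f + s f) = (\<lambda>f. \<Sum>b\<in>Basis. (k * t (\<lambda>w. snd c w \<bullet> b) + s (\<lambda>w. snd c w \<bullet> b)) * cv c u b f)"
  proof
    fix f
    have "k * t f + s f = k * (\<Sum>b\<in>Basis. t (\<lambda>w. snd c w \<bullet> b) * cv c u b f) +
        (\<Sum>b\<in>Basis. s (\<lambda>w. snd c w \<bullet> b) * cv c u b f)"
      by (rule arg_cong2[where f = "\<lambda>x y. k * x + y", OF tv_expand[OF assms(1) c] tv_expand[OF assms(2) c]])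
    then show "k * t f + s f = (\<Sum>b\<in>Basis. (k * t (\<lambda>w. snd c w \<bullet> b) + s (\<lambda>w. snd c w \<bullet> b)) * cv c u b f)"
      by (simp add: sum_distrib_left sum.distrib distrib_right mult.assoc)
  qed
  then show ?thesis using lincomb_TS[OF c, where I = Basis and a = "\<lambda>b. b"] by simp
qed

lemma TS_zero: "u \<in> carrier_of B \<Longrightarrow> (\<lambda>f. 0) \<in> TS u"
  using lincomb_TS[where I = "{}" and k = "\<lambda>_. 0" and a = "\<lambda>_. 0" and u = u]
  unfolding carrier_of_iff by force

section \<open>Smooth vector fields on open sets\<close>

lemma vf_TS: "X \<in> vf W \<Longrightarrow> u \<in> W \<Longrightarrow> X u \<in> TS u"
  by (auto simp: vfields_def)

lemma vf_smth: "X \<in> vf W \<Longrightarrow> opn V \<Longrightarrow> V \<subseteq> W \<Longrightarrow> smth V f \<Longrightarrow> smth V (\<lambda>u. X u f)"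
  by (auto simp: vfields_def)

lemma vf_near: "X \<in> vf W \<Longrightarrow> opn W \<Longrightarrow> u \<in> W \<Longrightarrow> near u f \<Longrightarrow> near u (\<lambda>w. X w f)"
  by (erule near_obtain, assumption+) (rule nearI, assumption+, rule vf_smth)

lemma vf_mono: "X \<in> vf W \<Longrightarrow> V \<subseteq> W \<Longrightarrow> X \<in> vf V"
  unfolding vfields_def by blast

lemma vf_cong_imp:
  assumes "X \<in> vf W" "\<And>u. u \<in> W \<Longrightarrow> X u = Y u"
  shows "Y \<in> vf W"
  unfolding vfields_def
proof (intro CollectI conjI ballI allI impI)
  fix u assume "u \<in> W" then show "Y u \<in> TS u" using vf_TS[OF assms(1)] assms(2) by metis
next
  fix V f assume V: "opn V \<and> V \<subseteq> W \<and> smth V f"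
  then show "smth V (\<lambda>u. Y u f)"
    using smooth_fun_cong[of V "\<lambda>u. X u f" "\<lambda>u. Y u f"] vf_smth[OF assms(1), of V f] assms(2) by (auto simp: subset_iff)
qed

lemma vf_local:
  assumes "\<And>u. u \<in> W \<Longrightarrow> \<exists>V. opn V \<and> u \<in> V \<and> X \<in> vf V"
  shows "X \<in> vf W"
  unfolding vfields_def
proof (intro CollectI conjI ballI allI impI)
  fix u assume "u \<in> W" then show "X u \<in> TS u" using assms vf_TS by blast
next
  fix V f assume V: "opn V \<and> V \<subseteq> W \<and> smth V f"
  show "smth V (\<lambda>u. X u f)"
  proof (rule smooth_fun_local)
    fix u assume u: "u \<in> V"
    then obtain V' where "opn V'" "u \<in> V'" "X \<in> vf V'" using assms V by blast
    then show "\<exists>V. opn V \<and> u \<in> V \<and> smth V (\<lambda>u. X u f)"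
      using V u by (intro exI[of _ "V \<inter> V'"])
        (auto intro!: open_atlas_Int vf_smth[of X V'] intro: smooth_fun_mono)
  qed
qed

lemma vf_lin:
  assumes "opn W" "X \<in> vf W" "Y \<in> vf W" "smth W f"
  shows "(\<lambda>w g. f w * X w g + Y w g) \<in> vf W"
  unfolding vfields_def
proof (intro CollectI conjI ballI allI impI)
  fix u assume "u \<in> W"
  then show "(\<lambda>g. f u * X u g + Y u g) \<in> TS u" using assms by (intro TS_add_cmult vf_TS)
next
  fix V g assume V: "opn V \<and> V \<subseteq> W \<and> smth V g"
  then show "smth V (\<lambda>u. f u * X u g + Y u g)"
    using assms by (intro smooth_fun_add smooth_fun_mult vf_smth[of X W] vf_smth[of Y W]) (auto intro: smooth_fun_mono)
qed

lemma vf_zero: "opn W \<Longrightarrow> (\<lambda>w g. 0) \<in> vf W"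
  unfolding vfields_def by (auto simp: open_in_atlas_iff intro!: TS_zero)

lemma vf_lincomb:
  assumes "opn W" "\<And>i. i \<in> I \<Longrightarrow> X i \<in> vf W" "\<And>i. i \<in> I \<Longrightarrow> smth W (f i)"
  shows "(\<lambda>w g. \<Sum>i\<in>I. f i w * X i w g) \<in> vf W"
  using assms(2,3)
proof (induction I rule: infinite_finite_induct)
  case (insert i I)
  then show ?case
    using vf_lin[OF assms(1), of "X i" "\<lambda>w g. \<Sum>i\<in>I. f i w * X i w g" "f i"] by simp
qed (simp_all add: vf_zero assms(1))

lemma vf_cv:
  assumes c: "c \<in> B"
  shows "(\<lambda>u. cv c u a) \<in> vf (fst c)"
  unfolding vfields_def
proof (intro CollectI conjI ballI allI impI)
  fix u assume "u \<in> fst c" then show "cv c u a \<in> TS u" using c by (rule cv_TS[rotated])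
next
  fix V f assume V: "opn V \<and> V \<subseteq> fst c \<and> smth V f"
  have o: "open (snd c ` V)" using open_atlas_image[of V c] V c by (simp add: Int_absorb1)
  have "smooth_on (snd c ` V) (f \<circ> cinv c)" using smooth_fun_chartD[of V f c] V c by (simp add: Int_absorb1)
  from smooth_on_frechet_derivative[OF this, of a]
  have "smooth_on (snd c ` V) ((\<lambda>u. cv c u a f) \<circ> cinv c)"
    by (subst smooth_on_cong[OF o, where g = "\<lambda>x. frechet_derivative (f \<circ> cinv c) (at x) a"])
       (use V c in \<open>auto simp: coord_vec_def subset_iff nearI\<close>)
  then show "smth V (\<lambda>u. cv c u a f)" using smooth_fun_chartI c V by blast
qed

section \<open>Lie brackets of vector fields\<close>

lemma cv_commute:
  assumes "c \<in> B" "u \<in> fst c" "near u f"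
  shows "cv c u a (\<lambda>w. cv c w b f) = cv c u b (\<lambda>w. cv c w a f)"
proof -
  obtain V where V: "opn V" "u \<in> V" "V \<subseteq> fst c" "smth V f"
    using near_obtain[OF assms(3) open_atlas_chart[OF assms(1)] assms(2)] .
  have o: "open (snd c ` V)" using open_atlas_image[of V c] V assms(1) by (simp add: Int_absorb1)
  have s: "smooth_on (snd c ` V) (f \<circ> cinv c)" using smooth_fun_chartD[of V f c] V assms(1) by (simp add: Int_absorb1)
  have *: "cv c u a (\<lambda>w. cv c w b f) =
      frechet_derivative (\<lambda>x. frechet_derivative (f \<circ> cinv c) (at x) b) (at (snd c u)) a" for a b
  proof (rule cv_eqI[OF _ assms(1,2)])
    show "near u (\<lambda>w. cv c w b f)"
      by (rule nearI[OF V(1,2)]) (rule vf_smth[OF vf_cv[OF assms(1)] V(1,3,4)])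
    have "((\<lambda>x. frechet_derivative (f \<circ> cinv c) (at x) b) has_derivative
      frechet_derivative (\<lambda>x. frechet_derivative (f \<circ> cinv c) (at x) b) (at (snd c u))) (at (snd c u))"
      by (rule smooth_on_has_derivative[OF smooth_on_frechet_derivative[OF s]]) (use V in auto)
    then show "((\<lambda>w. cv c w b f) \<circ> cinv c has_derivative
        frechet_derivative (\<lambda>x. frechet_derivative (f \<circ> cinv c) (at x) b) (at (snd c u))) (at (snd c u))"
      by (rule has_derivative_transform_within_open[OF _ o])
         (use V assms(1) in \<open>auto simp: coord_vec_def subset_iff nearI\<close>)
  qed
  show ?thesis unfolding * using frechet_derivative_commute[OF o s] V by auto
qed

text \<open>A commutator of derivations looks like a second-order operator. In a chart the
  second-order terms of the two composites coincide by symmetry of second derivatives, so what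
  remains is first order, hence a tangent vector.\<close>

lemma brk_expand:
  assumes W: "opn W" "X \<in> vf W" "Y \<in> vf W" "u \<in> W" and c: "c \<in> B" "u \<in> fst c"
  shows "brk X Y u f = (\<Sum>b\<in>Basis. (X u (\<lambda>w. Y w (\<lambda>v. snd c v \<bullet> b)) - Y u (\<lambda>w. X w (\<lambda>v. snd c v \<bullet> b)))
    * cv c u b f)"
proof (cases "near u f")
  case True
  let ?x = "\<lambda>b v. snd c v \<bullet> b"
  have nx: "near u (?x b)" for b using near_coord[OF c bounded_linear_inner_left] .
  have nc: "near u (\<lambda>w. cv c w b f)" for b
    using vf_near[OF vf_cv[OF c(1)] open_atlas_chart[OF c(1)] c(2) True] .
  \<comment> \<open>The product rule splits a composite into a first-order part and a second-order
    part; the split is used for both orders of composition.\<close>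
  have part: "X u (\<lambda>w. Y w f) = (\<Sum>b\<in>Basis. X u (\<lambda>w. Y w (?x b)) * cv c u b f) +
      (\<Sum>b\<in>Basis. \<Sum>a\<in>Basis. Y u (?x b) * X u (?x a) * cv c u a (\<lambda>w. cv c w b f))"
    if X: "X \<in> vf W" and Y: "Y \<in> vf W" for X Y
  proof -
    have nY: "near u (\<lambda>w. Y w (?x b))" for b using vf_near[OF Y W(1) W(4) nx] .
    have "X u (\<lambda>w. Y w f) = X u (\<lambda>w. \<Sum>b\<in>Basis. Y w (?x b) * cv c w b f)"
    proof (rule tv_cong[OF vf_TS[OF X W(4)] open_atlas_Int[OF W(1) open_atlas_chart[OF c(1)]]])
      show "u \<in> W \<inter> fst c" using W(4) c by simp
    next
      fix w assume "w \<in> W \<inter> fst c"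
      then show "Y w f = (\<Sum>b\<in>Basis. Y w (?x b) * cv c w b f)"
        by (intro tv_expand vf_TS[OF Y] c(1)) auto
    qed
    also have "\<dots> = (\<Sum>b\<in>Basis. X u (\<lambda>w. Y w (?x b) * cv c w b f))"
      by (rule tv_sum[OF vf_TS[OF X W(4)]]) (intro near_mult nY nc)
    also have "\<dots> = (\<Sum>b\<in>Basis. Y u (?x b) * X u (\<lambda>w. cv c w b f) + X u (\<lambda>w. Y w (?x b)) * cv c u b f)"
      by (intro sum.cong refl tv_mult[OF vf_TS[OF X W(4)] nY nc])
    also have "\<dots> = (\<Sum>b\<in>Basis. X u (\<lambda>w. Y w (?x b)) * cv c u b f) +
      (\<Sum>b\<in>Basis. \<Sum>a\<in>Basis. Y u (?x b) * X u (?x a) * cv c u a (\<lambda>w. cv c w b f))"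
    proof -
      have "Y u (?x b) * X u (\<lambda>w. cv c w b f) =
          (\<Sum>a\<in>Basis. Y u (?x b) * X u (?x a) * cv c u a (\<lambda>w. cv c w b f))" for b
        by (subst tv_expand[OF vf_TS[OF X W(4)] c]) (simp add: sum_distrib_left mult.assoc)
      then show ?thesis by (simp add: sum.distrib)
    qed
    finally show ?thesis .
  qed
  \<comment> \<open>Exchanging the summation indices together with the two coordinate derivatives
    turns one second-order part into the other.\<close>
  have "(\<Sum>b\<in>Basis. \<Sum>a\<in>Basis. Y u (?x b) * X u (?x a) * cv c u a (\<lambda>w. cv c w b f)) =
    (\<Sum>b\<in>Basis. \<Sum>a\<in>Basis. X u (?x b) * Y u (?x a) * cv c u a (\<lambda>w. cv c w b f))"
    by (subst sum.swap) (simp add: cv_commute[OF c True] mult.commute)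
  then show ?thesis
    using True part[OF W(2,3)] part[OF W(3,2)]
    by (simp add: lie_bracket_def left_diff_distrib sum_subtractf)
qed (simp add: lie_bracket_def coord_vec_def)

lemma brk_vf:
  assumes "opn W" "X \<in> vf W" "Y \<in> vf W"
  shows "brk X Y \<in> vf W"
  unfolding vfields_def
proof (intro CollectI conjI ballI allI impI)
  fix u assume u: "u \<in> W"
  then obtain c where c: "c \<in> B" "u \<in> fst c" using open_atlas_carrierD[OF assms(1)] by blast
  have "brk X Y u = (\<lambda>f. \<Sum>b\<in>Basis. (X u (\<lambda>w. Y w (\<lambda>v. snd c v \<bullet> b)) - Y u (\<lambda>w. X w (\<lambda>v. snd c v \<bullet> b)))
    * cv c u b f)"
    using brk_expand[OF assms u c] by blast
  then show "brk X Y u \<in> TS u" using lincomb_TS[OF c, where I = Basis and a = "\<lambda>b. b"] by simp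
next
  fix V f assume V: "opn V \<and> V \<subseteq> W \<and> smth V f"
  then have "smth V (\<lambda>u. X u (\<lambda>w. Y w f) - Y u (\<lambda>w. X w f))"
    using assms by (intro smooth_fun_diff vf_smth[of X W] vf_smth[of Y W]) auto
  then show "smth V (\<lambda>u. brk X Y u f)"
    using V by (subst smooth_fun_cong[where g = "\<lambda>u. X u (\<lambda>w. Y w f) - Y u (\<lambda>w. X w f)"])
      (auto simp: lie_bracket_def nearI)
qed

lemma brk_apply: "near u f \<Longrightarrow> brk X Y u f = X u (\<lambda>w. Y w f) - Y u (\<lambda>w. X w f)"
  by (simp add: lie_bracket_def)

lemma brk_cong:
  assumes "opn W" "X \<in> vf W" "Y \<in> vf W" "u \<in> W"
    "\<And>w. w \<in> W \<Longrightarrow> X w = X' w" "\<And>w. w \<in> W \<Longrightarrow> Y w = Y' w"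
  shows "brk X Y u = brk X' Y' u"
proof
  fix f
  have "X u (\<lambda>w. Y w f) = X u (\<lambda>w. Y' w f)" "Y u (\<lambda>w. X w f) = Y u (\<lambda>w. X' w f)"
    using assms tv_cong[OF vf_TS[OF assms(2,4)] assms(1,4), of "\<lambda>w. Y w f" "\<lambda>w. Y' w f"]
      tv_cong[OF vf_TS[OF assms(3,4)] assms(1,4), of "\<lambda>w. X w f" "\<lambda>w. X' w f"] by auto
  then show "brk X Y u f = brk X' Y' u f"
    using assms(4-6) by (simp add: lie_bracket_def)
qed

text \<open>The bracket obeys a Leibniz rule rather than linearity over functions:
  \<open>S u f * X u g\<close> is the defect that has to cancel in every operator built from
  brackets. If \<open>g\<close> is not smooth near \<open>u\<close>, all terms are 0 by
  convention.\<close>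

lemma brk_lin_right:
  assumes W: "opn W" "S \<in> vf W" "X \<in> vf W" "Y \<in> vf W" "smth W f" "u \<in> W"
  shows "brk S (\<lambda>w g. f w * X w g + Y w g) u g = f u * brk S X u g + S u f * X u g + brk S Y u g"
proof (cases "near u g")
  case True
  note t = vf_TS[OF W(2,6)] vf_TS[OF W(3,6)] vf_TS[OF W(4,6)]
  note n = vf_near[OF W(2,1,6) True] vf_near[OF W(3,1,6) True] vf_near[OF W(4,1,6) True]
  have f: "near u f" using nearI W by blast
  have "S u (\<lambda>w. f w * X w g + Y w g) = f u * S u (\<lambda>w. X w g) + S u f * X u g + S u (\<lambda>w. Y w g)"
    using tv_add[OF t(1) near_mult[OF f n(2)] n(3)] tv_mult[OF t(1) f n(2)] by simp
  then show ?thesis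
    using True by (simp add: brk_apply right_diff_distrib)
next
  case False
  then show ?thesis using tv_far[OF vf_TS[OF W(3,6)]] by (simp add: lie_bracket_def)
qed

lemma brk_antisym: "brk X Y u g = - brk Y X u g"
  by (simp add: lie_bracket_def)

lemma brk_lin_left:
  assumes W: "opn W" "S \<in> vf W" "X \<in> vf W" "Y \<in> vf W" "smth W f" "u \<in> W"
  shows "brk (\<lambda>w g. f w * X w g + Y w g) S u g = f u * brk X S u g - S u f * X u g + brk Y S u g"
  using brk_lin_right[OF W, of g] brk_antisym[of S X u g] brk_antisym[of S Y u g]
    brk_antisym[of S "\<lambda>w g. f w * X w g + Y w g" u g] by (simp add: algebra_simps)

section \<open>Tensorial operators and alternating bilinear forms\<close>

lemma vf_diff:
  assumes "opn W" "X \<in> vf W" "Y \<in> vf W"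
  shows "(\<lambda>w g. X w g - Y w g) \<in> vf W"
  using vf_lin[OF assms(1,3,2), of "\<lambda>u. -1"] by simp

text \<open>The characterisation of a (1,1)-tensor field by linearity over smooth functions; no
  endomorphism of a single tangent space is ever extracted. The congruence clause makes the result
  on \<open>W\<close> depend on the argument only through its values on \<open>W\<close>, so that
  restriction to smaller open sets is harmless.\<close>

definition tensorial :: "'p vform \<Rightarrow> bool" where
  "tensorial K \<longleftrightarrow> (\<forall>W X. opn W \<and> X \<in> vf W \<longrightarrow> K X \<in> vf W \<and>
     (\<forall>Y. (\<forall>u\<in>W. X u = Y u) \<longrightarrow> (\<forall>u\<in>W. K X u = K Y u)) \<and>
     (\<forall>Y f. Y \<in> vf W \<and> smth W f \<longrightarrow>
        (\<forall>u\<in>W. \<forall>g. K (\<lambda>w g. f w * X w g + Y w g) u g = f u * K X u g + K Y u g)))"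

lemma
  assumes "tensorial K" "opn W" "X \<in> vf W"
  shows tensorial_vf: "K X \<in> vf W"
    and tensorial_cong: "(\<And>u. u \<in> W \<Longrightarrow> X u = Y u) \<Longrightarrow> u \<in> W \<Longrightarrow> K X u = K Y u"
    and tensorial_lin: "Y \<in> vf W \<Longrightarrow> smth W f \<Longrightarrow> u \<in> W \<Longrightarrow>
      K (\<lambda>w g. f w * X w g + Y w g) u g = f u * K X u g + K Y u g"
  using assms unfolding tensorial_def by blast+

lemma tensorialI:
  assumes "\<And>W X. opn W \<Longrightarrow> X \<in> vf W \<Longrightarrow> K X \<in> vf W"
    and "\<And>W X Y u. opn W \<Longrightarrow> X \<in> vf W \<Longrightarrow> (\<And>u. u \<in> W \<Longrightarrow> X u = Y u) \<Longrightarrow> u \<in> W \<Longrightarrow> K X u = K Y u"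
    and "\<And>W X Y f u g. opn W \<Longrightarrow> X \<in> vf W \<Longrightarrow> Y \<in> vf W \<Longrightarrow> smth W f \<Longrightarrow> u \<in> W \<Longrightarrow>
      K (\<lambda>w g. f w * X w g + Y w g) u g = f u * K X u g + K Y u g"
  shows "tensorial K"
  unfolding tensorial_def using assms by blast

lemma tensorial_id: "tensorial (\<lambda>X. X)"
  by (rule tensorialI) auto

lemma tensorial_comp:
  assumes "tensorial K" "tensorial L"
  shows "tensorial (\<lambda>X. K (L X))"
proof (rule tensorialI)
  fix W X Y f u g
  assume W: "opn W" "X \<in> vf W" "Y \<in> vf W" "smth W f" "u \<in> W"
  have "K (L (\<lambda>w g. f w * X w g + Y w g)) u = K (\<lambda>w g. f w * L X w g + L Y w g) u"
    by (rule tensorial_cong[OF assms(1) W(1)])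
       (use W in \<open>auto intro!: tensorial_vf[OF assms(2)] vf_lin tensorial_lin[OF assms(2)]\<close>)
  then show "K (L (\<lambda>w g. f w * X w g + Y w g)) u g = f u * K (L X) u g + K (L Y) u g"
    using tensorial_lin[OF assms(1) W(1) tensorial_vf[OF assms(2) W(1,2)] tensorial_vf[OF assms(2) W(1,3)] W(4,5)] by simp
next
  fix W X Y u
  assume W: "opn W" "X \<in> vf W" "\<And>u. u \<in> W \<Longrightarrow> X u = Y u" "u \<in> W"
  show "K (L X) u = K (L Y) u"
    by (rule tensorial_cong[OF assms(1) W(1) tensorial_vf[OF assms(2) W(1,2)] _ W(4)])
       (rule tensorial_cong[OF assms(2) W(1,2,3)])
qed (intro tensorial_vf[OF assms(1)] tensorial_vf[OF assms(2)])

lemma tensorial_lincomb: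
  assumes "tensorial K" "tensorial L"
  shows "tensorial (\<lambda>X u f. a * K X u f + b * L X u f)"
proof (rule tensorialI)
  fix W X assume "opn W" "X \<in> vf W"
  then have "K X \<in> vf W" "L X \<in> vf W" using tensorial_vf[OF assms(1)] tensorial_vf[OF assms(2)] by blast+
  with \<open>opn W\<close> show "(\<lambda>u f. a * K X u f + b * L X u f) \<in> vf W"
    using vf_lin[OF \<open>opn W\<close> _ vf_lin[OF \<open>opn W\<close> _ vf_zero[OF \<open>opn W\<close>]], of "K X" "L X" "\<lambda>u. b" "\<lambda>u. a"]
    by simp
next
  fix W X Y u
  assume W: "opn W" "X \<in> vf W" "\<And>u. u \<in> W \<Longrightarrow> X u = Y u" "u \<in> W"
  show "(\<lambda>f. a * K X u f + b * L X u f) = (\<lambda>f. a * K Y u f + b * L Y u f)"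
    using tensorial_cong[OF assms(1) W] tensorial_cong[OF assms(2) W] by simp
next
  fix W X Y f u g
  assume W: "opn W" "X \<in> vf W" "Y \<in> vf W" "smth W f" "u \<in> W"
  show "a * K (\<lambda>w g. f w * X w g + Y w g) u g + b * L (\<lambda>w g. f w * X w g + Y w g) u g =
      f u * (a * K X u g + b * L X u g) + (a * K Y u g + b * L Y u g)"
    using tensorial_lin[OF assms(1) W] tensorial_lin[OF assms(2) W] by (simp add: algebra_simps)
qed

lemma open_atlas_subset_carrier: "opn W \<Longrightarrow> W \<subseteq> carrier_of B"
  by (simp add: open_in_atlas_iff)

lemma global_vf: "S \<in> vf (carrier_of B) \<Longrightarrow> opn W \<Longrightarrow> S \<in> vf W"
  using vf_mono open_atlas_subset_carrier by blast

text \<open>Both \<open>[S, K(fX)]\<close> and \<open>K [S, fX]\<close> produce the Leibniz term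
  \<open>S(f) K X\<close>, and these cancel in the difference.\<close>

lemma tensorial_lie:
  assumes S: "S \<in> vf (carrier_of B)" and K: "tensorial K"
  shows "tensorial (lie_vform B S K)"
proof (rule tensorialI)
  fix W X assume W: "opn W" "X \<in> vf W"
  show "lie_vform B S K X \<in> vf W"
    unfolding lie_vform_def
    by (intro vf_diff brk_vf tensorial_vf[OF K] global_vf[OF S] W)
next
  fix W X Y u
  assume W: "opn W" "X \<in> vf W" "\<And>u. u \<in> W \<Longrightarrow> X u = Y u" "u \<in> W"
  note SW = global_vf[OF S W(1)]
  have "brk S (K X) u = brk S (K Y) u"
    by (rule brk_cong[OF W(1) SW tensorial_vf[OF K W(1,2)] W(4) refl]) (rule tensorial_cong[OF K W(1-3)])
  moreover have "K (brk S X) u = K (brk S Y) u"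
    by (rule tensorial_cong[OF K W(1) brk_vf[OF W(1) SW W(2)] brk_cong[OF W(1) SW W(2)] W(4)]) (use W in auto)
  ultimately show "lie_vform B S K X u = lie_vform B S K Y u" by (simp add: lie_vform_def)
next
  fix W X Y f u g
  assume W: "opn W" "X \<in> vf W" "Y \<in> vf W" "smth W f" "u \<in> W"
  note SW = global_vf[OF S W(1)]
  let ?Z = "\<lambda>w g. f w * X w g + Y w g"
  note Z = vf_lin[OF W(1-4)]
  note KX = tensorial_vf[OF K W(1,2)] and KY = tensorial_vf[OF K W(1,3)]
  have "brk S (K ?Z) u = brk S (\<lambda>w g. f w * K X w g + K Y w g) u"
    by (rule brk_cong[OF W(1) SW tensorial_vf[OF K W(1) Z] W(5) refl])
       (intro ext tensorial_lin[OF K W(1-4)])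
  then have 1: "brk S (K ?Z) u g = f u * brk S (K X) u g + S u f * K X u g + brk S (K Y) u g"
    using brk_lin_right[OF W(1) SW KX KY W(4,5)] by simp
  \<comment> \<open>The Leibniz term is grouped with the bracket of \<open>Y\<close>, so that
    linearity of \<open>K\<close> can be applied twice in the shape
    \<open>f * X + Y\<close>.\<close>
  let ?b = "\<lambda>w g. S w f * X w g + brk S Y w g"
  have Sf: "smth W (\<lambda>u. S u f)" using vf_smth[OF SW W(1) order_refl W(4)] .
  have b: "?b \<in> vf W" by (intro vf_lin brk_vf SW W Sf)
  have "K (brk S ?Z) u = K (\<lambda>w g. f w * brk S X w g + ?b w g) u"
    by (rule tensorial_cong[OF K W(1) brk_vf[OF W(1) SW Z] _ W(5)])
       (intro ext, simp add: brk_lin_right[OF W(1) SW W(2-4)])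
  moreover have "K (\<lambda>w g. f w * brk S X w g + ?b w g) u g = f u * K (brk S X) u g + K ?b u g"
    by (rule tensorial_lin[OF K W(1) brk_vf[OF W(1) SW W(2)] b W(4,5)])
  moreover have "K ?b u g = S u f * K X u g + K (brk S Y) u g"
    by (rule tensorial_lin[OF K W(1,2) brk_vf[OF W(1) SW W(3)] Sf W(5)])
  ultimately show "lie_vform B S K ?Z u g = f u * lie_vform B S K X u g + lie_vform B S K Y u g"
    unfolding lie_vform_def 1 by (simp add: algebra_simps)
qed

section \<open>1-forms as linear maps over smooth functions\<close>

lemma k_form_1_iff:
  "k_form B 1 \<theta> \<longleftrightarrow> (\<forall>W X. opn W \<and> X \<in> vf W \<longrightarrow>
     (\<forall>Y. (\<forall>u\<in>W. X u = Y u) \<longrightarrow> (\<forall>u\<in>W. \<theta> [X] u = \<theta> [Y] u)) \<and> smth W (\<theta> [X]) \<and>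
     (\<forall>Y f. Y \<in> vf W \<and> smth W f \<longrightarrow>
        (\<forall>u\<in>W. \<theta> [\<lambda>w g. f w * X w g + Y w g] u = f u * \<theta> [X] u + \<theta> [Y] u)))"
  (is "?L \<longleftrightarrow> ?R")
proof
  assume L: ?L
  show ?R
  proof (intro allI impI)
    fix W X assume W: "opn W \<and> X \<in> vf W"
    have 1: "(\<forall>Ys. length Ys = 1 \<and> (\<forall>i<1. \<forall>u\<in>W. ([X] ! i) u = (Ys ! i) u) \<longrightarrow>
          (\<forall>u\<in>W. \<theta> [X] u = \<theta> Ys u)) \<and> smth W (\<theta> [X]) \<and>
        (\<forall>i<1. \<forall>Y\<in>vf W. \<forall>Z\<in>vf W. \<forall>f. smth W f \<longrightarrow>
          (\<forall>u\<in>W. \<theta> ([X][i := (\<lambda>w g. f w * Y w g + Z w g)]) u =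
                 f u * \<theta> ([X][i := Y]) u + \<theta> ([X][i := Z]) u))"
      using L[unfolded k_form_def, rule_format, of W "[X]"] W by auto
    show "(\<forall>Y. (\<forall>u\<in>W. X u = Y u) \<longrightarrow> (\<forall>u\<in>W. \<theta> [X] u = \<theta> [Y] u)) \<and> smth W (\<theta> [X]) \<and>
     (\<forall>Y f. Y \<in> vf W \<and> smth W f \<longrightarrow>
        (\<forall>u\<in>W. \<theta> [\<lambda>w g. f w * X w g + Y w g] u = f u * \<theta> [X] u + \<theta> [Y] u))"
    proof (intro conjI allI impI)
      fix Y assume "\<forall>u\<in>W. X u = Y u"
      then show "\<forall>u\<in>W. \<theta> [X] u = \<theta> [Y] u" using conjunct1[OF 1, rule_format, of "[Y]"] by simp
    qed (use 1 W in auto)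
  qed
next
  assume R: ?R
  show ?L
    unfolding k_form_def
  proof (intro allI impI, elim conjE)
    fix W Xs assume W: "opn W" "length Xs = 1" "set Xs \<subseteq> vf W"
    then obtain X where X: "Xs = [X]" "X \<in> vf W" by (auto simp: length_Suc_conv)
    show "(\<forall>Ys. length Ys = 1 \<and> (\<forall>i<1. \<forall>u\<in>W. (Xs ! i) u = (Ys ! i) u) \<longrightarrow>
          (\<forall>u\<in>W. \<theta> Xs u = \<theta> Ys u)) \<and> smth W (\<theta> Xs) \<and>
        (\<forall>i<1. \<forall>X\<in>vf W. \<forall>Y\<in>vf W. \<forall>f. smth W f \<longrightarrow>
          (\<forall>u\<in>W. \<theta> (Xs[i := (\<lambda>w g. f w * X w g + Y w g)]) u =
                 f u * \<theta> (Xs[i := X]) u + \<theta> (Xs[i := Y]) u)) \<and>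
        (\<forall>i j. i < j \<and> j < 1 \<and> Xs ! i = Xs ! j \<longrightarrow> (\<forall>u\<in>W. \<theta> Xs u = 0))"
      using R W(1) X by (auto simp: length_Suc_conv)
  qed
qed

lemma
  assumes "k_form B 1 \<theta>" "opn W" "X \<in> vf W"
  shows one_form_cong: "(\<And>u. u \<in> W \<Longrightarrow> X u = Y u) \<Longrightarrow> u \<in> W \<Longrightarrow> \<theta> [X] u = \<theta> [Y] u"
    and one_form_smth: "smth W (\<theta> [X])"
    and one_form_lin: "Y \<in> vf W \<Longrightarrow> smth W f \<Longrightarrow> u \<in> W \<Longrightarrow>
      \<theta> [\<lambda>w g. f w * X w g + Y w g] u = f u * \<theta> [X] u + \<theta> [Y] u"
  using assms(1)[unfolded k_form_1_iff] assms(2,3) by blast+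

lemma one_form_add:
  assumes "k_form B 1 \<theta>" "opn W" "X \<in> vf W" "Y \<in> vf W" "u \<in> W"
  shows "\<theta> [\<lambda>w g. X w g + Y w g] u = \<theta> [X] u + \<theta> [Y] u"
  using one_form_lin[OF assms(1-4) smooth_fun_const[of W 1] assms(5)] by simp

lemma one_form_zero:
  assumes "k_form B 1 \<theta>" "opn W" "u \<in> W"
  shows "\<theta> [\<lambda>w g. 0] u = 0"
  using one_form_add[OF assms(1,2) vf_zero[OF assms(2)] vf_zero[OF assms(2)] assms(3)] by simp

lemma one_form_neg:
  assumes "k_form B 1 \<theta>" "opn W" "X \<in> vf W" "u \<in> W"
  shows "\<theta> [\<lambda>w g. - X w g] u = - \<theta> [X] u"
  using one_form_lin[OF assms(1-3) vf_zero[OF assms(2)] smooth_fun_const[of W "-1"] assms(4)] one_form_zero[OF assms(1,2,4)]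
  by simp

lemma one_form_lincomb:
  assumes \<theta>: "k_form B 1 \<theta>" and W: "opn W" "u \<in> W"
    and "\<And>i. i \<in> I \<Longrightarrow> X i \<in> vf W" "\<And>i. i \<in> I \<Longrightarrow> smth W (f i)"
  shows "\<theta> [\<lambda>w g. \<Sum>i\<in>I. f i w * X i w g] u = (\<Sum>i\<in>I. f i u * \<theta> [X i] u)"
  using assms(4,5)
proof (induction I rule: infinite_finite_induct)
  case (insert i I)
  then show ?case
    using one_form_lin[OF \<theta> W(1), of "X i" "\<lambda>w g. \<Sum>i\<in>I. f i w * X i w g" "f i" u]
      vf_lincomb[OF W(1), of I X f] W(2) by simp
qed (simp_all add: one_form_zero[OF \<theta> W])

lemma one_form_near: "k_form B 1 \<theta> \<Longrightarrow> opn W \<Longrightarrow> X \<in> vf W \<Longrightarrow> u \<in> W \<Longrightarrow> near u (\<theta> [X])"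
  using one_form_smth nearI by blast

text \<open>Additivity in the first slot suffices, since antisymmetry transfers it to the second.\<close>

definition alternating :: "'p form \<Rightarrow> bool" where
  "alternating Q \<longleftrightarrow> (\<forall>W X Y. opn W \<and> X \<in> vf W \<and> Y \<in> vf W \<longrightarrow>
     smth W (Q [X, Y]) \<and>
     (\<forall>u\<in>W. Q [Y, X] u = - Q [X, Y] u) \<and>
     (\<forall>Z. (\<forall>u\<in>W. X u = Z u) \<longrightarrow> (\<forall>u\<in>W. Q [X, Y] u = Q [Z, Y] u)) \<and>
     (\<forall>Z f. Z \<in> vf W \<and> smth W f \<longrightarrow>
        (\<forall>u\<in>W. Q [\<lambda>w g. f w * X w g + Z w g, Y] u = f u * Q [X, Y] u + Q [Z, Y] u)))"

lemma
  assumes "alternating Q" "opn W" "X \<in> vf W" "Y \<in> vf W"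
  shows alternating_smth: "smth W (Q [X, Y])"
    and alternating_antisym: "u \<in> W \<Longrightarrow> Q [Y, X] u = - Q [X, Y] u"
    and alternating_cong_left: "(\<And>u. u \<in> W \<Longrightarrow> X u = Z u) \<Longrightarrow> u \<in> W \<Longrightarrow> Q [X, Y] u = Q [Z, Y] u"
    and alternating_lin_left: "Z \<in> vf W \<Longrightarrow> smth W f \<Longrightarrow> u \<in> W \<Longrightarrow>
      Q [\<lambda>w g. f w * X w g + Z w g, Y] u = f u * Q [X, Y] u + Q [Z, Y] u"
  using assms(1)[unfolded alternating_def] assms(2-4) by blast+

lemma alternatingI:
  assumes "\<And>W X Y. opn W \<Longrightarrow> X \<in> vf W \<Longrightarrow> Y \<in> vf W \<Longrightarrow> smth W (Q [X, Y])"
    and "\<And>W X Y u. opn W \<Longrightarrow> X \<in> vf W \<Longrightarrow> Y \<in> vf W \<Longrightarrow> u \<in> W \<Longrightarrow> Q [Y, X] u = - Q [X, Y] u"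
    and "\<And>W X Y Z u. opn W \<Longrightarrow> X \<in> vf W \<Longrightarrow> Y \<in> vf W \<Longrightarrow> Z \<in> vf W \<Longrightarrow>
      (\<And>u. u \<in> W \<Longrightarrow> X u = Z u) \<Longrightarrow> u \<in> W \<Longrightarrow> Q [X, Y] u = Q [Z, Y] u"
    and "\<And>W X Y Z f u. opn W \<Longrightarrow> X \<in> vf W \<Longrightarrow> Y \<in> vf W \<Longrightarrow> Z \<in> vf W \<Longrightarrow> smth W f \<Longrightarrow> u \<in> W \<Longrightarrow>
      Q [\<lambda>w g. f w * X w g + Z w g, Y] u = f u * Q [X, Y] u + Q [Z, Y] u"
  shows "alternating Q"
  unfolding alternating_def
proof (intro allI impI, elim conjE, intro conjI ballI allI impI)
  fix W X Y Z u
  assume W: "opn W" "X \<in> vf W" "Y \<in> vf W" "\<forall>u\<in>W. X u = Z u" "u \<in> W"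
  then have "Z \<in> vf W" using vf_cong_imp[of X W Z] by blast
  then show "Q [X, Y] u = Q [Z, Y] u" using assms(3)[OF W(1-3)] W(4,5) by blast
qed (use assms(1,2,4) in blast)+

lemma alternating_cong_right:
  assumes "alternating Q" "opn W" "X \<in> vf W" "Y \<in> vf W" "\<And>u. u \<in> W \<Longrightarrow> Y u = Z u" "u \<in> W"
  shows "Q [X, Y] u = Q [X, Z] u"
proof -
  have "Z \<in> vf W" using vf_cong_imp[OF assms(4,5)] .
  then show ?thesis
    using alternating_antisym[OF assms(1,2,4,3,6)] alternating_antisym[OF assms(1,2) _ assms(3,6), of Z]
      alternating_cong_left[OF assms(1,2,4,3,5,6)] by simp
qed

lemma alternating_lincomb_left:
  assumes Q: "alternating Q" and W: "opn W" "u \<in> W" "Y \<in> vf W"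
    and "\<And>i. i \<in> I \<Longrightarrow> X i \<in> vf W" "\<And>i. i \<in> I \<Longrightarrow> smth W (f i)"
  shows "Q [\<lambda>w g. \<Sum>i\<in>I. f i w * X i w g, Y] u = (\<Sum>i\<in>I. f i u * Q [X i, Y] u)"
proof -
  have zero: "Q [\<lambda>w g. 0, Y] u = 0"
    using alternating_lin_left[OF Q W(1) vf_zero[OF W(1)] W(3) vf_zero[OF W(1)] smooth_fun_const[of W 1] W(2)] by simp
  show ?thesis
    using assms(5,6)
  proof (induction I rule: infinite_finite_induct)
    case (insert i I)
    then show ?case
      using alternating_lin_left[OF Q W(1) _ W(3), of "X i" "\<lambda>w g. \<Sum>i\<in>I. f i w * X i w g" "f i" u]
        vf_lincomb[OF W(1), of I X f] W(2) by simp
  qed (simp_all add: zero)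
qed

lemma alternating_lincomb_right:
  assumes Q: "alternating Q" and W: "opn W" "u \<in> W" "Y \<in> vf W"
    and X: "\<And>i. i \<in> I \<Longrightarrow> X i \<in> vf W" "\<And>i. i \<in> I \<Longrightarrow> smth W (f i)"
  shows "Q [Y, \<lambda>w g. \<Sum>i\<in>I. f i w * X i w g] u = (\<Sum>i\<in>I. f i u * Q [Y, X i] u)"
proof -
  have "Q [Y, \<lambda>w g. \<Sum>i\<in>I. f i w * X i w g] u = - (\<Sum>i\<in>I. f i u * Q [X i, Y] u)"
  proof -
    have v: "(\<lambda>w g. \<Sum>i\<in>I. f i w * X i w g) \<in> vf W" by (intro vf_lincomb W X)
    have "Q [\<lambda>w g. \<Sum>i\<in>I. f i w * X i w g, Y] u = (\<Sum>i\<in>I. f i u * Q [X i, Y] u)"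
      by (intro alternating_lincomb_left[OF Q W] X)
    then show ?thesis using alternating_antisym[OF Q W(1) v W(3) W(2)] by simp
  qed
  also have "\<dots> = (\<Sum>i\<in>I. f i u * Q [Y, X i] u)"
    unfolding sum_negf[symmetric]
    by (intro sum.cong refl) (simp add: alternating_antisym[OF Q W(1) X(1) W(3) W(2)])
  finally show ?thesis .
qed

text \<open>Both forms expand into the same double sum with the same coefficients, so it is enough
  to compare their values on the frame at the single point \<open>u\<close>.\<close>

lemma alternating_eq_on_frame:
  assumes P: "alternating P" and Q: "alternating Q" and W: "opn W" "u \<in> W"
    and E: "\<And>i. i \<in> I \<Longrightarrow> E i \<in> vf W"
    and X: "X \<in> vf W" "\<And>i. i \<in> I \<Longrightarrow> smth W (a i)" "\<And>w g. w \<in> W \<Longrightarrow> X w g = (\<Sum>i\<in>I. a i w * E i w g)"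
    and Y: "Y \<in> vf W" "\<And>i. i \<in> I \<Longrightarrow> smth W (b i)" "\<And>w g. w \<in> W \<Longrightarrow> Y w g = (\<Sum>i\<in>I. b i w * E i w g)"
    and eq: "\<And>i j. i \<in> I \<Longrightarrow> j \<in> I \<Longrightarrow> P [E i, E j] u = Q [E i, E j] u"
  shows "P [X, Y] u = Q [X, Y] u"
proof -
  have "R [X, Y] u = (\<Sum>i\<in>I. a i u * (\<Sum>j\<in>I. b j u * R [E i, E j] u))" if R: "alternating R" for R
  proof -
    have "R [X, Y] u = R [\<lambda>w g. \<Sum>i\<in>I. a i w * E i w g, Y] u"
      by (rule alternating_cong_left[OF R W(1) X(1) Y(1) _ W(2)]) (intro ext X(3))
    also have "\<dots> = (\<Sum>i\<in>I. a i u * R [E i, Y] u)"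
      by (intro alternating_lincomb_left[OF R W Y(1)] E X(2))
    also have "\<dots> = (\<Sum>i\<in>I. a i u * (\<Sum>j\<in>I. b j u * R [E i, E j] u))"
    proof (intro sum.cong refl)
      fix i assume i: "i \<in> I"
      have "R [E i, Y] u = R [E i, \<lambda>w g. \<Sum>i\<in>I. b i w * E i w g] u"
        by (rule alternating_cong_right[OF R W(1) E[OF i] Y(1) _ W(2)]) (intro ext Y(3))
      also have "\<dots> = (\<Sum>j\<in>I. b j u * R [E i, E j] u)"
        by (intro alternating_lincomb_right[OF R W E[OF i]] E Y(2))
      finally show "a i u * R [E i, Y] u = a i u * (\<Sum>j\<in>I. b j u * R [E i, E j] u)" by simp
    qed
    finally show ?thesis .
  qed
  from this[OF P] this[OF Q] eq show ?thesis by simp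
qed

section \<open>The operators on forms in low degree and their tensoriality\<close>

lemma ext_d_0 [simp]: "ext_d B \<omega> [X] u = X u (\<omega> [])"
  by (simp add: ext_d_def omit_def)

lemma ext_d_1 [simp]: "ext_d B \<omega> [X, Y] u = X u (\<omega> [Y]) - Y u (\<omega> [X]) - \<omega> [brk X Y] u"
  by (simp add: ext_d_def omit_def numeral_2_eq_2)

lemma i_deriv_0 [simp]: "i_deriv K \<omega> [] u = 0"
  by (simp add: i_deriv_def)

lemma i_deriv_1 [simp]: "i_deriv K \<omega> [X] = \<omega> [K X]"
  by (simp add: i_deriv_def fun_eq_iff)

lemma i_deriv_2 [simp]: "i_deriv K \<omega> [X, Y] u = \<omega> [K X, Y] u + \<omega> [X, K Y] u"
  by (simp add: i_deriv_def numeral_2_eq_2)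

lemma lie_form_0 [simp]: "lie_form B X \<omega> [] u = X u (\<omega> [])"
  by (simp add: lie_form_def)

lemma lie_form_1 [simp]: "lie_form B S \<omega> [X] u = S u (\<omega> [X]) - \<omega> [brk S X] u"
  by (simp add: lie_form_def)

lemma lie_form_2 [simp]:
  "lie_form B S \<omega> [X, Y] u = S u (\<omega> [X, Y]) - \<omega> [brk S X, Y] u - \<omega> [X, brk S Y] u"
  by (simp add: lie_form_def numeral_2_eq_2)

lemma d_deriv_1:
  "d_deriv B K \<omega> [X, Y] u = ext_d B \<omega> [K X, Y] u + ext_d B \<omega> [X, K Y] u - ext_d B (i_deriv K \<omega>) [X, Y] u"
  by (simp add: d_deriv_def del: ext_d_1)

text \<open>Replacing \<open>X\<close> by \<open>f X\<close> creates the term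
  \<open>Y(f) \<theta>(X)\<close> twice, from differentiating \<open>\<theta>(f X)\<close> and from
  the bracket with \<open>f X\<close>, with opposite signs.\<close>

lemma alternating_ext_d:
  assumes \<theta>: "k_form B 1 \<theta>"
  shows "alternating (ext_d B \<theta>)"
proof (rule alternatingI)
  fix W X Y assume W: "opn W" "X \<in> vf W" "Y \<in> vf W"
  have "smth W (\<lambda>u. X u (\<theta> [Y]) - Y u (\<theta> [X]) - \<theta> [brk X Y] u)"
    by (intro smooth_fun_diff W(1) vf_smth[OF W(2,1) order_refl] vf_smth[OF W(3,1) order_refl]
        one_form_smth[OF \<theta> W(1)] brk_vf[OF W] W(2,3))
  moreover have "ext_d B \<theta> [X, Y] = (\<lambda>u. X u (\<theta> [Y]) - Y u (\<theta> [X]) - \<theta> [brk X Y] u)"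
    by (rule ext) simp
  ultimately show "smth W (ext_d B \<theta> [X, Y])" by simp
next
  fix W X Y u assume W: "opn W" "X \<in> vf W" "Y \<in> vf W" "u \<in> W"
  have "\<theta> [brk Y X] u = \<theta> [\<lambda>w g. - brk X Y w g] u"
    by (rule one_form_cong[OF \<theta> W(1) brk_vf[OF W(1,3,2)] _ W(4)]) (intro ext, rule brk_antisym)
  also have "\<dots> = - \<theta> [brk X Y] u"
    by (rule one_form_neg[OF \<theta> W(1) brk_vf[OF W(1,2,3)] W(4)])
  finally show "ext_d B \<theta> [Y, X] u = - ext_d B \<theta> [X, Y] u" by simp
next
  fix W X Y Z u assume W: "opn W" "X \<in> vf W" "Y \<in> vf W" "Z \<in> vf W" "\<And>u. u \<in> W \<Longrightarrow> X u = Z u" "u \<in> W"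
  have "\<theta> [brk X Y] u = \<theta> [brk Z Y] u"
    by (rule one_form_cong[OF \<theta> W(1) brk_vf[OF W(1,2,3)] _ W(6)]) (intro brk_cong[OF W(1-3)] W(5) refl)
  moreover have "Y u (\<theta> [X]) = Y u (\<theta> [Z])"
    by (rule tv_cong[OF vf_TS[OF W(3,6)] W(1,6)]) (rule one_form_cong[OF \<theta> W(1,2,5)])
  ultimately show "ext_d B \<theta> [X, Y] u = ext_d B \<theta> [Z, Y] u" using W(5,6) by simp
next
  fix W X Y Z f u assume W: "opn W" "X \<in> vf W" "Y \<in> vf W" "Z \<in> vf W" "smth W f" "u \<in> W"
  let ?L = "\<lambda>w g. f w * X w g + Z w g"
  note t = vf_TS[OF W(3,6)]
  have nf: "near u f" using nearI W by blast
  note nX = one_form_near[OF \<theta> W(1,2,6)] and nZ = one_form_near[OF \<theta> W(1,4,6)]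
  have "Y u (\<theta> [?L]) = Y u (\<lambda>w. f w * \<theta> [X] w + \<theta> [Z] w)"
    by (rule tv_cong[OF t W(1,6)]) (rule one_form_lin[OF \<theta> W(1,2,4,5)])
  also have "\<dots> = f u * Y u (\<theta> [X]) + Y u f * \<theta> [X] u + Y u (\<theta> [Z])"
    using tv_add[OF t near_mult[OF nf nX] nZ] tv_mult[OF t nf nX] by simp
  finally have 1: "Y u (\<theta> [?L]) = f u * Y u (\<theta> [X]) + Y u f * \<theta> [X] u + Y u (\<theta> [Z])" .
  have Yf: "smth W (\<lambda>w. - Y w f)"
    using smooth_fun_diff[OF W(1) smooth_fun_const[of W 0] vf_smth[OF W(3,1) order_refl W(5)]] by simp
  \<comment> \<open>The Leibniz term of the bracket is kept together with \<open>brk Z Y\<close>, so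
    that \<open>one_form_lin\<close> applies to the bracket in two stages.\<close>
  let ?b = "\<lambda>w g. - Y w f * X w g + brk Z Y w g"
  have b: "?b \<in> vf W" by (intro vf_lin brk_vf W Yf)
  have "\<theta> [brk ?L Y] u = \<theta> [\<lambda>w g. f w * brk X Y w g + ?b w g] u"
    by (rule one_form_cong[OF \<theta> W(1) brk_vf[OF W(1) vf_lin[OF W(1,2,4,5)] W(3)] _ W(6)])
       (intro ext, simp add: brk_lin_left[OF W(1,3,2,4,5)])
  moreover have "\<theta> [\<lambda>w g. f w * brk X Y w g + ?b w g] u = f u * \<theta> [brk X Y] u + \<theta> [?b] u"
    by (rule one_form_lin[OF \<theta> W(1) brk_vf[OF W(1,2,3)] b W(5,6)])
  moreover have "\<theta> [?b] u = - Y u f * \<theta> [X] u + \<theta> [brk Z Y] u"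
    by (rule one_form_lin[OF \<theta> W(1,2) brk_vf[OF W(1,4,3)] Yf W(6)])
  ultimately show "ext_d B \<theta> [?L, Y] u = f u * ext_d B \<theta> [X, Y] u + ext_d B \<theta> [Z, Y] u"
    using 1 by (simp add: algebra_simps)
qed

lemma alternating_lincomb:
  assumes P: "alternating P" and Q: "alternating Q"
  shows "alternating (\<lambda>Xs u. a * P Xs u + b * Q Xs u)"
proof (rule alternatingI)
  fix W X Y assume W: "opn W" "X \<in> vf W" "Y \<in> vf W"
  show "smth W (\<lambda>u. a * P [X, Y] u + b * Q [X, Y] u)"
    by (intro smooth_fun_add smooth_fun_mult smooth_fun_const alternating_smth[OF P] alternating_smth[OF Q] W)
next
  fix W X Y u assume W: "opn W" "X \<in> vf W" "Y \<in> vf W" "u \<in> W"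
  show "a * P [Y, X] u + b * Q [Y, X] u = - (a * P [X, Y] u + b * Q [X, Y] u)"
    unfolding alternating_antisym[OF P W] alternating_antisym[OF Q W] by simp
next
  fix W X Y Z u assume W: "opn W" "X \<in> vf W" "Y \<in> vf W" "Z \<in> vf W" "\<And>u. u \<in> W \<Longrightarrow> X u = Z u" "u \<in> W"
  show "a * P [X, Y] u + b * Q [X, Y] u = a * P [Z, Y] u + b * Q [Z, Y] u"
    using alternating_cong_left[OF P W(1-3,5,6)] alternating_cong_left[OF Q W(1-3,5,6)] by simp
next
  fix W X Y Z f u assume W: "opn W" "X \<in> vf W" "Y \<in> vf W" "Z \<in> vf W" "smth W f" "u \<in> W"
  show "a * P [\<lambda>w g. f w * X w g + Z w g, Y] u + b * Q [\<lambda>w g. f w * X w g + Z w g, Y] u =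
      f u * (a * P [X, Y] u + b * Q [X, Y] u) + (a * P [Z, Y] u + b * Q [Z, Y] u)"
    using alternating_lin_left[OF P W] alternating_lin_left[OF Q W] by (simp add: algebra_simps)
qed

lemma alternating_diff: "alternating P \<Longrightarrow> alternating Q \<Longrightarrow> alternating (\<lambda>Xs u. P Xs u - Q Xs u)"
  using alternating_lincomb[of P Q 1 "-1"] by simp

lemma alternating_cmult: "alternating P \<Longrightarrow> alternating (\<lambda>Xs u. k * P Xs u)"
  using alternating_lincomb[of P P k 0] by simp

lemma alternating_zero: "alternating (\<lambda>Xs u. 0)"
  by (rule alternatingI) auto

lemma k_form_i_deriv:
  assumes \<theta>: "k_form B 1 \<theta>" and K: "tensorial K"
  shows "k_form B 1 (i_deriv K \<theta>)"
  unfolding k_form_1_iff i_deriv_1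
proof (intro allI impI conjI)
  fix W X Y assume W: "opn W \<and> X \<in> vf W" and "\<forall>u\<in>W. X u = Y u"
  then show "\<forall>u\<in>W. \<theta> [K X] u = \<theta> [K Y] u"
    using one_form_cong[OF \<theta> _ tensorial_vf[OF K], where W = W and Y = "K Y"] tensorial_cong[OF K, of W X Y] by blast
next
  fix W X assume "opn W \<and> X \<in> vf W"
  then show "smth W (\<theta> [K X])" using one_form_smth[OF \<theta>] tensorial_vf[OF K] by blast
next
  fix W X Y f assume "opn W \<and> X \<in> vf W" "Y \<in> vf W \<and> smth W f"
  then have W: "opn W" "X \<in> vf W" "Y \<in> vf W" "smth W f" by auto
  show "\<forall>u\<in>W. \<theta> [K (\<lambda>w g. f w * X w g + Y w g)] u = f u * \<theta> [K X] u + \<theta> [K Y] u"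
  proof
    fix u assume u: "u \<in> W"
    have "\<theta> [K (\<lambda>w g. f w * X w g + Y w g)] u = \<theta> [\<lambda>w g. f w * K X w g + K Y w g] u"
      by (rule one_form_cong[OF \<theta> W(1) tensorial_vf[OF K W(1) vf_lin[OF W]] _ u]) (intro ext tensorial_lin[OF K W])
    then show "\<theta> [K (\<lambda>w g. f w * X w g + Y w g)] u = f u * \<theta> [K X] u + \<theta> [K Y] u"
      using one_form_lin[OF \<theta> W(1) tensorial_vf[OF K W(1,2)] tensorial_vf[OF K W(1,3)] W(4) u] by simp
  qed
qed

lemma alternating_i_deriv:
  assumes Q: "alternating Q" and K: "tensorial K"
  shows "alternating (i_deriv K Q)"
proof (rule alternatingI)
  fix W X Y assume W: "opn W" "X \<in> vf W" "Y \<in> vf W"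
  have "smth W (\<lambda>u. Q [K X, Y] u + Q [X, K Y] u)"
    by (intro smooth_fun_add alternating_smth[OF Q] tensorial_vf[OF K] W)
  moreover have "i_deriv K Q [X, Y] = (\<lambda>u. Q [K X, Y] u + Q [X, K Y] u)" by (rule ext) simp
  ultimately show "smth W (i_deriv K Q [X, Y])" by simp
next
  fix W X Y u assume W: "opn W" "X \<in> vf W" "Y \<in> vf W" "u \<in> W"
  show "i_deriv K Q [Y, X] u = - i_deriv K Q [X, Y] u"
    using alternating_antisym[OF Q W(1) tensorial_vf[OF K W(1,2)] W(3,4)] alternating_antisym[OF Q W(1,2) tensorial_vf[OF K W(1,3)] W(4)]
    by simp
next
  fix W X Y Z u assume W: "opn W" "X \<in> vf W" "Y \<in> vf W" "Z \<in> vf W" "\<And>u. u \<in> W \<Longrightarrow> X u = Z u" "u \<in> W"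
  show "i_deriv K Q [X, Y] u = i_deriv K Q [Z, Y] u"
    using alternating_cong_left[OF Q W(1) tensorial_vf[OF K W(1,2)] W(3) tensorial_cong[OF K W(1,2,5)] W(6)]
      alternating_cong_left[OF Q W(1,2) tensorial_vf[OF K W(1,3)] W(5,6)] by simp
next
  fix W X Y Z f u assume W: "opn W" "X \<in> vf W" "Y \<in> vf W" "Z \<in> vf W" "smth W f" "u \<in> W"
  let ?L = "\<lambda>w g. f w * X w g + Z w g"
  have "Q [K ?L, Y] u = Q [\<lambda>w g. f w * K X w g + K Z w g, Y] u"
    by (rule alternating_cong_left[OF Q W(1) tensorial_vf[OF K W(1) vf_lin[OF W(1,2,4,5)]] W(3) _ W(6)])
       (intro ext tensorial_lin[OF K W(1,2,4,5)])
  then show "i_deriv K Q [?L, Y] u = f u * i_deriv K Q [X, Y] u + i_deriv K Q [Z, Y] u"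
    using alternating_lin_left[OF Q W(1) tensorial_vf[OF K W(1,2)] W(3) tensorial_vf[OF K W(1,4)] W(5,6)]
      alternating_lin_left[OF Q W(1,2) tensorial_vf[OF K W(1,3)] W(4-6)]
    by (simp add: algebra_simps)
qed

lemma alternating_d_deriv:
  assumes "k_form B 1 \<theta>" "tensorial K"
  shows "alternating (d_deriv B K \<theta>)"
  unfolding d_deriv_def
  by (intro alternating_diff alternating_i_deriv alternating_ext_d k_form_i_deriv assms)

text \<open>The term \<open>S(f) Q(X, Y)\<close> arises from differentiating the value and from the
  bracket in the first slot, and cancels between them.\<close>

lemma alternating_lie_form:
  assumes S: "S \<in> vf (carrier_of B)" and Q: "alternating Q"
  shows "alternating (lie_form B S Q)"
proof (rule alternatingI)
  fix W X Y assume W: "opn W" "X \<in> vf W" "Y \<in> vf W"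
  note SW = global_vf[OF S W(1)]
  have "smth W (\<lambda>u. S u (Q [X, Y]) - Q [brk S X, Y] u - Q [X, brk S Y] u)"
    by (intro smooth_fun_diff vf_smth[OF SW] order_refl alternating_smth[OF Q] brk_vf W SW)
  moreover have "lie_form B S Q [X, Y] = (\<lambda>u. S u (Q [X, Y]) - Q [brk S X, Y] u - Q [X, brk S Y] u)"
    by (rule ext) simp
  ultimately show "smth W (lie_form B S Q [X, Y])" by simp
next
  fix W X Y u assume W: "opn W" "X \<in> vf W" "Y \<in> vf W" "u \<in> W"
  note SW = global_vf[OF S W(1)]
  have "S u (Q [Y, X]) = S u (\<lambda>w. - 1 * Q [X, Y] w)"
    by (rule tv_cong[OF vf_TS[OF SW W(4)] W(1,4)]) (simp add: alternating_antisym[OF Q W(1,2,3)])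
  also have "\<dots> = - S u (Q [X, Y])"
    using tv_cmult[OF vf_TS[OF SW W(4)] nearI[OF W(1,4) alternating_smth[OF Q W(1-3)]], of "-1"] by simp
  finally show "lie_form B S Q [Y, X] u = - lie_form B S Q [X, Y] u"
    using alternating_antisym[OF Q W(1) brk_vf[OF W(1) SW W(2)] W(3,4)] alternating_antisym[OF Q W(1,2) brk_vf[OF W(1) SW W(3)] W(4)]
    by simp
next
  fix W X Y Z u assume W: "opn W" "X \<in> vf W" "Y \<in> vf W" "Z \<in> vf W" "\<And>u. u \<in> W \<Longrightarrow> X u = Z u" "u \<in> W"
  note SW = global_vf[OF S W(1)]
  have "S u (Q [X, Y]) = S u (Q [Z, Y])"
    by (rule tv_cong[OF vf_TS[OF SW W(6)] W(1,6)]) (rule alternating_cong_left[OF Q W(1-3,5)])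
  moreover have "Q [brk S X, Y] u = Q [brk S Z, Y] u"
    by (rule alternating_cong_left[OF Q W(1) brk_vf[OF W(1) SW W(2)] W(3) _ W(6)])
       (intro brk_cong[OF W(1) SW W(2)] refl W(5))
  ultimately show "lie_form B S Q [X, Y] u = lie_form B S Q [Z, Y] u"
    using alternating_cong_left[OF Q W(1,2) brk_vf[OF W(1) SW W(3)] W(5,6)] by simp
next
  fix W X Y Z f u assume W: "opn W" "X \<in> vf W" "Y \<in> vf W" "Z \<in> vf W" "smth W f" "u \<in> W"
  note SW = global_vf[OF S W(1)]
  let ?L = "\<lambda>w g. f w * X w g + Z w g"
  note t = vf_TS[OF SW W(6)]
  have nf: "near u f" using nearI W by blast
  note nX = nearI[OF W(1,6) alternating_smth[OF Q W(1,2,3)]] and nZ = nearI[OF W(1,6) alternating_smth[OF Q W(1,4,3)]]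
  have "S u (Q [?L, Y]) = S u (\<lambda>w. f w * Q [X, Y] w + Q [Z, Y] w)"
    by (rule tv_cong[OF t W(1,6)]) (rule alternating_lin_left[OF Q W(1-5)])
  also have "\<dots> = f u * S u (Q [X, Y]) + S u f * Q [X, Y] u + S u (Q [Z, Y])"
    using tv_add[OF t near_mult[OF nf nX] nZ] tv_mult[OF t nf nX] by simp
  finally have 1: "S u (Q [?L, Y]) = f u * S u (Q [X, Y]) + S u f * Q [X, Y] u + S u (Q [Z, Y])" .
  have Sf: "smth W (\<lambda>w. S w f)" using vf_smth[OF SW W(1) order_refl W(5)] .
  let ?b = "\<lambda>w g. S w f * X w g + brk S Z w g"
  have b: "?b \<in> vf W" by (intro vf_lin brk_vf SW W Sf)
  have "Q [brk S ?L, Y] u = Q [\<lambda>w g. f w * brk S X w g + ?b w g, Y] u"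
    by (rule alternating_cong_left[OF Q W(1) brk_vf[OF W(1) SW vf_lin[OF W(1,2,4,5)]] W(3) _ W(6)])
       (intro ext, simp add: brk_lin_right[OF W(1) SW W(2,4,5)])
  moreover have "Q [\<lambda>w g. f w * brk S X w g + ?b w g, Y] u = f u * Q [brk S X, Y] u + Q [?b, Y] u"
    by (rule alternating_lin_left[OF Q W(1) brk_vf[OF W(1) SW W(2)] W(3) b W(5,6)])
  moreover have "Q [?b, Y] u = S u f * Q [X, Y] u + Q [brk S Z, Y] u"
    by (rule alternating_lin_left[OF Q W(1,2,3) brk_vf[OF W(1) SW W(4)] Sf W(6)])
  ultimately show "lie_form B S Q [?L, Y] u = f u * lie_form B S Q [X, Y] u + lie_form B S Q [Z, Y] u"
    using 1 alternating_lin_left[OF Q W(1,2) brk_vf[OF W(1) SW W(3)] W(4-6)] by (simp add: algebra_simps)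
qed

lemma alternating_add_left:
  assumes "alternating Q" "opn W" "X \<in> vf W" "Z \<in> vf W" "Y \<in> vf W" "u \<in> W"
  shows "Q [\<lambda>w g. X w g + Z w g, Y] u = Q [X, Y] u + Q [Z, Y] u"
  using alternating_lin_left[OF assms(1-3,5,4) smooth_fun_const[of W 1] assms(6)] by simp

lemma alternating_zero_left:
  assumes Q: "alternating Q" and W: "opn W" "Y \<in> vf W" "u \<in> W" and X: "\<And>w g. w \<in> W \<Longrightarrow> X w g = 0"
  shows "Q [X, Y] u = 0"
proof -
  have "Q [\<lambda>w g. 0, Y] u = Q [X, Y] u"
    by (rule alternating_cong_left[OF Q W(1) vf_zero[OF W(1)] W(2) _ W(3)]) (simp add: X fun_eq_iff)
  moreover have "Q [\<lambda>w g. 0, Y] u = 0"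
    using alternating_lincomb_left[OF Q W(1,3,2), where I = "{}"] by simp
  ultimately show ?thesis by simp
qed

lemma alternating_zero_right:
  assumes Q: "alternating Q" and W: "opn W" "Y \<in> vf W" "u \<in> W" and X: "\<And>w g. w \<in> W \<Longrightarrow> X w g = 0"
  shows "Q [Y, X] u = 0"
proof -
  have "X \<in> vf W"
    by (rule vf_cong_imp[OF vf_zero[OF W(1)]]) (simp add: X fun_eq_iff)
  then show ?thesis using alternating_antisym[OF Q W(1) _ W(2,3)] alternating_zero_left[OF assms] by fastforce
qed

lemma tensorial_sum:
  assumes K: "tensorial K" and W: "opn W" "u \<in> W"
    and "\<And>i. i \<in> I \<Longrightarrow> X i \<in> vf W" "\<And>i. i \<in> I \<Longrightarrow> smth W (f i)"
  shows "K (\<lambda>w g. \<Sum>i\<in>I. f i w * X i w g) u g = (\<Sum>i\<in>I. f i u * K (X i) u g)"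
proof -
  have zero: "K (\<lambda>w g. 0) u g = 0"
    using tensorial_lin[OF K W(1) vf_zero[OF W(1)] vf_zero[OF W(1)] smooth_fun_const[of W 1] W(2), of g] by simp
  show ?thesis
    using assms(4,5)
  proof (induction I rule: infinite_finite_induct)
    case (insert i I)
    then show ?case
      using tensorial_lin[OF K W(1), of "X i" "\<lambda>w g. \<Sum>i\<in>I. f i w * X i w g" "f i" u g]
        vf_lincomb[OF W(1), of I X f] W(2) by simp
  qed (simp_all add: zero)
qed

end

section \<open>The slit tangent bundle\<close>

text \<open>A chart is a homeomorphism onto an open subset of the model space, so it carries
  overlaps to sets that are open there and not just relatively open in its image.\<close>

lemma smooth_manifold_atlas:
  fixes A :: "('p, 'e::euclidean_space) atlas"
  assumes "smooth_manifold T A"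
  shows "smooth_atlas A"
proof -
  have c: "openin T (fst c)" "open (snd c ` fst c)"
      "homeomorphic_map (subtopology T (fst c)) (top_of_set (snd c ` fst c)) (snd c)" if "c \<in> A" for c
    using assms that unfolding smooth_manifold_def by auto
  have sub: "topspace (subtopology T (fst c)) = fst c" if "c \<in> A" for c
    using openin_subset[OF c(1)[OF that]] by auto
  show ?thesis
  proof
    fix d assume "d \<in> A"
    then show "inj_on (snd d) (fst d)"
      using homeomorphic_imp_injective_map[OF c(3)] sub by metis
  next
    fix d e assume de: "d \<in> A" "e \<in> A"
    have "openin (subtopology T (fst d)) (fst d \<inter> fst e)"
      using c(1)[OF de(2)] by (auto simp: openin_subtopology)
    then have "openin (top_of_set (snd d ` fst d)) (snd d ` (fst d \<inter> fst e))"
      using homeomorphic_imp_open_map[OF c(3)[OF de(1)]] unfolding open_map_def by blast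
    then show "open (snd d ` (fst d \<inter> fst e))"
      using openin_open_trans c(2)[OF de(1)] by blast
    show "smooth_on (snd d ` (fst d \<inter> fst e)) (snd e \<circ> inv_into (fst d) (snd d))"
      using assms de unfolding smooth_manifold_def by (auto simp: split_beta)
  qed
qed

locale slit_geometry =
  fixes A :: "('m, real^'n) atlas"
  assumes base: "smooth_atlas A"
begin

abbreviation sc :: "('m, real^'n) chart \<Rightarrow> ('m tpt, (real^'n) \<times> (real^'n)) chart" where
  "sc \<equiv> slit_chart A"
abbreviation D :: "('m, real^'n) chart \<Rightarrow> 'm tpt set" where "D c \<equiv> fst (sc c)"
abbreviation dx :: "('m, real^'n) chart \<Rightarrow> 'n \<Rightarrow> 'm tpt vfield" where "dx \<equiv> dx_field A"
abbreviation dy :: "('m, real^'n) chart \<Rightarrow> 'n \<Rightarrow> 'm tpt vfield" where "dy \<equiv> dy_field A"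
abbreviation J :: "'m tpt vform" where "J \<equiv> tangent_structure A"
abbreviation C :: "'m tpt vfield" where "C \<equiv> liouville A"

text \<open>The fibre coordinates of an induced chart, as a vector. At each base point it is inverse
  to \<open>coord_vec A c q\<close>, which gives injectivity and the inverse of the induced
  chart.\<close>

definition vel :: "('m, real^'n) chart \<Rightarrow> 'm tvec \<Rightarrow> real^'n" where
  "vel c w = (\<chi> i. w (\<lambda>q. snd c q $ i))"

lemma vel_coord_vec: "c \<in> A \<Longrightarrow> q \<in> fst c \<Longrightarrow> vel c (coord_vec A c q a) = a"
  using smooth_atlas.cv_coord[OF base _ _ bounded_linear_vec_nth] by (simp add: vel_def vec_eq_iff)

lemma coord_vec_vel:
  assumes "w \<in> tangent_space A q" "c \<in> A" "q \<in> fst c"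
  shows "coord_vec A c q (vel c w) = w"
  using smooth_atlas.TS_obtain[OF base assms] vel_coord_vec[OF assms(2,3)] by metis

lemma coord_vec_eq_0_iff:
  assumes "c \<in> A" "q \<in> fst c"
  shows "coord_vec A c q a = (\<lambda>f. 0) \<longleftrightarrow> a = 0"
proof
  assume "coord_vec A c q a = (\<lambda>f. 0)"
  then have "a = vel c (\<lambda>f. 0)" using vel_coord_vec[OF assms, of a] by simp
  then show "a = 0" by (simp add: vel_def vec_eq_iff)
next
  have "coord_vec A c q 0 f = 0" for f
    using smooth_atlas.cv_lincomb[OF base assms, where I = "{}"] by simp
  then show "coord_vec A c q a = (\<lambda>f. 0)" if "a = 0" using that by (simp add: fun_eq_iff)
qed

lemma mem_D: "u \<in> D c \<longleftrightarrow> fst u \<in> fst c \<and> snd u \<in> tangent_space A (fst u) \<and> snd u \<noteq> (\<lambda>f. 0)"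
  by (cases u) (simp add: slit_chart_def)

lemma snd_sc: "snd (sc c) u = (snd c (fst u), vel c (snd u))"
  by (simp add: slit_chart_def xcoord_def ycoord_def vel_def vec_eq_iff)

lemma sc_inj: "c \<in> A \<Longrightarrow> inj_on (snd (sc c)) (D c)"
proof (rule inj_onI)
  fix u v assume c: "c \<in> A" and uv: "u \<in> D c" "v \<in> D c" "snd (sc c) u = snd (sc c) v"
  have "fst u = fst v"
    by (rule inj_onD[OF smooth_atlas.chart_inj[OF base c]]) (use uv in \<open>simp_all add: mem_D snd_sc\<close>)
  moreover have "snd u = snd v"
  proof -
    have "snd u = coord_vec A c (fst u) (vel c (snd u))" "snd v = coord_vec A c (fst v) (vel c (snd v))"
      using coord_vec_vel[OF _ c] uv by (simp_all add: mem_D)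
    moreover have "vel c (snd u) = vel c (snd v)" using uv(3) by (simp add: snd_sc)
    ultimately show ?thesis using \<open>fst u = fst v\<close> by simp
  qed
  ultimately show "u = v" by (simp add: prod_eq_iff)
qed

text \<open>Removing the zero section corresponds to removing the zero vector from the fibre
  coordinates, as \<open>coord_vec\<close> is injective and linear in them. This product form gives
  openness.\<close>

lemma sc_overlap:
  assumes "c \<in> A" "d \<in> A"
  shows "snd (sc c) ` (D c \<inter> D d) = snd c ` (fst c \<inter> fst d) \<times> - {0}"
proof (intro equalityI subsetI)
  fix z assume "z \<in> snd (sc c) ` (D c \<inter> D d)"
  then obtain u where u: "u \<in> D c" "u \<in> D d" "z = snd (sc c) u" by auto
  have "vel c (snd u) \<noteq> 0"
    using coord_vec_vel[of "snd u" "fst u" c] coord_vec_eq_0_iff[OF assms(1), of "fst u" "vel c (snd u)"] u assms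
    by (auto simp: mem_D)
  then show "z \<in> snd c ` (fst c \<inter> fst d) \<times> - {0}" using u by (auto simp: mem_D snd_sc)
next
  fix z :: "(real^'n) \<times> (real^'n)" assume "z \<in> snd c ` (fst c \<inter> fst d) \<times> - {0}"
  then obtain q and y :: "real^'n" where q: "q \<in> fst c" "q \<in> fst d" "z = (snd c q, y)" "y \<noteq> 0" by auto
  let ?u = "(q, coord_vec A c q y)"
  have "?u \<in> D c \<inter> D d" "z = snd (sc c) ?u"
    using q coord_vec_eq_0_iff[OF assms(1) q(1)] smooth_atlas.cv_TS[OF base assms(1) q(1)]
    by (auto simp: mem_D snd_sc vel_coord_vec[OF assms(1) q(1)])
  then show "z \<in> snd (sc c) ` (D c \<inter> D d)" by blast
qed

lemma sc_inv:
  assumes "c \<in> A" "q \<in> fst c" "(y::real^'n) \<noteq> 0"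
  shows "inv_into (D c) (snd (sc c)) (snd c q, y) = (q, coord_vec A c q y)"
  by (rule inv_into_f_eq[OF sc_inj[OF assms(1)]])
     (use assms coord_vec_eq_0_iff[OF assms(1,2)] smooth_atlas.cv_TS[OF base assms(1,2)]
       in \<open>auto simp: mem_D snd_sc vel_coord_vec[OF assms(1,2)]\<close>)

text \<open>The transition is \<open>(x, y) \<mapsto> (\<tau> x, D\<tau>(x) y)\<close>. Its linear
  dependence on \<open>y\<close> is written as a sum over \<open>Basis\<close>, because smoothness
  of derivatives is available in fixed directions.\<close>

lemma sc_smooth:
  assumes c: "c \<in> A" and d: "d \<in> A"
  shows "smooth_on (snd (sc c) ` (D c \<inter> D d)) (snd (sc d) \<circ> inv_into (D c) (snd (sc c)))"
proof -
  define \<tau> where "\<tau> = snd d \<circ> inv_into (fst c) (snd c)"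
  let ?O = "snd c ` (fst c \<inter> fst d)"
  let ?U = "snd (sc c) ` (D c \<inter> D d)"
  have oO: "open ?O" using smooth_atlas.chart_overlap[OF base c d] .
  have U: "?U = ?O \<times> - {0}" using sc_overlap[OF c d] .
  have oU: "open ?U" unfolding U by (intro open_Times oO) auto
  have st: "smooth_on ?O \<tau>" unfolding \<tau>_def by (rule smooth_atlas.chart_smooth[OF base c d])
  have eq: "(snd (sc d) \<circ> inv_into (D c) (snd (sc c))) z =
      (\<tau> (fst z), 0) + (0, \<Sum>b\<in>Basis. (snd z \<bullet> b) *\<^sub>R frechet_derivative \<tau> (at (fst z)) b)"
    if z: "z \<in> ?U" for z
  proof -
    obtain q and y :: "real^'n" where q: "q \<in> fst c" "q \<in> fst d" "z = (snd c q, y)" "y \<noteq> 0" using z unfolding U by auto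
    have "linear (frechet_derivative \<tau> (at (snd c q)))"
      using smooth_on_has_derivative[OF st] q has_derivative_linear by blast
    then have "(\<Sum>b\<in>Basis. (y \<bullet> b) *\<^sub>R frechet_derivative \<tau> (at (snd c q)) b) =
        frechet_derivative \<tau> (at (snd c q)) (\<Sum>b\<in>Basis. (y \<bullet> b) *\<^sub>R b)"
      by (simp add: linear_sum linear_cmul)
    moreover have "vel d (coord_vec A c q y) = frechet_derivative \<tau> (at (snd c q)) y"
      unfolding smooth_atlas.cv_transition[OF base d c q(2,1)] vel_coord_vec[OF d q(2)] \<tau>_def ..
    ultimately show ?thesis
      using q sc_inv[OF c q(1,4)] smooth_atlas.cinv[OF base c q(1)]
      by (simp add: snd_sc \<tau>_def euclidean_representation)
  qed
  have Oimg: "fst ` ?U \<subseteq> ?O" unfolding U by auto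
  have sf: "smooth_on ?U (fst :: (real^'n) \<times> (real^'n) \<Rightarrow> _)"
    by (rule smooth_on_linear[OF bounded_linear_fst oU])
  have "smooth_on ?U (\<lambda>z. (((\<lambda>x. \<tau> x) \<circ> fst) z, 0 :: real^'n) +
      (0 :: real^'n, \<Sum>b\<in>Basis. (snd z \<bullet> b) *\<^sub>R ((\<lambda>x. frechet_derivative \<tau> (at x) b) \<circ> fst) z))"
  proof (intro smooth_on_add oU)
    show "smooth_on ?U (\<lambda>z. (((\<lambda>x. \<tau> x) \<circ> fst) z, 0 :: real^'n))"
      by (rule smooth_on_linear_image[where L = "\<lambda>x. (x, 0)", OF _ oU smooth_on_compose[OF oU oO Oimg sf]])
         (use st in \<open>auto intro: bounded_linear_Pair bounded_linear_ident bounded_linear_zero\<close>)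
    show "smooth_on ?U (\<lambda>z. (0 :: real^'n,
        \<Sum>b\<in>Basis. (snd z \<bullet> b) *\<^sub>R ((\<lambda>x. frechet_derivative \<tau> (at x) b) \<circ> fst) z))"
    proof (rule smooth_on_linear_image[where L = "\<lambda>x. (0, x)", OF _ oU])
      show "bounded_linear (\<lambda>x. (0 :: real^'n, x :: real^'n))"
        by (intro bounded_linear_Pair bounded_linear_ident bounded_linear_zero)
      show "smooth_on ?U (\<lambda>z. \<Sum>b\<in>Basis. (snd z \<bullet> b) *\<^sub>R ((\<lambda>x. frechet_derivative \<tau> (at x) b) \<circ> fst) z)"
      proof (intro smooth_on_sum smooth_on_scaleR oU)
        fix b :: "real^'n"
        show "smooth_on ?U (\<lambda>z. snd z \<bullet> b)"
          by (intro smooth_on_linear oU bounded_linear_compose[OF bounded_linear_inner_left bounded_linear_snd])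
        show "smooth_on ?U ((\<lambda>x. frechet_derivative \<tau> (at x) b) \<circ> fst)"
          by (rule smooth_on_compose[OF oU oO Oimg sf smooth_on_frechet_derivative[OF st]])
      qed
    qed
  qed
  then show ?thesis
    by (subst smooth_on_cong[OF oU eq]) (simp_all add: o_def)
qed

sublocale smooth_atlas "slit_bundle A"
proof
  fix c assume "c \<in> slit_bundle A"
  then show "inj_on (snd c) (fst c)" using sc_inj by (auto simp: slit_bundle_def)
next
  fix c d assume "c \<in> slit_bundle A" "d \<in> slit_bundle A"
  then obtain c' d' where cd: "c' \<in> A" "d' \<in> A" "c = sc c'" "d = sc d'" by (auto simp: slit_bundle_def)
  show "open (snd c ` (fst c \<inter> fst d))"
    unfolding cd sc_overlap[OF cd(1,2)]
    by (intro open_Times smooth_atlas.chart_overlap[OF base cd(1,2)]) auto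
  show "smooth_on (snd c ` (fst c \<inter> fst d)) (snd d \<circ> inv_into (fst c) (snd c))"
    unfolding cd using sc_smooth[OF cd(1,2)] .
qed

lemma sc_mem [simp]: "c \<in> A \<Longrightarrow> sc c \<in> slit_bundle A"
  by (simp add: slit_bundle_def)

lemma open_atlas_D: "c \<in> A \<Longrightarrow> opn (D c)"
  by (simp add: open_atlas_chart)

lemma D_obtain:
  assumes "u \<in> slit_points A"
  obtains c where "c \<in> A" "u \<in> D c"
  using assms by (auto simp: carrier_of_iff slit_bundle_def)

lemma D_carrier: "c \<in> A \<Longrightarrow> u \<in> D c \<Longrightarrow> u \<in> slit_points A"
  unfolding carrier_of_iff by (rule bexI[OF _ sc_mem])

lemma xcoord_eq: "xcoord c i = (\<lambda>u. fst (snd (sc c) u) $ i)"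
  by (simp add: snd_sc xcoord_def fun_eq_iff)

lemma ycoord_eq: "ycoord c i = (\<lambda>u. snd (snd (sc c) u) $ i)"
  by (simp add: snd_sc ycoord_def vel_def fun_eq_iff)

lemma bounded_linear_fst_nth: "bounded_linear (\<lambda>z::(real^'n)\<times>(real^'n). fst z $ i)"
  by (rule bounded_linear_compose[OF bounded_linear_vec_nth bounded_linear_fst])

lemma bounded_linear_snd_nth: "bounded_linear (\<lambda>z::(real^'n)\<times>(real^'n). snd z $ i)"
  by (rule bounded_linear_compose[OF bounded_linear_vec_nth bounded_linear_snd])

lemma x_smth: "c \<in> A \<Longrightarrow> smth (D c) (xcoord c i)"
  unfolding xcoord_eq by (rule smooth_fun_coord[OF sc_mem bounded_linear_fst_nth])

lemma y_smth: "c \<in> A \<Longrightarrow> smth (D c) (ycoord c i)"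
  unfolding ycoord_eq by (rule smooth_fun_coord[OF sc_mem bounded_linear_snd_nth])

lemma x_near: "c \<in> A \<Longrightarrow> u \<in> D c \<Longrightarrow> near u (xcoord c i)"
  by (rule nearI[OF open_atlas_D _ x_smth])

lemma y_near: "c \<in> A \<Longrightarrow> u \<in> D c \<Longrightarrow> near u (ycoord c i)"
  by (rule nearI[OF open_atlas_D _ y_smth])

section \<open>Coordinate fields of one induced chart\<close>

context
  fixes c assumes c: "c \<in> A"
begin

lemma dx_vf: "dx c i \<in> vf (D c)"
  unfolding dx_field_def by (rule vf_cv) (simp add: c)

lemma dy_vf: "dy c i \<in> vf (D c)"
  unfolding dy_field_def by (rule vf_cv) (simp add: c)

lemma dx_x: "u \<in> D c \<Longrightarrow> dx c k u (xcoord c i) = (if k = i then 1 else 0)"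
  and dx_y: "u \<in> D c \<Longrightarrow> dx c k u (ycoord c i) = 0"
  and dy_x: "u \<in> D c \<Longrightarrow> dy c k u (xcoord c i) = 0"
  and dy_y: "u \<in> D c \<Longrightarrow> dy c k u (ycoord c i) = (if k = i then 1 else 0)"
  by (simp_all add: xcoord_eq ycoord_eq dx_field_def dy_field_def c axis_def
      cv_coord[OF sc_mem[OF c] _ bounded_linear_fst_nth] cv_coord[OF sc_mem[OF c] _ bounded_linear_snd_nth])

lemma tv_frame:
  assumes t: "t \<in> TS u" and u: "u \<in> D c"
  shows "t f = (\<Sum>k\<in>UNIV. t (xcoord c k) * dx c k u f) + (\<Sum>k\<in>UNIV. t (ycoord c k) * dy c k u f)"
proof -
  obtain a where a: "t = cv (sc c) u a" using TS_obtain[OF t sc_mem[OF c] u] .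
  let ?a = "\<Sum>k\<in>UNIV. (fst a $ k) *\<^sub>R (axis k 1, 0 :: real^'n)"
  let ?b = "\<Sum>k\<in>UNIV. (snd a $ k) *\<^sub>R (0 :: real^'n, axis k 1)"
  have ab: "a = ?a + ?b"
    by (simp add: prod_eq_iff fst_sum snd_sum vec_eq_iff axis_def if_distrib cong: if_cong)
  have "cv (sc c) u (?a + ?b) f = cv (sc c) u ?a f + cv (sc c) u ?b f"
    using cv_lincomb[OF sc_mem[OF c] u, where I = "{True, False}" and k = "\<lambda>_. 1" and a = "\<lambda>i. if i then ?a else ?b"]
    by simp
  then have "t f = (\<Sum>k\<in>UNIV. fst a $ k * dx c k u f) + (\<Sum>k\<in>UNIV. snd a $ k * dy c k u f)"
    unfolding a ab[symmetric] cv_lincomb[OF sc_mem[OF c] u] dx_field_def dy_field_def by simp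
  moreover have "t (xcoord c k) = fst a $ k" "t (ycoord c k) = snd a $ k" for k
    unfolding a xcoord_eq ycoord_eq
    using cv_coord[OF sc_mem[OF c] u bounded_linear_fst_nth] cv_coord[OF sc_mem[OF c] u bounded_linear_snd_nth] by auto
  ultimately show ?thesis by simp
qed

text \<open>As in the definition of \<open>vertical\<close>, \<open>g\<close> is an arbitrary
  function on the base, so there is no derivative of \<open>g\<close> to which a chain rule could
  apply. Instead the coordinate expression is restricted to a line in the fibre direction, where it
  is locally constant; if the composite is not smooth near \<open>u\<close>, the value is the
  default 0.\<close>

lemma dy_comp_fst:
  assumes u: "u \<in> D c"
  shows "dy c k u (g \<circ> fst) = 0"
proof (cases "near u (g \<circ> fst)")
  case True
  define F where "F = (g \<circ> fst) \<circ> cinv (sc c)"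
  define z where "z = snd (sc c) u"
  define e where "e = (0 :: real^'n, axis k (1::real) :: real^'n)"
  define F' where "F' = frechet_derivative F (at z)"
  have F: "(F has_derivative F') (at z)"
    unfolding F_def F'_def z_def by (rule near_has_derivative[OF True sc_mem[OF c] u])
  have "((\<lambda>s::real. z + s *\<^sub>R e) has_derivative (\<lambda>s. s *\<^sub>R e)) (at 0)"
    by (auto intro!: derivative_eq_intros)
  from has_derivative_compose[OF this, of F F'] F
  have 1: "((\<lambda>s. F (z + s *\<^sub>R e)) has_derivative (\<lambda>s. F' (s *\<^sub>R e))) (at 0)" by simp
  have val: "F z' = g (inv_into (fst c) (snd c) (fst z'))" if "z' \<in> snd (sc c) ` D c" for z'
  proof -
    from that obtain v where v: "v \<in> D c" "z' = snd (sc c) v" by blast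
    have "F z' = g (fst v)" using cinv[OF sc_mem[OF c] v(1)] by (simp add: F_def v(2))
    moreover have "inv_into (fst c) (snd c) (fst z') = fst v"
      using v smooth_atlas.cinv[OF base c, of "fst v"] by (simp add: snd_sc mem_D)
    ultimately show ?thesis by simp
  qed
  let ?O = "(\<lambda>s::real. z + s *\<^sub>R e) -` (snd (sc c) ` D c)"
  have oO: "open ?O"
    by (rule open_vimage) (use chart_overlap[OF sc_mem[OF c] sc_mem[OF c]] in \<open>auto intro!: continuous_intros\<close>)
  have "((\<lambda>s. F (z + s *\<^sub>R e)) has_derivative (\<lambda>s. 0)) (at 0)"
  proof (rule has_derivative_transform_within_open[OF has_derivative_const oO])
    show "(0::real) \<in> ?O" using u by (simp add: z_def)
  next
    fix s assume "s \<in> ?O"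
    then show "F z = F (z + s *\<^sub>R e)"
      using val[of z] val[of "z + s *\<^sub>R e"] u by (simp add: z_def e_def)
  qed
  from has_derivative_unique[OF 1 this] have "F' (1 *\<^sub>R e) = 0" by meson
  then show ?thesis using True by (simp add: dy_field_def coord_vec_def F'_def F_def z_def e_def)
next
  case False
  then show ?thesis by (simp add: dy_field_def coord_vec_def)
qed

end

section \<open>Change of induced chart, and chart independence of \<open>J\<close> and
  \<open>C\<close>\<close>

lemma xcoord_comp: "xcoord d i = (\<lambda>q. snd d q $ i) \<circ> fst"
  by (simp add: xcoord_def fun_eq_iff)

text \<open>This is the Jacobian entry of the base transition. The right-hand side involves
  \<open>u\<close> only through \<open>fst u\<close>, so its derivatives along the fibre vanish, as
  \<open>dy_ycoord_change\<close> requires.\<close>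

lemma dx_xcoord:
  assumes c: "c \<in> A" and d: "d \<in> A" and u: "u \<in> D c" "u \<in> D d"
  shows "dx c k u (xcoord d i) = coord_vec A c (fst u) (axis k 1) (\<lambda>q. snd d q $ i)"
proof -
  define h where "h = (\<lambda>q. snd d q $ i) \<circ> inv_into (fst c) (snd c)"
  have q: "fst u \<in> fst c" "fst u \<in> fst d" using u by (auto simp: mem_D)
  have nr: "smooth_near A (fst u) (\<lambda>q. snd d q $ i)"
    using smooth_atlas.near_coord[OF base d q(2) bounded_linear_vec_nth] .
  have h: "(h has_derivative frechet_derivative h (at (snd c (fst u)))) (at (snd c (fst u)))"
    unfolding h_def by (rule smooth_atlas.near_has_derivative[OF base nr c q(1)])
  have 1: "((\<lambda>z. h (fst z)) has_derivative (\<lambda>z. frechet_derivative h (at (snd c (fst u))) (fst z)))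
      (at (snd (sc c) u))"
    by (rule has_derivative_compose[OF bounded_linear_imp_has_derivative[OF bounded_linear_fst]])
       (use h in \<open>simp add: snd_sc\<close>)
  have "(xcoord d i \<circ> cinv (sc c) has_derivative (\<lambda>z. frechet_derivative h (at (snd c (fst u))) (fst z)))
      (at (snd (sc c) u))"
  proof (rule has_derivative_transform_within_open[OF 1 chart_overlap[OF sc_mem[OF c] sc_mem[OF c]]])
    fix z assume "z \<in> snd (sc c) ` (D c \<inter> D c)"
    then obtain v where v: "v \<in> D c" "z = snd (sc c) v" by auto
    then show "h (fst z) = (xcoord d i \<circ> cinv (sc c)) z"
      using cinv[OF sc_mem[OF c] v(1)] smooth_atlas.cinv[OF base c, of "fst v"]
      by (auto simp: h_def xcoord_def mem_D snd_sc)
  qed (use u in auto)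
  from cv_eqI[OF x_near[OF d u(2)] sc_mem[OF c] u(1) this]
  show ?thesis using nr by (simp add: dx_field_def coord_vec_def h_def)
qed

context
  fixes c d u
  assumes cd: "c \<in> A" "d \<in> A" and u: "u \<in> D c" "u \<in> D d"
begin

lemma tv_xcoord_change:
  "t \<in> TS u \<Longrightarrow> t (xcoord d i) = (\<Sum>k\<in>UNIV. t (xcoord c k) * dx c k u (xcoord d i))"
  using tv_frame[OF cd(1) _ u(1), of t "xcoord d i"] dy_comp_fst[OF cd(1) u(1)] by (simp add: xcoord_comp)

lemma ycoord_change: "ycoord d i u = (\<Sum>k\<in>UNIV. ycoord c k u * dx c k u (xcoord d i))"
proof -
  have q: "fst u \<in> fst c" "fst u \<in> fst d" "snd u \<in> tangent_space A (fst u)" using u by (auto simp: mem_D)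
  have "snd u = coord_vec A c (fst u) (\<Sum>k\<in>UNIV. ycoord c k u *\<^sub>R axis k 1)"
  proof -
    have "(\<Sum>k\<in>UNIV. ycoord c k u *\<^sub>R axis k 1) = vel c (snd u)"
      by (simp add: vec_eq_iff axis_def vel_def ycoord_def if_distrib cong: if_cong)
    then show ?thesis using coord_vec_vel[OF q(3) cd(1) q(1)] by simp
  qed
  then have "ycoord d i u = coord_vec A c (fst u) (\<Sum>k\<in>UNIV. ycoord c k u *\<^sub>R axis k 1) (\<lambda>q. snd d q $ i)"
    by (simp add: ycoord_def[of d])
  then show ?thesis
    by (simp add: smooth_atlas.cv_lincomb[OF base cd(1) q(1)] dx_xcoord[OF cd u])
qed

end

text \<open>The law \<open>ycoord_change\<close> is differentiated along the fibre: the Jacobian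
  entries are constant there, so only the fibre coordinates contribute.\<close>

lemma dy_ycoord_change:
  assumes cd: "c \<in> A" "d \<in> A" and u: "u \<in> D c" "u \<in> D d"
  shows "dy c k u (ycoord d i) = dx c k u (xcoord d i)"
proof -
  let ?h = "\<lambda>j w. coord_vec A c (fst w) (axis j 1) (\<lambda>q. snd d q $ i)"
  have t: "dy c k u \<in> TS u" using vf_TS[OF dy_vf[OF cd(1)] u(1)] .
  have dh: "dy c k u (\<lambda>w. dx c j w (xcoord d i)) = 0" for j
  proof -
    have "dy c k u (\<lambda>w. dx c j w (xcoord d i)) =
        dy c k u ((\<lambda>q. coord_vec A c q (axis j 1) (\<lambda>q. snd d q $ i)) \<circ> fst)"
      by (rule tv_cong[OF t open_atlas_Int[OF open_atlas_D[OF cd(1)] open_atlas_D[OF cd(2)]]]) (use u dx_xcoord[OF cd] in auto)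
    then show ?thesis using dy_comp_fst[OF cd(1) u(1)] by simp
  qed
  have nh: "near u (\<lambda>w. dx c j w (xcoord d i))" for j
    by (rule vf_near[OF dx_vf[OF cd(1)] open_atlas_D[OF cd(1)] u(1) x_near[OF cd(2) u(2)]])
  have "dy c k u (ycoord d i) = dy c k u (\<lambda>w. \<Sum>j\<in>UNIV. ycoord c j w * dx c j w (xcoord d i))"
    by (rule tv_cong[OF t open_atlas_Int[OF open_atlas_D[OF cd(1)] open_atlas_D[OF cd(2)]]]) (use u ycoord_change[OF cd] in auto)
  also have "\<dots> = (\<Sum>j\<in>UNIV. dy c k u (\<lambda>w. ycoord c j w * dx c j w (xcoord d i)))"
    by (rule tv_sum[OF t]) (intro near_mult nh y_near[OF cd(1) u(1)])
  also have "\<dots> = (\<Sum>j\<in>UNIV. if k = j then dx c j u (xcoord d i) else 0)"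
    by (intro sum.cong refl) (simp add: tv_mult[OF t y_near[OF cd(1) u(1)] nh] dh dy_y[OF cd(1) u(1)])
  finally show ?thesis by simp
qed

lemma dy_change:
  assumes cd: "c \<in> A" "d \<in> A" and u: "u \<in> D c" "u \<in> D d"
  shows "dy c k u f = (\<Sum>i\<in>UNIV. dx c k u (xcoord d i) * dy d i u f)"
  using tv_frame[OF cd(2) vf_TS[OF dy_vf[OF cd(1)] u(1)] u(2), of k f] dy_comp_fst[OF cd(1) u(1)]
  by (simp add: dy_ycoord_change[OF cd u] xcoord_comp)

text \<open>Any coefficients that transform by the base Jacobian define the same vertical vector in
  both charts. This serves \<open>J\<close> and \<open>C\<close> at once.\<close>

lemma vertical_lift_change:
  assumes cd: "c \<in> A" "d \<in> A" and u: "u \<in> D c" "u \<in> D d"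
    and a: "\<And>i. b i = (\<Sum>k\<in>UNIV. a k * dx c k u (xcoord d i))"
  shows "(\<Sum>i\<in>UNIV. b i * dy d i u f) = (\<Sum>k\<in>UNIV. a k * dy c k u f)"
proof -
  have "(\<Sum>i\<in>UNIV. b i * dy d i u f) = (\<Sum>i\<in>UNIV. \<Sum>k\<in>UNIV. a k * (dx c k u (xcoord d i) * dy d i u f))"
    by (simp add: a sum_distrib_right mult.assoc)
  also have "\<dots> = (\<Sum>k\<in>UNIV. a k * dy c k u f)"
    by (subst sum.swap) (simp add: dy_change[OF cd u] sum_distrib_left)
  finally show ?thesis .
qed

lemma chart_at:
  assumes "c \<in> A" "u \<in> D c"
  shows "chart_at A (fst u) \<in> A" "u \<in> D (chart_at A (fst u))"
proof -
  have "chart_at A (fst u) \<in> A \<and> fst u \<in> fst (chart_at A (fst u))"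
    unfolding chart_at_def by (rule someI[of _ c]) (use assms in \<open>auto simp: mem_D\<close>)
  then show "chart_at A (fst u) \<in> A" "u \<in> D (chart_at A (fst u))" using assms by (auto simp: mem_D)
qed

text \<open>Removes the arbitrary choice made by \<open>chart_at\<close>: from here on
  \<open>J\<close> may be computed in any induced chart.\<close>

lemma J_eq:
  assumes "c \<in> A" "u \<in> D c" "X u \<in> TS u"
  shows "J X u f = (\<Sum>k\<in>UNIV. X u (xcoord c k) * dy c k u f)"
  unfolding tangent_structure_def Let_def
  using vertical_lift_change[OF assms(1) chart_at(1)[OF assms(1,2)] assms(2) chart_at(2)[OF assms(1,2)]]
    tv_xcoord_change[OF assms(1) chart_at(1)[OF assms(1,2)] assms(2) chart_at(2)[OF assms(1,2)] assms(3)]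
  by simp

lemma C_eq:
  assumes "c \<in> A" "u \<in> D c"
  shows "C u f = (\<Sum>k\<in>UNIV. ycoord c k u * dy c k u f)"
  unfolding liouville_def Let_def
  using vertical_lift_change[OF assms(1) chart_at(1)[OF assms(1,2)] assms(2) chart_at(2)[OF assms(1,2)]]
    ycoord_change[OF assms(1) chart_at(1)[OF assms(1,2)] assms(2) chart_at(2)[OF assms(1,2)]]
  by simp

lemma vf_from_charts:
  assumes "opn W" "\<And>c. c \<in> A \<Longrightarrow> \<exists>Y\<in>vf (W \<inter> D c). \<forall>u\<in>W \<inter> D c. Y u = X u"
  shows "X \<in> vf W"
proof (rule vf_local)
  fix u assume u: "u \<in> W"
  then obtain c where c: "c \<in> A" "u \<in> D c"
    using D_obtain[of u] open_atlas_subset_carrier[OF assms(1)] by blast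
  from assms(2)[OF c(1)] obtain Y where "Y \<in> vf (W \<inter> D c)" "\<And>u. u \<in> W \<inter> D c \<Longrightarrow> Y u = X u" by blast
  then have "X \<in> vf (W \<inter> D c)" by (rule vf_cong_imp)
  then show "\<exists>V. opn V \<and> u \<in> V \<and> X \<in> vf V"
    using open_atlas_Int[OF assms(1) open_atlas_D[OF c(1)]] u c(2) by blast
qed

lemma tensorial_J: "tensorial J"
proof (rule tensorialI)
  fix W X assume W: "opn W" "X \<in> vf W"
  show "J X \<in> vf W"
  proof (rule vf_from_charts[OF W(1)])
    fix c assume c: "c \<in> A"
    let ?V = "W \<inter> D c"
    note oV = open_atlas_Int[OF W(1) open_atlas_D[OF c]]
    let ?Y = "\<lambda>w f. \<Sum>k\<in>UNIV. X w (xcoord c k) * dy c k w f"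
    have "?Y \<in> vf ?V"
    proof (rule vf_lincomb[OF oV])
      fix k
      show "dy c k \<in> vf ?V" by (rule vf_mono[OF dy_vf[OF c]]) auto
      show "smth ?V (\<lambda>w. X w (xcoord c k))"
        by (rule vf_smth[OF W(2) oV Int_lower1 smooth_fun_mono[OF x_smth[OF c] Int_lower2]])
    qed
    moreover have "?Y u = J X u" if "u \<in> ?V" for u
      by (rule ext, rule J_eq[OF c, symmetric]) (use vf_TS[OF W(2), of u] that in simp_all)
    ultimately show "\<exists>Y\<in>vf ?V. \<forall>u\<in>?V. Y u = J X u" by (intro bexI[of _ ?Y] ballI)
  qed
qed (simp_all add: tangent_structure_def Let_def sum_distrib_left sum.distrib distrib_right mult.assoc)

lemma C_vf: "C \<in> vf (slit_points A)"
proof (rule vf_from_charts[OF open_atlas_carrier])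
  fix c assume c: "c \<in> A"
  have eq: "slit_points A \<inter> D c = D c" using D_carrier[OF c] by auto
  let ?Y = "\<lambda>w f. \<Sum>k\<in>UNIV. ycoord c k w * dy c k w f"
  have "?Y \<in> vf (D c)"
    by (intro vf_lincomb open_atlas_D dy_vf y_smth c)
  moreover have "?Y u = C u" if "u \<in> D c" for u
    by (rule ext) (rule C_eq[OF c that, symmetric])
  ultimately show "\<exists>Y\<in>vf (slit_points A \<inter> D c). \<forall>u\<in>slit_points A \<inter> D c. Y u = C u"
    unfolding eq by (intro bexI[of _ ?Y] ballI)
qed

lemma C_x: "c \<in> A \<Longrightarrow> u \<in> D c \<Longrightarrow> C u (xcoord c i) = 0"
  by (simp add: C_eq dy_x)

lemma C_y: "c \<in> A \<Longrightarrow> u \<in> D c \<Longrightarrow> C u (ycoord c i) = ycoord c i u"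
  by (simp add: C_eq dy_y if_distrib cong: if_cong)

end

section \<open>The adapted frame of a spray\<close>

lemma sum_UNIV_Plus: "(\<Sum>j\<in>UNIV. h j) = (\<Sum>i\<in>UNIV. h (Inl i)) + (\<Sum>i\<in>UNIV. h (Inr i))"
  for h :: "'a::finite + 'b::finite \<Rightarrow> real"
  unfolding UNIV_Plus_UNIV[symmetric] by (subst sum.Plus) (auto simp: o_def)

locale spray_geometry = slit_geometry A for A :: "('m, real^'n) atlas" +
  fixes S :: "'m tpt vfield"
  assumes spray: "spray A S"
begin

lemma S_vf: "S \<in> vf (slit_points A)"
  using spray by (simp add: spray_def semispray_def)

lemma S_vfW: "opn W \<Longrightarrow> S \<in> vf W"
  by (rule global_vf[OF S_vf])

text \<open>In an induced chart \<open>[S, \<partial>/\<partial>y\<^sup>i] = - \<partial>/\<partial>x\<^sup>i + 2 N\<^sup>k\<^sub>i \<partial>/\<partial>y\<^sup>k\<close> with \<open>N\<^sup>k\<^sub>i = \<partial>G\<^sup>k/\<partial>y\<^sup>i\<close>, so the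
  coefficients of the connection can be read off a bracket without naming the functions \<open>G\<^sup>k\<close>.
  The field \<open>H c i\<close> is \<open>\<delta>/\<delta>x\<^sup>i\<close>; its odd shape \<open>f * X + Y\<close> is the one in which linearity over
  functions is stated.\<close>

definition N :: "('m, real^'n) chart \<Rightarrow> 'n \<Rightarrow> 'n \<Rightarrow> 'm tpt \<Rightarrow> real" where
  "N c i k u = brk S (dy c i) u (ycoord c k) / 2"

definition H :: "('m, real^'n) chart \<Rightarrow> 'n \<Rightarrow> 'm tpt vfield" where
  "H c i = (\<lambda>u f. - 1 * (\<Sum>k\<in>UNIV. N c i k u * dy c k u f) + dx c i u f)"

abbreviation LJ :: "'m tpt vform" where "LJ \<equiv> lie_vform (slit_bundle A) S J"
abbreviation hr :: "'m tpt vform" where "hr \<equiv> hor A S"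
abbreviation vr :: "'m tpt vform" where "vr \<equiv> ver A S"
abbreviation FJ :: "'m tpt vform" where "FJ \<equiv> F_plus_J A S"
abbreviation \<Phi> :: "'m tpt vform" where "\<Phi> \<equiv> jacobi_endo A S"
abbreviation \<Psi> :: "'m tpt vform" where "\<Psi> \<equiv> \<lambda>X w f. FJ X w f - \<Phi> X w f"

lemma tensorial_LJ: "tensorial LJ"
  by (rule tensorial_lie[OF S_vf tensorial_J])

lemma hor_alt: "hr = (\<lambda>X u f. (1/2) * X u f + (- 1/2) * LJ X u f)"
  by (simp add: hor_def fun_eq_iff field_simps)

lemma ver_alt: "vr = (\<lambda>X u f. (1/2) * X u f + (1/2) * LJ X u f)"
  by (simp add: ver_def fun_eq_iff field_simps)

lemma tensorial_hor: "tensorial hr"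
  unfolding hor_alt by (rule tensorial_lincomb[OF tensorial_id tensorial_LJ])

lemma tensorial_ver: "tensorial vr"
  unfolding ver_alt by (rule tensorial_lincomb[OF tensorial_id tensorial_LJ])

lemma ver_hor: "vr X u f = X u f - hr X u f"
  by (simp add: ver_def hor_def field_simps)

lemma FJ_alt: "FJ = (\<lambda>X. hr (lie_vform (slit_bundle A) S hr X))"
  by (simp add: F_plus_J_def almost_complex_def fun_eq_iff)

lemma \<Phi>_alt: "\<Phi> = (\<lambda>X. vr (lie_vform (slit_bundle A) S hr X))"
  by (simp add: jacobi_endo_def fun_eq_iff)

lemma tensorial_FJ: "tensorial FJ"
  unfolding FJ_alt by (rule tensorial_comp[OF tensorial_hor tensorial_lie[OF S_vf tensorial_hor]])

lemma tensorial_\<Phi>: "tensorial \<Phi>"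
  unfolding \<Phi>_alt by (rule tensorial_comp[OF tensorial_ver tensorial_lie[OF S_vf tensorial_hor]])

lemma tensorial_\<Psi>: "tensorial \<Psi>"
  using tensorial_lincomb[OF tensorial_FJ tensorial_\<Phi>, of 1 "-1"] by simp

lemma alternating_dyn_cov:
  assumes "alternating Q" shows "alternating (dyn_cov A S Q)"
  unfolding dyn_cov_def by (rule alternating_diff[OF alternating_lie_form[OF S_vf assms] alternating_i_deriv[OF assms tensorial_\<Psi>]])

section \<open>Brackets with the spray and the two projectors, in one induced chart\<close>

context
  fixes c assumes c: "c \<in> A"
begin

lemma tv_congD: "t \<in> TS u \<Longrightarrow> u \<in> D c \<Longrightarrow> (\<And>w. w \<in> D c \<Longrightarrow> f w = g w) \<Longrightarrow> t f = t g"
  by (rule tv_cong[OF _ open_atlas_D[OF c]])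

lemma tv_constD: "t \<in> TS u \<Longrightarrow> u \<in> D c \<Longrightarrow> (\<And>w. w \<in> D c \<Longrightarrow> f w = k) \<Longrightarrow> t f = 0"
  using tv_congD[of t u f "\<lambda>w. k"] by simp

lemma S_D: "S \<in> vf (D c)"
  by (rule S_vfW[OF open_atlas_D[OF c]])

lemmas dxT = vf_TS[OF dx_vf[OF c]] and dyT = vf_TS[OF dy_vf[OF c]] and ST = vf_TS[OF S_D]

text \<open>The semispray condition \<open>J S = C\<close>, evaluated on a fibre coordinate.\<close>

lemma S_x: "u \<in> D c \<Longrightarrow> S u (xcoord c i) = ycoord c i u"
proof -
  assume u: "u \<in> D c"
  have "J S u (ycoord c i) = C u (ycoord c i)"
    using spray D_carrier[OF c u] by (simp add: spray_def semispray_def)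
  then show ?thesis
    using J_eq[of c u S "ycoord c i", OF c u ST[OF u]] C_y[OF c u]
    by (simp add: dy_y[OF c u] if_distrib cong: if_cong)
qed

lemma brk_S_dy_x: "u \<in> D c \<Longrightarrow> brk S (dy c i) u (xcoord c k) = (if i = k then - 1 else 0)"
proof -
  assume u: "u \<in> D c"
  have "S u (\<lambda>w. dy c i w (xcoord c k)) = 0"
    by (rule tv_constD[OF ST[OF u] u dy_x[OF c]])
  moreover have "dy c i u (\<lambda>w. S w (xcoord c k)) = dy c i u (ycoord c k)"
    by (rule tv_congD[OF dyT[OF u] u S_x])
  ultimately show ?thesis by (simp add: brk_apply[OF x_near[OF c u]] dy_y[OF c u])
qed

lemma brk_S_dx_x: "u \<in> D c \<Longrightarrow> brk S (dx c i) u (xcoord c k) = 0"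
proof -
  assume u: "u \<in> D c"
  have "S u (\<lambda>w. dx c i w (xcoord c k)) = 0"
    by (rule tv_constD[OF ST[OF u] u dx_x[OF c]])
  moreover have "dx c i u (\<lambda>w. S w (xcoord c k)) = dx c i u (ycoord c k)"
    by (rule tv_congD[OF dxT[OF u] u S_x])
  ultimately show ?thesis by (simp add: brk_apply[OF x_near[OF c u]] dx_y[OF c u])
qed

lemma brk_S_dy_vf: "brk S (dy c i) \<in> vf (D c)" and brk_S_dx_vf: "brk S (dx c i) \<in> vf (D c)"
  by (rule brk_vf[OF open_atlas_D[OF c] S_D dy_vf[OF c]] brk_vf[OF open_atlas_D[OF c] S_D dx_vf[OF c]])+

lemma brk_S_dy:
  assumes u: "u \<in> D c"
  shows "brk S (dy c i) u f = 2 * (\<Sum>k\<in>UNIV. N c i k u * dy c k u f) - dx c i u f"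
proof -
  have "(\<Sum>k\<in>UNIV. brk S (dy c i) u (xcoord c k) * dx c k u f) = - dx c i u f"
    by (simp add: brk_S_dy_x[OF u] if_distrib[of "\<lambda>x. x * _"] cong: if_cong)
  moreover have "brk S (dy c i) u (ycoord c k) = 2 * N c i k u" for k by (simp add: N_def)
  ultimately show ?thesis
    using tv_frame[OF c vf_TS[OF brk_S_dy_vf u] u, of i f] by (simp add: sum_distrib_left mult.assoc)
qed

lemma N_smth: "smth (D c) (N c i k)"
proof -
  have "smth (D c) (\<lambda>u. (1/2) * brk S (dy c i) u (ycoord c k))"
    by (intro smooth_fun_mult smooth_fun_const vf_smth[OF brk_S_dy_vf] open_atlas_D[OF c] order_refl y_smth[OF c])
  then show ?thesis by (simp add: N_def[abs_def])
qed

lemma Ndy_vf: "(\<lambda>u f. \<Sum>k\<in>UNIV. N c i k u * dy c k u f) \<in> vf (D c)"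
  by (intro vf_lincomb open_atlas_D[OF c] dy_vf[OF c] N_smth)

lemma H_vf: "H c i \<in> vf (D c)"
  unfolding H_def by (rule vf_lin[OF open_atlas_D[OF c] Ndy_vf dx_vf[OF c] smooth_fun_const])

lemmas HT = vf_TS[OF H_vf]

lemma H_x: "u \<in> D c \<Longrightarrow> H c i u (xcoord c k) = (if i = k then 1 else 0)"
  by (simp add: H_def dx_x[OF c] dy_x[OF c])

lemma H_y: "u \<in> D c \<Longrightarrow> H c i u (ycoord c k) = - N c i k u"
  by (simp add: H_def dx_y[OF c] dy_y[OF c] if_distrib cong: if_cong)

lemma J_dx: "u \<in> D c \<Longrightarrow> J (dx c i) u f = dy c i u f"
  using J_eq[of c u "dx c i" f, OF c _ dxT]
  by (simp add: dx_x[OF c] if_distrib[of "\<lambda>x. x * _"] cong: if_cong)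

lemma J_dy: "u \<in> D c \<Longrightarrow> J (dy c i) u f = 0"
  using J_eq[of c u "dy c i" f, OF c _ dyT] by (simp add: dy_x[OF c])

lemma J_H: "u \<in> D c \<Longrightarrow> J (H c i) u f = dy c i u f"
  using J_eq[of c u "H c i" f, OF c _ HT]
  by (simp add: H_x if_distrib[of "\<lambda>x. x * _"] cong: if_cong)

lemma J_x: "u \<in> D c \<Longrightarrow> X u \<in> TS u \<Longrightarrow> J X u (xcoord c k) = 0"
  using J_eq[of c u X "xcoord c k", OF c] by (simp add: dy_x[OF c])

text \<open>\<open>[S, J]\<close> has eigenvalue 1 on the fields \<open>dy\<close> and, by
  \<open>LJ_H\<close>, eigenvalue -1 on the fields \<open>H\<close>; this is what makes
  \<open>vr\<close> and \<open>hr\<close> the projectors onto the two halves of the frame. On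
  \<open>dy\<close> the only contribution is \<open>J [S, dy]\<close>, because \<open>J\<close>
  kills \<open>dy\<close>.\<close>

lemma LJ_dy:
  assumes u: "u \<in> D c"
  shows "LJ (dy c i) u f = dy c i u f"
proof -
  have "brk S (J (dy c i)) u = brk S (\<lambda>w g. 0) u"
    by (rule brk_cong[OF open_atlas_D[OF c] S_D tensorial_vf[OF tensorial_J open_atlas_D[OF c] dy_vf[OF c]] u refl])
       (simp add: J_dy fun_eq_iff)
  moreover have "brk S (\<lambda>w g. 0) u f = 0" using tv_const[OF ST[OF u]] by (simp add: lie_bracket_def)
  ultimately have "brk S (J (dy c i)) u f = 0" by simp
  moreover have "J (brk S (dy c i)) u f = - dy c i u f"
    using J_eq[of c u "brk S (dy c i)" f, OF c u vf_TS[OF brk_S_dy_vf u]]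
    by (simp add: brk_S_dy_x[OF u] if_distrib[of "\<lambda>x. x * _"] cong: if_cong)
  ultimately show ?thesis by (simp add: lie_vform_def)
qed

lemma LJ_dx:
  assumes u: "u \<in> D c"
  shows "LJ (dx c i) u f = 2 * (\<Sum>k\<in>UNIV. N c i k u * dy c k u f) - dx c i u f"
proof -
  have "brk S (J (dx c i)) u = brk S (dy c i) u"
    by (rule brk_cong[OF open_atlas_D[OF c] S_D tensorial_vf[OF tensorial_J open_atlas_D[OF c] dx_vf[OF c]] u refl])
       (simp add: J_dx fun_eq_iff)
  moreover have "J (brk S (dx c i)) u f = 0"
    using J_eq[of c u "brk S (dx c i)" f, OF c u vf_TS[OF brk_S_dx_vf u]]
    by (simp add: brk_S_dx_x[OF u])
  ultimately show ?thesis by (simp add: lie_vform_def brk_S_dy[OF u])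
qed

lemma LJ_H:
  assumes u: "u \<in> D c"
  shows "LJ (H c i) u f = - H c i u f"
proof -
  have "LJ (H c i) u f = - 1 * LJ (\<lambda>w f. \<Sum>k\<in>UNIV. N c i k w * dy c k w f) u f + LJ (dx c i) u f"
    unfolding H_def by (rule tensorial_lin[OF tensorial_LJ open_atlas_D[OF c] Ndy_vf dx_vf[OF c] smooth_fun_const u])
  moreover have "LJ (\<lambda>w f. \<Sum>k\<in>UNIV. N c i k w * dy c k w f) u f = (\<Sum>k\<in>UNIV. N c i k u * dy c k u f)"
    using tensorial_sum[OF tensorial_LJ open_atlas_D[OF c] u, where I = UNIV and X = "dy c" and f = "N c i" and g = f]
    by (simp add: LJ_dy[OF u] dy_vf[OF c] N_smth)
  ultimately show ?thesis by (simp add: LJ_dx[OF u] H_def)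
qed

lemma hor_dy: "u \<in> D c \<Longrightarrow> hr (dy c i) u f = 0"
  by (simp add: hor_def LJ_dy)

lemma ver_dy: "u \<in> D c \<Longrightarrow> vr (dy c i) u f = dy c i u f"
  by (simp add: ver_def LJ_dy)

lemma hor_H: "u \<in> D c \<Longrightarrow> hr (H c i) u f = H c i u f"
  by (simp add: hor_def LJ_H)

lemma ver_H: "u \<in> D c \<Longrightarrow> vr (H c i) u f = 0"
  by (simp add: ver_def LJ_H)

text \<open>The index type \<open>'n + 'n\<close> lets one sum over \<open>UNIV\<close> run over
  both halves of the frame.\<close>

definition frame :: "'n + 'n \<Rightarrow> 'm tpt vfield" where
  "frame = case_sum (H c) (dy c)"

text \<open>The dual coframe \<open>dx\<^sup>i\<close>, \<open>\<delta>y\<^sup>i = dy\<^sup>i +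
  N\<^sup>i\<^sub>k dx\<^sup>k\<close>, evaluated on \<open>X\<close>.\<close>

definition frame_coef :: "'m tpt vfield \<Rightarrow> 'n + 'n \<Rightarrow> 'm tpt \<Rightarrow> real" where
  "frame_coef X = case_sum (\<lambda>i u. X u (xcoord c i))
     (\<lambda>i u. X u (ycoord c i) + (\<Sum>k\<in>UNIV. X u (xcoord c k) * N c k i u))"

lemma frame_vf: "frame j \<in> vf (D c)"
  by (cases j) (simp_all add: frame_def H_vf dy_vf[OF c])

lemma frame_expand:
  assumes u: "u \<in> D c" and X: "X u \<in> TS u"
  shows "X u f = (\<Sum>j\<in>UNIV. frame_coef X j u * frame j u f)"
proof -
  \<comment> \<open>The \<open>N\<close> terms of the coefficients of \<open>dy\<close> cancel those
    contained in the fields \<open>H\<close>.\<close>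
  have "(\<Sum>k\<in>UNIV. (\<Sum>j\<in>UNIV. X u (xcoord c j) * N c j k u) * dy c k u f) =
      (\<Sum>j\<in>UNIV. X u (xcoord c j) * (\<Sum>k\<in>UNIV. N c j k u * dy c k u f))"
    unfolding sum_distrib_right sum_distrib_left by (subst sum.swap) (simp add: mult.assoc)
  then show ?thesis
    unfolding sum_UNIV_Plus tv_frame[OF c X u, of f]
    by (simp add: frame_coef_def frame_def H_def sum.distrib distrib_right right_diff_distrib sum_subtractf)
qed

lemma frame_coef_smth:
  assumes W: "opn W" "W \<subseteq> D c" and X: "X \<in> vf W"
  shows "smth W (frame_coef X j)"
proof (cases j)
  case (Inl i)
  then show ?thesis
    using vf_smth[OF X W(1) order_refl smooth_fun_mono[OF x_smth[OF c] W(2)]] by (simp add: frame_coef_def)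
next
  case (Inr i)
  have "smth W (\<lambda>u. X u (ycoord c i) + (\<Sum>k\<in>UNIV. X u (xcoord c k) * N c k i u))"
    by (intro smooth_fun_add smooth_fun_sum smooth_fun_mult W(1) smooth_fun_mono[OF N_smth W(2)]
        vf_smth[OF X W(1) order_refl smooth_fun_mono[OF x_smth[OF c] W(2)]]
        vf_smth[OF X W(1) order_refl smooth_fun_mono[OF y_smth[OF c] W(2)]])
  then show ?thesis using Inr by (simp add: frame_coef_def)
qed

lemma alternating_eq_frame:
  assumes "alternating R" "alternating Q" and W: "opn W" "W \<subseteq> D c" "u \<in> W" and X: "X \<in> vf W" and Y: "Y \<in> vf W"
    and eq: "\<And>i j. R [frame i, frame j] u = Q [frame i, frame j] u"
  shows "R [X, Y] u = Q [X, Y] u"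
proof (rule alternating_eq_on_frame[OF assms(1,2) W(1,3), where I = UNIV and E = frame and a = "frame_coef X" and b = "frame_coef Y"])
  show "frame i \<in> vf W" for i by (rule vf_mono[OF frame_vf W(2)])
  show "X w g = (\<Sum>i\<in>UNIV. frame_coef X i w * frame i w g)" if "w \<in> W" for w g
    by (rule frame_expand) (use that W(2) vf_TS[OF X] in auto)
  show "Y w g = (\<Sum>i\<in>UNIV. frame_coef Y i w * frame i w g)" if "w \<in> W" for w g
    by (rule frame_expand) (use that W(2) vf_TS[OF Y] in auto)
qed (use X Y eq frame_coef_smth[OF W(1,2)] in auto)

text \<open>Expansion in the adapted frame turns the projector into a formula that sees only the x
  components; in particular \<open>hr\<close> annihilates every field that has none.\<close>

lemma hor_eq:
  assumes X: "X \<in> vf (D c)" and u: "u \<in> D c"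
  shows "hr X u f = (\<Sum>i\<in>UNIV. X u (xcoord c i) * H c i u f)"
proof -
  have "hr X u = hr (\<lambda>w g. \<Sum>j\<in>UNIV. frame_coef X j w * frame j w g) u"
    by (rule tensorial_cong[OF tensorial_hor open_atlas_D[OF c] X _ u]) (rule ext, rule frame_expand, assumption, rule vf_TS[OF X])
  then have "hr X u f = (\<Sum>j\<in>UNIV. frame_coef X j u * hr (frame j) u f)"
    using tensorial_sum[OF tensorial_hor open_atlas_D[OF c] u, where I = UNIV and X = frame and f = "frame_coef X" and g = f]
      frame_vf frame_coef_smth[OF open_atlas_D[OF c] order_refl X] by simp
  then show ?thesis
    unfolding sum_UNIV_Plus by (simp add: frame_coef_def frame_def hor_H[OF u] hor_dy[OF u])
qed

lemma ver_x:
  assumes X: "X \<in> vf (D c)" and u: "u \<in> D c"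
  shows "vr X u (xcoord c k) = 0"
  unfolding ver_hor hor_eq[OF X u] by (simp add: H_x[OF u] if_distrib cong: if_cong)

lemma hor_ver:
  assumes X: "X \<in> vf (D c)" and u: "u \<in> D c"
  shows "hr (vr X) u f = 0"
  by (simp add: hor_eq[OF tensorial_vf[OF tensorial_ver open_atlas_D[OF c] X] u] ver_x[OF X u])

section \<open>The operators \<open>FJ\<close>, \<open>\<Phi>\<close> and \<nabla> on the adapted
  frame\<close>

lemma lie_hor_dy:
  assumes u: "u \<in> D c"
  shows "lie_vform (slit_bundle A) S hr (dy c i) u f = H c i u f"
proof -
  have "brk S (hr (dy c i)) u = brk S (\<lambda>w g. 0) u"
    by (rule brk_cong[OF open_atlas_D[OF c] S_D tensorial_vf[OF tensorial_hor open_atlas_D[OF c] dy_vf[OF c]] u refl])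
       (simp add: hor_dy fun_eq_iff)
  moreover have "brk S (\<lambda>w g. 0) u f = 0" using tv_const[OF ST[OF u]] by (simp add: lie_bracket_def)
  ultimately have "brk S (hr (dy c i)) u f = 0" by simp
  moreover have "hr (brk S (dy c i)) u f = - H c i u f"
    by (simp add: hor_eq[OF brk_S_dy_vf u] brk_S_dy_x[OF u] if_distrib[of "\<lambda>x. x * _"] cong: if_cong)
  ultimately show ?thesis by (simp add: lie_vform_def)
qed

lemma brk_S_H_vf: "brk S (H c i) \<in> vf (D c)"
  by (rule brk_vf[OF open_atlas_D[OF c] S_D H_vf])

lemma lie_hor_H:
  assumes u: "u \<in> D c"
  shows "lie_vform (slit_bundle A) S hr (H c i) u f = vr (brk S (H c i)) u f"
proof -
  have "brk S (hr (H c i)) u = brk S (H c i) u"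
    by (rule brk_cong[OF open_atlas_D[OF c] S_D tensorial_vf[OF tensorial_hor open_atlas_D[OF c] H_vf] u refl])
       (simp add: hor_H fun_eq_iff)
  then show ?thesis by (simp add: lie_vform_def ver_hor)
qed

lemma lie_hor_vf: "X \<in> vf (D c) \<Longrightarrow> lie_vform (slit_bundle A) S hr X \<in> vf (D c)"
  by (rule tensorial_vf[OF tensorial_lie[OF S_vf tensorial_hor] open_atlas_D[OF c]])

text \<open>\<open>\<F> + J\<close> is \<open>h \<circ> [S, h]\<close>, and \<open>[S, h]\<close>
  already sends \<open>dy\<close> to \<open>H\<close>. Together with \<open>FJ_H\<close> this is the
  local form \<open>\<delta>/\<delta>x\<^sup>i \<otimes> \<delta>y\<^sup>i\<close>: insertion of
  \<open>FJ\<close> only trades vertical frame fields for horizontal ones.\<close>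

lemma FJ_dy: assumes u: "u \<in> D c" shows "FJ (dy c i) u f = H c i u f"
proof -
  have "FJ (dy c i) u = hr (H c i) u"
    unfolding FJ_alt
    by (rule tensorial_cong[OF tensorial_hor open_atlas_D[OF c] lie_hor_vf[OF dy_vf[OF c]] _ u]) (rule ext, rule lie_hor_dy)
  then show ?thesis by (simp add: hor_H[OF u])
qed

lemma FJ_H: assumes u: "u \<in> D c" shows "FJ (H c i) u f = 0"
proof -
  have "FJ (H c i) u = hr (vr (brk S (H c i))) u"
    unfolding FJ_alt
    by (rule tensorial_cong[OF tensorial_hor open_atlas_D[OF c] lie_hor_vf[OF H_vf] _ u]) (rule ext, rule lie_hor_H)
  then show ?thesis by (simp add: hor_ver[OF brk_S_H_vf u])
qed

lemma \<Phi>_dy: assumes u: "u \<in> D c" shows "\<Phi> (dy c i) u f = 0"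
proof -
  have "\<Phi> (dy c i) u = vr (H c i) u"
    unfolding \<Phi>_alt
    by (rule tensorial_cong[OF tensorial_ver open_atlas_D[OF c] lie_hor_vf[OF dy_vf[OF c]] _ u]) (rule ext, rule lie_hor_dy)
  then show ?thesis by (simp add: ver_H[OF u])
qed

lemma \<Phi>_H: assumes u: "u \<in> D c" shows "\<Phi> (H c i) u f = vr (brk S (H c i)) u f"
proof -
  have "\<Phi> (H c i) u = vr (vr (brk S (H c i))) u"
    unfolding \<Phi>_alt
    by (rule tensorial_cong[OF tensorial_ver open_atlas_D[OF c] lie_hor_vf[OF H_vf] _ u]) (rule ext, rule lie_hor_H)
  \<comment> \<open>Applying \<open>vr\<close> twice is the same as applying it once, because
    \<open>hr\<close> annihilates the image of \<open>vr\<close>.\<close>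
  then show ?thesis by (simp add: ver_hor[of "vr _"] hor_ver[OF brk_S_H_vf u])
qed

lemma brk_S_H_x:
  assumes u: "u \<in> D c"
  shows "brk S (H c i) u (xcoord c k) = N c i k u"
proof -
  have "S u (\<lambda>w. H c i w (xcoord c k)) = 0"
    by (rule tv_constD[OF ST[OF u] u H_x])
  moreover have "H c i u (\<lambda>w. S w (xcoord c k)) = H c i u (ycoord c k)"
    by (rule tv_congD[OF HT[OF u] u S_x])
  ultimately show ?thesis by (simp add: brk_apply[OF x_near[OF c u]] H_y[OF u])
qed

text \<open>The bracket contributes \<open>2 N dy - dx\<close>; adding \<open>H = dx - N dy\<close>
  from \<open>FJ\<close> cancels the \<open>dx\<close> part and leaves a vertical field.\<close>

lemma nabla_dy:
  assumes u: "u \<in> D c"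
  shows "brk S (dy c i) u f + \<Psi> (dy c i) u f = (\<Sum>k\<in>UNIV. N c i k u * dy c k u f)"
  by (simp add: brk_S_dy[OF u] FJ_dy[OF u] \<Phi>_dy[OF u] H_def)

text \<open>\<open>\<Phi>\<close> is exactly the vertical part of \<open>[S, H]\<close>, so
  subtracting it leaves the horizontal part, whose coefficients are again \<open>N\<close>.\<close>

lemma nabla_H:
  assumes u: "u \<in> D c"
  shows "brk S (H c i) u f + \<Psi> (H c i) u f = (\<Sum>k\<in>UNIV. N c i k u * H c k u f)"
  using hor_eq[OF brk_S_H_vf u, of i f]
  by (simp add: FJ_H[OF u] \<Phi>_H[OF u] ver_hor brk_S_H_x[OF u])

text \<open>Here \<open>brk S X + \<Psi> X\<close> is the covariant derivative \<open>\<nabla>X\<close>, expanded in vector fields \<open>VX k\<close>.\<close>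

lemma dyn_cov_eq:
  assumes Q: "alternating Q" and u: "u \<in> D c" and X: "X \<in> vf (D c)" and Y: "Y \<in> vf (D c)"
    and VX: "\<And>k. VX k \<in> vf (D c)" "\<And>w f. w \<in> D c \<Longrightarrow> brk S X w f + \<Psi> X w f = (\<Sum>k\<in>UNIV. a k w * VX k w f)"
      "\<And>k. smth (D c) (a k)"
    and VY: "\<And>k. VY k \<in> vf (D c)" "\<And>w f. w \<in> D c \<Longrightarrow> brk S Y w f + \<Psi> Y w f = (\<Sum>k\<in>UNIV. b k w * VY k w f)"
      "\<And>k. smth (D c) (b k)"
  shows "dyn_cov A S Q [X, Y] u = S u (Q [X, Y]) -
    (\<Sum>k\<in>(UNIV::'n set). a k u * Q [VX k, Y] u) - (\<Sum>k\<in>(UNIV::'n set). b k u * Q [X, VY k] u)"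
proof -
  note o = open_atlas_D[OF c]
  have *: "Q [brk S X, Y] u + Q [\<Psi> X, Y] u = (\<Sum>k\<in>(UNIV::'n set). a k u * Q [V k, Y] u)"
    if X: "X \<in> vf (D c)" and Y: "Y \<in> vf (D c)" and V: "\<And>k. V k \<in> vf (D c)" "\<And>k. smth (D c) (a k)"
      "\<And>w f. w \<in> D c \<Longrightarrow> brk S X w f + \<Psi> X w f = (\<Sum>k\<in>UNIV. a k w * V k w f)"
    for X Y V a
  proof -
    note b = brk_vf[OF o S_D X] and p = tensorial_vf[OF tensorial_\<Psi> o X]
    let ?Z = "\<lambda>w f. brk S X w f + \<Psi> X w f"
    have z: "?Z \<in> vf (D c)" using vf_lin[OF o b p smooth_fun_const[of _ 1]] by simp
    have "Q [?Z, Y] u = Q [brk S X, Y] u + Q [\<Psi> X, Y] u"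
      by (rule alternating_add_left[OF Q o b p Y u])
    moreover have "Q [?Z, Y] u = Q [\<lambda>w f. \<Sum>k\<in>UNIV. a k w * V k w f, Y] u"
      by (rule alternating_cong_left[OF Q o z Y _ u]) (rule ext, rule V(3))
    moreover have "Q [\<lambda>w f. \<Sum>k\<in>UNIV. a k w * V k w f, Y] u = (\<Sum>k\<in>UNIV. a k u * Q [V k, Y] u)"
      by (rule alternating_lincomb_left[OF Q o u Y V(1,2)])
    ultimately show ?thesis by simp
  qed
  have 2: "Q [X, brk S Y] u + Q [X, \<Psi> Y] u = (\<Sum>k\<in>UNIV. b k u * Q [X, VY k] u)"
  proof -
    have "Q [X, brk S Y] u + Q [X, \<Psi> Y] u = - (Q [brk S Y, X] u + Q [\<Psi> Y, X] u)"
      using alternating_antisym[OF Q o brk_vf[OF o S_D Y] X u] alternating_antisym[OF Q o tensorial_vf[OF tensorial_\<Psi> o Y] X u] by simp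
    moreover have "Q [X, VY k] u = - Q [VY k, X] u" for k
      by (rule alternating_antisym[OF Q o VY(1) X u])
    ultimately show ?thesis using *[OF Y X VY(1,3,2)] by (simp add: sum_negf)
  qed
  show ?thesis
    using *[OF X Y VX(1,3,2)] 2 by (simp add: dyn_cov_def)
qed

end

section \<open>Semi-basic 1-forms\<close>

context
  fixes c \<theta>
  assumes c: "c \<in> A" and \<theta>: "k_form (slit_bundle A) 1 \<theta>" and sb: "semi_basic A 1 \<theta>"
begin

lemma semi_basic_smth: "smth (D c) (\<theta> [dx c i])"
  by (rule one_form_smth[OF \<theta> open_atlas_D[OF c] dx_vf[OF c]])

lemma semi_basic_near: "u \<in> D c \<Longrightarrow> near u (\<theta> [dx c i])"
  by (rule nearI[OF open_atlas_D[OF c] _ semi_basic_smth])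

text \<open>The \<open>dy\<close> part of the coordinate expansion of \<open>X\<close> is a vertical
  field, which a semi-basic form annihilates.\<close>

lemma semi_basic_expand:
  assumes W: "opn W" "W \<subseteq> D c" and X: "X \<in> vf W" and u: "u \<in> W"
  shows "\<theta> [X] u = (\<Sum>k\<in>UNIV. X u (xcoord c k) * \<theta> [dx c k] u)"
proof -
  let ?Y = "\<lambda>w g. \<Sum>k\<in>UNIV. X w (xcoord c k) * dx c k w g"
  let ?Z = "\<lambda>w g. \<Sum>k\<in>UNIV. X w (ycoord c k) * dy c k w g"
  have x: "smth W (\<lambda>w. X w (xcoord c k))" and y: "smth W (\<lambda>w. X w (ycoord c k))" for k
    by (rule vf_smth[OF X W(1) order_refl smooth_fun_mono[OF x_smth[OF c] W(2)]]
        vf_smth[OF X W(1) order_refl smooth_fun_mono[OF y_smth[OF c] W(2)]])+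
  have dxW: "dx c k \<in> vf W" and dyW: "dy c k \<in> vf W" for k
    by (rule vf_mono[OF dx_vf[OF c] W(2)] vf_mono[OF dy_vf[OF c] W(2)])+
  have Y: "?Y \<in> vf W" by (rule vf_lincomb[OF W(1) dxW x])
  have Z: "?Z \<in> vf W" by (rule vf_lincomb[OF W(1) dyW y])
  have "vertical A W ?Z"
    unfolding vertical_def
    by (intro conjI Z ballI allI sum.neutral) (use dy_comp_fst[OF c] W(2) in auto)
  then have "\<theta> [?Z] u = 0"
    using sb[unfolded semi_basic_def, rule_format, of W "[?Z]" u] W(1) Z u by auto
  moreover have "\<theta> [X] u = \<theta> [\<lambda>w g. ?Y w g + ?Z w g] u"
    by (rule one_form_cong[OF \<theta> W(1) X _ u]) (rule ext, rule tv_frame[OF c vf_TS[OF X]], use W(2) in auto)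
  moreover have "\<theta> [\<lambda>w g. ?Y w g + ?Z w g] u = \<theta> [?Y] u + \<theta> [?Z] u"
    by (rule one_form_add[OF \<theta> W(1) Y Z u])
  moreover have "\<theta> [?Y] u = (\<Sum>k\<in>UNIV. X u (xcoord c k) * \<theta> [dx c k] u)"
    by (rule one_form_lincomb[OF \<theta> W(1) u dxW x])
  ultimately show ?thesis by simp
qed

lemmas semi_basic_D = semi_basic_expand[OF open_atlas_D[OF c] order_refl]

lemma semi_basic_H: "u \<in> D c \<Longrightarrow> \<theta> [H c i] u = \<theta> [dx c i] u"
  by (simp add: semi_basic_D[OF H_vf[OF c]] H_x[OF c] if_distrib[of "\<lambda>x. x * _"] cong: if_cong)

lemma semi_basic_dy: "u \<in> D c \<Longrightarrow> \<theta> [dy c i] u = 0"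
  by (simp add: semi_basic_D[OF dy_vf[OF c]] dy_x[OF c])

lemma semi_basic_zero: "X \<in> vf (D c) \<Longrightarrow> u \<in> D c \<Longrightarrow> (\<And>k. X u (xcoord c k) = 0) \<Longrightarrow> \<theta> [X] u = 0"
  by (simp add: semi_basic_D)

text \<open>Both fields have constant x components, so their bracket has none and is annihilated;
  the form also vanishes on \<open>dy\<close>. One of the three terms of the exterior derivative
  survives.\<close>

lemma ext_d_dy_H:
  assumes u: "u \<in> D c"
  shows "ext_d (slit_bundle A) \<theta> [dy c i, H c j] u = dy c i u (\<theta> [dx c j])"
proof -
  have "brk (dy c i) (H c j) u (xcoord c k) = 0" for k
    using tv_constD[OF c dyT[OF c u] u H_x[OF c]] tv_constD[OF c HT[OF c u] u dy_x[OF c]]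
    by (simp add: brk_apply[OF x_near[OF c u]])
  then have "\<theta> [brk (dy c i) (H c j)] u = 0"
    by (intro semi_basic_zero brk_vf open_atlas_D[OF c] dy_vf[OF c] H_vf[OF c] u)
  moreover have "dy c i u (\<theta> [H c j]) = dy c i u (\<theta> [dx c j])"
    by (rule tv_congD[OF c dyT[OF c u] u semi_basic_H])
  moreover have "H c j u (\<theta> [dy c i]) = 0"
    by (rule tv_constD[OF c HT[OF c u] u semi_basic_dy])
  ultimately show ?thesis by simp
qed

lemma ext_d_dy_dy:
  assumes u: "u \<in> D c"
  shows "ext_d (slit_bundle A) \<theta> [dy c i, dy c j] u = 0"
proof -
  have "brk (dy c i) (dy c j) u (xcoord c k) = 0" for k
    using tv_constD[OF c dyT[OF c u] u dy_x[OF c]] by (simp add: brk_apply[OF x_near[OF c u]])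
  then have "\<theta> [brk (dy c i) (dy c j)] u = 0"
    by (intro semi_basic_zero brk_vf open_atlas_D[OF c] dy_vf[OF c] u)
  then show ?thesis
    using tv_constD[OF c dyT[OF c u] u semi_basic_dy] by simp
qed

text \<open>An operator with vertical values annihilates semi-basic forms, so only \<open>i\<^sub>K d\<theta>\<close> remains.\<close>

lemma d_deriv_vertical:
  assumes K: "tensorial K" "\<And>X w k. X \<in> vf (D c) \<Longrightarrow> w \<in> D c \<Longrightarrow> K X w (xcoord c k) = 0"
    and X: "X \<in> vf (D c)" and Y: "Y \<in> vf (D c)" and u: "u \<in> D c"
  shows "d_deriv (slit_bundle A) K \<theta> [X, Y] u =
    ext_d (slit_bundle A) \<theta> [K X, Y] u + ext_d (slit_bundle A) \<theta> [X, K Y] u"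
proof -
  have 0: "\<theta> [K Z] w = 0" if "Z \<in> vf (D c)" "w \<in> D c" for Z w
    by (rule semi_basic_zero[OF tensorial_vf[OF K(1) open_atlas_D[OF c] that(1)] that(2)]) (rule K(2)[OF that])
  have "X u (\<theta> [K Y]) = 0" by (rule tv_constD[OF c vf_TS[OF X u] u 0[OF Y]])
  moreover have "Y u (\<theta> [K X]) = 0" by (rule tv_constD[OF c vf_TS[OF Y u] u 0[OF X]])
  moreover have "\<theta> [K (brk X Y)] u = 0" by (rule 0[OF brk_vf[OF open_atlas_D[OF c] X Y] u])
  ultimately show ?thesis unfolding d_deriv_1 ext_d_1[of "i_deriv K \<theta>"] i_deriv_1 by linarith
qed

lemmas dv_expand = d_deriv_vertical[OF tensorial_ver ver_x[OF c]]

lemma J_vertical: "X \<in> vf (D c) \<Longrightarrow> w \<in> D c \<Longrightarrow> J X w (xcoord c k) = 0"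
  by (rule J_x[OF c _ vf_TS])

lemmas dJ_expand = d_deriv_vertical[OF tensorial_J J_vertical]

lemmas ext_bil = alternating_ext_d[OF \<theta>]
lemmas vr_vf = tensorial_vf[OF tensorial_ver open_atlas_D[OF c]]
lemmas J_vf = tensorial_vf[OF tensorial_J open_atlas_D[OF c]]

lemma ext_ver_dy: "Y \<in> vf (D c) \<Longrightarrow> u \<in> D c \<Longrightarrow>
    ext_d (slit_bundle A) \<theta> [vr (dy c i), Y] u = ext_d (slit_bundle A) \<theta> [dy c i, Y] u"
  by (rule alternating_cong_left[OF ext_bil open_atlas_D[OF c] vr_vf[OF dy_vf[OF c]]])
     (auto simp: ver_dy[OF c] fun_eq_iff simp del: ext_d_1)

lemma ext_ver_dy': "Y \<in> vf (D c) \<Longrightarrow> u \<in> D c \<Longrightarrow>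
    ext_d (slit_bundle A) \<theta> [Y, vr (dy c i)] u = ext_d (slit_bundle A) \<theta> [Y, dy c i] u"
  by (rule alternating_cong_right[OF ext_bil open_atlas_D[OF c] _ vr_vf[OF dy_vf[OF c]]])
     (auto simp: ver_dy[OF c] fun_eq_iff simp del: ext_d_1)

lemma ext_J_H: "Y \<in> vf (D c) \<Longrightarrow> u \<in> D c \<Longrightarrow>
    ext_d (slit_bundle A) \<theta> [J (H c i), Y] u = ext_d (slit_bundle A) \<theta> [dy c i, Y] u"
  by (rule alternating_cong_left[OF ext_bil open_atlas_D[OF c] J_vf[OF H_vf[OF c]]])
     (auto simp: J_H[OF c] fun_eq_iff simp del: ext_d_1)

lemma ext_J_H': "Y \<in> vf (D c) \<Longrightarrow> u \<in> D c \<Longrightarrow>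
    ext_d (slit_bundle A) \<theta> [Y, J (H c i)] u = ext_d (slit_bundle A) \<theta> [Y, dy c i] u"
  by (rule alternating_cong_right[OF ext_bil open_atlas_D[OF c] _ J_vf[OF H_vf[OF c]]])
     (auto simp: J_H[OF c] fun_eq_iff simp del: ext_d_1)

lemma ext_ver_H: "Y \<in> vf (D c) \<Longrightarrow> u \<in> D c \<Longrightarrow> ext_d (slit_bundle A) \<theta> [vr (H c i), Y] u = 0"
  by (rule alternating_zero_left[OF ext_bil open_atlas_D[OF c]]) (auto simp: ver_H[OF c])

lemma ext_ver_H': "Y \<in> vf (D c) \<Longrightarrow> u \<in> D c \<Longrightarrow> ext_d (slit_bundle A) \<theta> [Y, vr (H c i)] u = 0"
  by (rule alternating_zero_right[OF ext_bil open_atlas_D[OF c]]) (auto simp: ver_H[OF c])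

lemma ext_J_dy: "Y \<in> vf (D c) \<Longrightarrow> u \<in> D c \<Longrightarrow> ext_d (slit_bundle A) \<theta> [J (dy c i), Y] u = 0"
  by (rule alternating_zero_left[OF ext_bil open_atlas_D[OF c]]) (auto simp: J_dy[OF c])

lemma ext_J_dy': "Y \<in> vf (D c) \<Longrightarrow> u \<in> D c \<Longrightarrow> ext_d (slit_bundle A) \<theta> [Y, J (dy c i)] u = 0"
  by (rule alternating_zero_right[OF ext_bil open_atlas_D[OF c]]) (auto simp: J_dy[OF c])

text \<open>\<open>vr\<close> fixes \<open>dy\<close> and kills \<open>H\<close>, so a mixed pair
  gets one contribution, a horizontal pair gets none, and a vertical pair only sees the vanishing
  values of \<open>ext_d_dy_dy\<close>.\<close>

lemma
  assumes u: "u \<in> D c"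
  shows dv_dy_H: "d_deriv (slit_bundle A) vr \<theta> [dy c i, H c j] u = dy c i u (\<theta> [dx c j])"
    and dv_dy_dy: "d_deriv (slit_bundle A) vr \<theta> [dy c i, dy c j] u = 0"
    and dv_H_H: "d_deriv (slit_bundle A) vr \<theta> [H c i, H c j] u = 0"
  by (simp_all add: dv_expand ext_ver_dy ext_ver_dy' ext_ver_H ext_ver_H' ext_d_dy_H ext_d_dy_dy
      H_vf[OF c] dy_vf[OF c] u del: ext_d_1)

text \<open>\<open>J\<close> moves \<open>H\<close> to \<open>dy\<close> and kills
  \<open>dy\<close>. On a horizontal pair both slots contribute a mixed value, with opposite signs
  by antisymmetry; this is why condition (1) is symmetry of the derivative matrix.\<close>

lemma
  assumes u: "u \<in> D c"
  shows dJ_H_H: "d_deriv (slit_bundle A) J \<theta> [H c i, H c j] u = dy c i u (\<theta> [dx c j]) - dy c j u (\<theta> [dx c i])"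
    and dJ_dy_H: "d_deriv (slit_bundle A) J \<theta> [dy c i, H c j] u = 0"
    and dJ_dy_dy: "d_deriv (slit_bundle A) J \<theta> [dy c i, dy c j] u = 0"
  by (simp_all add: dJ_expand ext_J_H ext_J_H' ext_J_dy ext_J_dy' ext_d_dy_H ext_d_dy_dy
      alternating_antisym[OF ext_bil open_atlas_D[OF c] dy_vf[OF c] H_vf[OF c]] H_vf[OF c] dy_vf[OF c] u del: ext_d_1)

lemmas dJ_bil = alternating_d_deriv[OF \<theta> tensorial_J]
lemmas dv_bil = alternating_d_deriv[OF \<theta> tensorial_ver]
lemmas FJ_vf = tensorial_vf[OF tensorial_FJ open_atlas_D[OF c]]

lemma dJ_FJ_left: "Y \<in> vf (D c) \<Longrightarrow> u \<in> D c \<Longrightarrow>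
    d_deriv (slit_bundle A) J \<theta> [FJ (dy c i), Y] u = d_deriv (slit_bundle A) J \<theta> [H c i, Y] u"
  by (rule alternating_cong_left[OF dJ_bil open_atlas_D[OF c] FJ_vf[OF dy_vf[OF c]]]) (auto simp: FJ_dy[OF c] fun_eq_iff)

lemma dJ_FJ_right: "Y \<in> vf (D c) \<Longrightarrow> u \<in> D c \<Longrightarrow>
    d_deriv (slit_bundle A) J \<theta> [Y, FJ (dy c i)] u = d_deriv (slit_bundle A) J \<theta> [Y, H c i] u"
  by (rule alternating_cong_right[OF dJ_bil open_atlas_D[OF c] _ FJ_vf[OF dy_vf[OF c]]]) (auto simp: FJ_dy[OF c] fun_eq_iff)

lemma dJ_FJ_H: "Y \<in> vf (D c) \<Longrightarrow> u \<in> D c \<Longrightarrow> d_deriv (slit_bundle A) J \<theta> [FJ (H c i), Y] u = 0"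
  by (rule alternating_zero_left[OF dJ_bil open_atlas_D[OF c]]) (auto simp: FJ_H[OF c])

lemma dJ_FJ_H': "Y \<in> vf (D c) \<Longrightarrow> u \<in> D c \<Longrightarrow> d_deriv (slit_bundle A) J \<theta> [Y, FJ (H c i)] u = 0"
  by (rule alternating_zero_right[OF dJ_bil open_atlas_D[OF c]]) (auto simp: FJ_H[OF c])

text \<open>Insertion of \<open>FJ\<close> carries the horizontal block into the mixed one. Half of
  the mixed value below, subtracted from that of \<open>dv_dy_H\<close>, leaves the symmetrised
  y-derivative on the right of condition (2).\<close>

lemma
  assumes u: "u \<in> D c"
  shows iFJ_dy_H: "i_deriv FJ (d_deriv (slit_bundle A) J \<theta>) [dy c i, H c j] u =
      dy c i u (\<theta> [dx c j]) - dy c j u (\<theta> [dx c i])"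
    and iFJ_dy_dy: "i_deriv FJ (d_deriv (slit_bundle A) J \<theta>) [dy c i, dy c j] u = 0"
    and iFJ_H_H: "i_deriv FJ (d_deriv (slit_bundle A) J \<theta>) [H c i, H c j] u = 0"
  by (simp_all add: dJ_FJ_left dJ_FJ_right dJ_FJ_H dJ_FJ_H' dJ_H_H dJ_dy_H
      alternating_antisym[OF dJ_bil open_atlas_D[OF c] dy_vf[OF c] H_vf[OF c]] H_vf[OF c] dy_vf[OF c] u)

lemma
  assumes u: "u \<in> D c"
  shows nabla_dy_H: "dyn_cov A S (d_deriv (slit_bundle A) vr \<theta>) [dy c i, H c j] u =
      S u (\<lambda>w. dy c i w (\<theta> [dx c j])) - (\<Sum>k\<in>UNIV. N c i k u * dy c k u (\<theta> [dx c j])) -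
      (\<Sum>k\<in>UNIV. N c j k u * dy c i u (\<theta> [dx c k]))"
    and nabla_dy_dy: "dyn_cov A S (d_deriv (slit_bundle A) vr \<theta>) [dy c i, dy c j] u = 0"
    and nabla_H_H: "dyn_cov A S (d_deriv (slit_bundle A) vr \<theta>) [H c i, H c j] u = 0"
proof -
  note dc = dyn_cov_eq[OF c dv_bil u]
  note vfs = dy_vf[OF c] H_vf[OF c]
  have "dyn_cov A S (d_deriv (slit_bundle A) vr \<theta>) [dy c i, H c j] u =
      S u (d_deriv (slit_bundle A) vr \<theta> [dy c i, H c j]) -
      (\<Sum>k\<in>UNIV. N c i k u * d_deriv (slit_bundle A) vr \<theta> [dy c k, H c j] u) -
      (\<Sum>k\<in>UNIV. N c j k u * d_deriv (slit_bundle A) vr \<theta> [dy c i, H c k] u)"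
    by (rule dc[where VX = "dy c" and VY = "H c" and a = "N c i" and b = "N c j"])
       (rule vfs nabla_dy[OF c] nabla_H[OF c] N_smth[OF c] | assumption)+
  moreover have "S u (d_deriv (slit_bundle A) vr \<theta> [dy c i, H c j]) = S u (\<lambda>w. dy c i w (\<theta> [dx c j]))"
    by (rule tv_congD[OF c ST[OF c u] u dv_dy_H])
  ultimately show "dyn_cov A S (d_deriv (slit_bundle A) vr \<theta>) [dy c i, H c j] u =
      S u (\<lambda>w. dy c i w (\<theta> [dx c j])) - (\<Sum>k\<in>UNIV. N c i k u * dy c k u (\<theta> [dx c j])) -
      (\<Sum>k\<in>UNIV. N c j k u * dy c i u (\<theta> [dx c k]))"
    by (simp add: dv_dy_H[OF u])
  have "dyn_cov A S (d_deriv (slit_bundle A) vr \<theta>) [dy c i, dy c j] u =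
      S u (d_deriv (slit_bundle A) vr \<theta> [dy c i, dy c j]) -
      (\<Sum>k\<in>UNIV. N c i k u * d_deriv (slit_bundle A) vr \<theta> [dy c k, dy c j] u) -
      (\<Sum>k\<in>UNIV. N c j k u * d_deriv (slit_bundle A) vr \<theta> [dy c i, dy c k] u)"
    by (rule dc[where VX = "dy c" and VY = "dy c" and a = "N c i" and b = "N c j"])
       (rule vfs nabla_dy[OF c] N_smth[OF c] | assumption)+
  moreover have "S u (d_deriv (slit_bundle A) vr \<theta> [dy c i, dy c j]) = 0"
    by (rule tv_constD[OF c ST[OF c u] u dv_dy_dy])
  ultimately show "dyn_cov A S (d_deriv (slit_bundle A) vr \<theta>) [dy c i, dy c j] u = 0"
    by (simp add: dv_dy_dy[OF u])
  have "dyn_cov A S (d_deriv (slit_bundle A) vr \<theta>) [H c i, H c j] u =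
      S u (d_deriv (slit_bundle A) vr \<theta> [H c i, H c j]) -
      (\<Sum>k\<in>UNIV. N c i k u * d_deriv (slit_bundle A) vr \<theta> [H c k, H c j] u) -
      (\<Sum>k\<in>UNIV. N c j k u * d_deriv (slit_bundle A) vr \<theta> [H c i, H c k] u)"
    by (rule dc[where VX = "H c" and VY = "H c" and a = "N c i" and b = "N c j"])
       (rule vfs nabla_H[OF c] N_smth[OF c] | assumption)+
  moreover have "S u (d_deriv (slit_bundle A) vr \<theta> [H c i, H c j]) = 0"
    by (rule tv_constD[OF c ST[OF c u] u dv_H_H])
  ultimately show "dyn_cov A S (d_deriv (slit_bundle A) vr \<theta>) [H c i, H c j] u = 0"
    by (simp add: dv_H_H[OF u])
qed

text \<open>\<open>C\<close> has no x components, so those of \<open>[C, X]\<close> are the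
  \<open>C\<close>-derivatives of those of \<open>X\<close>, and they cancel against the product
  rule. Homogeneity of a semi-basic form is thus homogeneity of its coefficients, with the same
  order.\<close>

lemma lie_C_theta:
  assumes W: "opn W" "W \<subseteq> D c" and X: "X \<in> vf W" and u: "u \<in> W"
  shows "lie_form (slit_bundle A) C \<theta> [X] u = (\<Sum>k\<in>UNIV. X u (xcoord c k) * C u (\<theta> [dx c k]))"
proof -
  have uD: "u \<in> D c" using u W by auto
  have CW: "C \<in> vf W" by (rule global_vf[OF C_vf W(1)])
  note t = vf_TS[OF CW u]
  have nX: "near u (\<lambda>w. X w (xcoord c k))" for k by (rule vf_near[OF X W(1) u x_near[OF c uD]])
  have "C u (\<theta> [X]) = C u (\<lambda>w. \<Sum>k\<in>UNIV. X w (xcoord c k) * \<theta> [dx c k] w)"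
    by (rule tv_cong[OF t W(1) u semi_basic_expand[OF W X]])
  also have "\<dots> = (\<Sum>k\<in>UNIV. C u (\<lambda>w. X w (xcoord c k) * \<theta> [dx c k] w))"
    by (rule tv_sum[OF t]) (intro near_mult nX semi_basic_near uD)
  also have "\<dots> = (\<Sum>k\<in>UNIV. X u (xcoord c k) * C u (\<theta> [dx c k]) + C u (\<lambda>w. X w (xcoord c k)) * \<theta> [dx c k] u)"
    by (intro sum.cong refl tv_mult[OF t nX semi_basic_near[OF uD]])
  finally have 1: "C u (\<theta> [X]) = \<dots>" .
  have "X u (\<lambda>w. C w (xcoord c k)) = 0" for k
    using tv_cong[OF vf_TS[OF X u] W(1) u, of "\<lambda>w. C w (xcoord c k)" "\<lambda>w. 0"] C_x[OF c] W(2)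
      tv_const[OF vf_TS[OF X u]] by (auto simp: subset_iff)
  then have "\<theta> [brk C X] u = (\<Sum>k\<in>UNIV. C u (\<lambda>w. X w (xcoord c k)) * \<theta> [dx c k] u)"
    by (simp add: semi_basic_expand[OF W brk_vf[OF W(1) CW X] u] brk_apply[OF x_near[OF c uD]])
  then show ?thesis by (simp add: 1 sum.distrib)
qed

end

section \<open>From identities of forms to identities of coefficients in all induced charts\<close>

lemma chart_Int:
  assumes "opn W" "u \<in> W"
  obtains c where "c \<in> A" "u \<in> W \<inter> D c" "opn (W \<inter> D c)" "W \<inter> D c \<subseteq> D c"
proof -
  obtain c where "c \<in> A" "u \<in> D c" using D_obtain[of u] open_atlas_subset_carrier[OF assms(1)] assms(2) by blast
  then show thesis using that assms open_atlas_Int[OF assms(1) open_atlas_D] by simp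
qed

text \<open>\<open>form_eq\<close> tests fields on arbitrary open sets, which are cut down to a
  chart; hence the expansions are required on every open subset of a chart domain and not on the
  whole domain alone.\<close>

lemma form_eq_1_iff:
  assumes "\<And>c W X u. c \<in> A \<Longrightarrow> opn W \<Longrightarrow> W \<subseteq> D c \<Longrightarrow> X \<in> vf W \<Longrightarrow> u \<in> W \<Longrightarrow>
      \<omega> [X] u = (\<Sum>k\<in>UNIV. X u (xcoord c k) * a c k u)"
    and "\<And>c W X u. c \<in> A \<Longrightarrow> opn W \<Longrightarrow> W \<subseteq> D c \<Longrightarrow> X \<in> vf W \<Longrightarrow> u \<in> W \<Longrightarrow>
      \<eta> [X] u = (\<Sum>k\<in>UNIV. X u (xcoord c k) * b c k u)"
  shows "form_eq (slit_bundle A) 1 \<omega> \<eta> \<longleftrightarrow> (\<forall>c\<in>A. \<forall>u\<in>D c. \<forall>k. a c k u = b c k u)"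
proof
  assume L: "form_eq (slit_bundle A) 1 \<omega> \<eta>"
  show "\<forall>c\<in>A. \<forall>u\<in>D c. \<forall>k. a c k u = b c k u"
  proof (intro ballI allI)
    fix c u k assume c: "c \<in> A" and u: "u \<in> D c"
    have "\<omega> [dx c k] u = \<eta> [dx c k] u"
      using L[unfolded form_eq_def, rule_format, of "D c" "[dx c k]" u] open_atlas_D[OF c] dx_vf[OF c] u by simp
    then show "a c k u = b c k u"
      using assms[OF c open_atlas_D[OF c] order_refl dx_vf[OF c] u]
      by (simp add: dx_x[OF c u] if_distrib[of "\<lambda>x. x * _"] cong: if_cong)
  qed
next
  assume R: "\<forall>c\<in>A. \<forall>u\<in>D c. \<forall>k. a c k u = b c k u"
  show "form_eq (slit_bundle A) 1 \<omega> \<eta>"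
    unfolding form_eq_def
  proof (intro allI impI ballI)
    fix W Xs u assume W: "opn W \<and> length Xs = 1 \<and> set Xs \<subseteq> vf W" and u: "u \<in> W"
    then obtain X where X: "Xs = [X]" "X \<in> vf W" by (auto simp: length_Suc_conv)
    obtain c where c: "c \<in> A" "u \<in> W \<inter> D c" "opn (W \<inter> D c)" "W \<inter> D c \<subseteq> D c"
      using chart_Int[OF conjunct1[OF W] u] .
    have XW: "X \<in> vf (W \<inter> D c)" by (rule vf_mono[OF X(2)]) simp
    show "\<omega> Xs u = \<eta> Xs u"
      unfolding X(1) assms(1)[OF c(1,3,4) XW c(2)] assms(2)[OF c(1,3,4) XW c(2)] using R c(1,2) by auto
  qed
qed

lemma homogeneous_iff:
  assumes \<theta>: "k_form (slit_bundle A) 1 \<theta>" "semi_basic A 1 \<theta>"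
  shows "homogeneous_form A 1 r \<theta> \<longleftrightarrow> (\<forall>c\<in>A. \<forall>u\<in>D c. \<forall>k. C u (\<theta> [dx c k]) = r * \<theta> [dx c k] u)"
  unfolding homogeneous_form_def
proof (rule form_eq_1_iff)
  fix c W X u assume *: "c \<in> A" "opn W" "W \<subseteq> D c" "X \<in> vf W" "u \<in> W"
  show "lie_form (slit_bundle A) C \<theta> [X] u = (\<Sum>k\<in>UNIV. X u (xcoord c k) * C u (\<theta> [dx c k]))"
    by (rule lie_C_theta[OF *(1) \<theta> *(2-)])
  show "r * \<theta> [X] u = (\<Sum>k\<in>UNIV. X u (xcoord c k) * (r * \<theta> [dx c k] u))"
    unfolding semi_basic_expand[OF *(1) \<theta> *(2-)] by (simp add: sum_distrib_left mult.left_commute)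
qed

text \<open>Reduction to the adapted frame. The vertical block has to agree outright, the horizontal
  and mixed blocks are described by the predicates \<open>hh\<close> and \<open>vh\<close>, and the
  remaining block follows by antisymmetry.\<close>

lemma form_eq_2_iff:
  assumes P: "alternating R" and Q: "alternating Q"
    and HH: "\<And>c u i j. c \<in> A \<Longrightarrow> u \<in> D c \<Longrightarrow>
      R [H c i, H c j] u = Q [H c i, H c j] u \<longleftrightarrow> hh c u i j"
    and VV: "\<And>c u i j. c \<in> A \<Longrightarrow> u \<in> D c \<Longrightarrow> R [dy c i, dy c j] u = Q [dy c i, dy c j] u"
    and VH: "\<And>c u i j. c \<in> A \<Longrightarrow> u \<in> D c \<Longrightarrow>
      R [dy c i, H c j] u = Q [dy c i, H c j] u \<longleftrightarrow> vh c u i j"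
  shows "form_eq (slit_bundle A) 2 R Q \<longleftrightarrow> (\<forall>c\<in>A. \<forall>u\<in>D c. \<forall>i j. hh c u i j \<and> vh c u i j)"
proof
  assume L: "form_eq (slit_bundle A) 2 R Q"
  show "\<forall>c\<in>A. \<forall>u\<in>D c. \<forall>i j. hh c u i j \<and> vh c u i j"
  proof (intro ballI allI)
    fix c u i j assume c: "c \<in> A" and u: "u \<in> D c"
    have "R [X, Y] u = Q [X, Y] u" if "X \<in> vf (D c)" "Y \<in> vf (D c)" for X Y
      using L[unfolded form_eq_def, rule_format, of "D c" "[X, Y]" u] open_atlas_D[OF c] that u by simp
    then show "hh c u i j \<and> vh c u i j"
      using HH[OF c u] VH[OF c u] H_vf[OF c] dy_vf[OF c] by blast
  qed
next
  assume R: "\<forall>c\<in>A. \<forall>u\<in>D c. \<forall>i j. hh c u i j \<and> vh c u i j"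
  show "form_eq (slit_bundle A) 2 R Q"
    unfolding form_eq_def
  proof (intro allI impI ballI)
    fix W Xs u assume W: "opn W \<and> length Xs = 2 \<and> set Xs \<subseteq> vf W" and u: "u \<in> W"
    then obtain X Y where X: "Xs = [X, Y]" "X \<in> vf W" "Y \<in> vf W"
      by (auto simp: numeral_2_eq_2 length_Suc_conv)
    obtain c where c: "c \<in> A" "u \<in> W \<inter> D c" "opn (W \<inter> D c)" "W \<inter> D c \<subseteq> D c"
      using chart_Int[OF conjunct1[OF W] u] .
    have u': "u \<in> D c" using c(2) by simp
    have XW: "X \<in> vf (W \<inter> D c)" "Y \<in> vf (W \<inter> D c)" by (rule vf_mono[OF X(2)] vf_mono[OF X(3)], simp)+
    have hv: "R [H c i, dy c j] u = Q [H c i, dy c j] u" for i j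
      using alternating_antisym[OF P open_atlas_D[OF c(1)] dy_vf[OF c(1)] H_vf[OF c(1)] u', of i j]
        alternating_antisym[OF Q open_atlas_D[OF c(1)] dy_vf[OF c(1)] H_vf[OF c(1)] u', of i j]
        VH[OF c(1) u'] R c(1) u' by simp
    show "R Xs u = Q Xs u"
      unfolding X(1)
    proof (rule alternating_eq_frame[OF c(1) P Q c(3,4,2) XW])
      fix i j show "R [frame c i, frame c j] u = Q [frame c i, frame c j] u"
        using hv VV[OF c(1) u'] VH[OF c(1) u'] HH[OF c(1) u'] R c(1) u'
        by (cases i; cases j) (simp_all add: frame_def[OF c(1)])
    qed
  qed
qed

lemma d_J_zero_iff:
  assumes \<theta>: "k_form (slit_bundle A) 1 \<theta>" "semi_basic A 1 \<theta>"
  shows "form_eq (slit_bundle A) 2 (d_deriv (slit_bundle A) J \<theta>) (\<lambda>Xs u. 0) \<longleftrightarrow>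
    (\<forall>c\<in>A. \<forall>u\<in>D c. \<forall>i j. dy c i u (\<theta> [dx c j]) = dy c j u (\<theta> [dx c i]))"
  using form_eq_2_iff[OF alternating_d_deriv[OF \<theta>(1) tensorial_J] alternating_zero,
      of "\<lambda>c u i j. dy c i u (\<theta> [dx c j]) = dy c j u (\<theta> [dx c i])" "\<lambda>c u i j. True"]
  by (simp add: dJ_H_H[OF _ \<theta>] dJ_dy_H[OF _ \<theta>] dJ_dy_dy[OF _ \<theta>])

lemma nabla_d_v_iff:
  assumes \<theta>: "k_form (slit_bundle A) 1 \<theta>" "semi_basic A 1 \<theta>"
    and \<sigma>: "k_form (slit_bundle A) 1 \<sigma>" "semi_basic A 1 \<sigma>"
  shows "form_eq (slit_bundle A) 2 (dyn_cov A S (d_deriv (slit_bundle A) vr \<theta>))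
      (\<lambda>Xs u. d_deriv (slit_bundle A) vr \<sigma> Xs u - 1 / 2 * i_deriv FJ (d_deriv (slit_bundle A) J \<sigma>) Xs u) \<longleftrightarrow>
    (\<forall>c\<in>A. \<forall>u\<in>D c. \<forall>i j. S u (\<lambda>w. dy c i w (\<theta> [dx c j])) -
        (\<Sum>k\<in>UNIV. N c i k u * dy c k u (\<theta> [dx c j])) - (\<Sum>k\<in>UNIV. N c j k u * dy c i u (\<theta> [dx c k])) =
      (dy c i u (\<sigma> [dx c j]) + dy c j u (\<sigma> [dx c i])) / 2)"
  (is "form_eq _ 2 ?R ?Q \<longleftrightarrow> (\<forall>c\<in>A. \<forall>u\<in>D c. \<forall>i j. ?e c u i j)")
proof -
  have Q: "alternating ?Q"
    by (rule alternating_diff[OF alternating_d_deriv[OF \<sigma>(1) tensorial_ver]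
        alternating_cmult[OF alternating_i_deriv[OF alternating_d_deriv[OF \<sigma>(1) tensorial_J] tensorial_FJ]]])
  have "form_eq (slit_bundle A) 2 ?R ?Q \<longleftrightarrow> (\<forall>c\<in>A. \<forall>u\<in>D c. \<forall>i j. True \<and> ?e c u i j)"
  proof (rule form_eq_2_iff[OF alternating_dyn_cov[OF alternating_d_deriv[OF \<theta>(1) tensorial_ver]] Q])
    fix c u i j assume c: "c \<in> A" and u: "u \<in> D c"
    show "(?R [H c i, H c j] u = ?Q [H c i, H c j] u) = True"
      unfolding nabla_H_H[OF c \<theta> u] dv_H_H[OF c \<sigma> u] iFJ_H_H[OF c \<sigma> u] by simp
    show "?R [dy c i, dy c j] u = ?Q [dy c i, dy c j] u"
      unfolding nabla_dy_dy[OF c \<theta> u] dv_dy_dy[OF c \<sigma> u] iFJ_dy_dy[OF c \<sigma> u] by simp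
    show "(?R [dy c i, H c j] u = ?Q [dy c i, H c j] u) = ?e c u i j"
      unfolding nabla_dy_H[OF c \<theta> u] dv_dy_H[OF c \<sigma> u] iFJ_dy_H[OF c \<sigma> u]
      by (simp add: field_simps)
  qed
  then show ?thesis by simp
qed

section \<open>The Lagrange differential\<close>

text \<open>The Euler-Lagrange expression, that is, the coefficient of \<open>dx\<^sup>j\<close> in
  \<open>\<delta>\<^sub>S L\<close>, as \<open>lagrange_expand\<close> shows.\<close>

definition euler :: "('m, real^'n) chart \<Rightarrow> ('m tpt \<Rightarrow> real) \<Rightarrow> 'n \<Rightarrow> 'm tpt \<Rightarrow> real" where
  "euler c L j = (\<lambda>u. S u (\<lambda>w. dy c j w L) - dx c j u L)"

context
  fixes c assumes c: "c \<in> A"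
begin

lemma C_D: "C \<in> vf (D c)"
  by (rule global_vf[OF C_vf open_atlas_D[OF c]])

lemmas CT = vf_TS[OF C_D]

lemma dx_dy_commute: "u \<in> D c \<Longrightarrow> near u f \<Longrightarrow> dx c i u (\<lambda>w. dy c j w f) = dy c j u (\<lambda>w. dx c i w f)"
  unfolding dx_field_def dy_field_def by (rule cv_commute[OF sc_mem[OF c]])

lemma dy_dy_commute: "u \<in> D c \<Longrightarrow> near u f \<Longrightarrow> dy c i u (\<lambda>w. dy c j w f) = dy c j u (\<lambda>w. dy c i w f)"
  unfolding dy_field_def by (rule cv_commute[OF sc_mem[OF c]])

lemma smooth_fun_vf: "X \<in> vf (D c) \<Longrightarrow> smth (D c) f \<Longrightarrow> smth (D c) (\<lambda>u. X u f)"
  by (rule vf_smth[OF _ open_atlas_D[OF c] order_refl])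

lemma near_D: "smth (D c) f \<Longrightarrow> u \<in> D c \<Longrightarrow> near u f"
  by (rule nearI[OF open_atlas_D[OF c]])

lemma near_vf: "X \<in> vf (D c) \<Longrightarrow> smth (D c) f \<Longrightarrow> u \<in> D c \<Longrightarrow> near u (\<lambda>u. X u f)"
  by (rule near_D[OF smooth_fun_vf])

context
  fixes L assumes L: "smth (D c) L"
begin

lemma euler_smth: "smth (D c) (euler c L j)"
  unfolding euler_def by (intro smooth_fun_diff open_atlas_D[OF c] smooth_fun_vf[OF S_D[OF c]] smooth_fun_vf[OF dy_vf[OF c]] smooth_fun_vf[OF dx_vf[OF c]] L)

text \<open>Moving the y-derivative past \<open>S\<close> costs the bracket
  \<open>[S, \<partial>/\<partial>y\<^sup>i]\<close>, which supplies both the connection term and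
  the x-derivative.\<close>

lemma dy_euler:
  assumes u: "u \<in> D c"
  shows "dy c i u (euler c L j) = S u (\<lambda>w. dy c i w (\<lambda>v. dy c j v L)) + dx c i u (\<lambda>w. dy c j w L) -
    2 * (\<Sum>k\<in>UNIV. N c i k u * dy c k u (\<lambda>w. dy c j w L)) - dy c i u (\<lambda>w. dx c j w L)"
proof -
  have dL: "smth (D c) (\<lambda>w. dy c j w L)" by (rule smooth_fun_vf[OF dy_vf[OF c] L])
  have "dy c i u (euler c L j) = dy c i u (\<lambda>w. S w (\<lambda>v. dy c j v L)) - dy c i u (\<lambda>w. dx c j w L)"
    unfolding euler_def
    by (rule tv_diff[OF dyT[OF c u] near_vf[OF S_D[OF c] dL u] near_vf[OF dx_vf[OF c] L u]])
  then show ?thesis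
    using brk_S_dy[OF c u, of i "\<lambda>w. dy c j w L"] brk_apply[OF near_D[OF dL u], of S "dy c i"] by linarith
qed

text \<open>Symmetrising removes the two mixed terms \<open>\<partial>\<^sup>2L/\<partial>x\<partial>y\<close>; what is left is the coefficient of
  \<open>\<nabla> d\<^sub>v d\<^sub>J L\<close>.\<close>

lemma dy_euler_symmetrised:
  assumes u: "u \<in> D c"
  shows "dy c i u (euler c L j) + dy c j u (euler c L i) = 2 * (S u (\<lambda>w. dy c i w (\<lambda>v. dy c j v L)) -
    (\<Sum>k\<in>UNIV. N c i k u * dy c k u (\<lambda>w. dy c j w L)) - (\<Sum>k\<in>UNIV. N c j k u * dy c i u (\<lambda>w. dy c k w L)))"
proof -
  have "S u (\<lambda>w. dy c j w (\<lambda>v. dy c i v L)) = S u (\<lambda>w. dy c i w (\<lambda>v. dy c j v L))"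
    by (rule tv_congD[OF c ST[OF c u] u]) (rule dy_dy_commute, assumption, rule near_D[OF L])
  then show ?thesis
    by (simp add: dy_euler[OF u] dx_dy_commute[OF u near_D[OF L u]] dy_dy_commute[OF u near_D[OF L u], of _ i])
qed

text \<open>\<open>d\<^sub>J L(X)\<close> is the sum of
  \<open>X(x\<^sup>k) \<partial>L/\<partial>y\<^sup>k\<close>. The terms with
  \<open>S(X(x\<^sup>k))\<close> cancel, and so do the y components of \<open>X\<close>, between
  \<open>d\<^sub>J L([S, X])\<close> and \<open>dL(X)\<close>; the result is semi-basic.\<close>

lemma lagrange_expand:
  assumes W: "opn W" "W \<subseteq> D c" and X: "X \<in> vf W" and u: "u \<in> W"
  shows "lagrange_diff A S L [X] u = (\<Sum>k\<in>UNIV. X u (xcoord c k) * euler c L k u)"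
proof -
  have uD: "u \<in> D c" using u W by auto
  have d: "d_deriv (slit_bundle A) J (fun_form L) [Z] w = (\<Sum>k\<in>UNIV. Z w (xcoord c k) * dy c k w L)"
    if "Z w \<in> TS w" "w \<in> D c" for Z w
  proof -
    have "i_deriv J (fun_form L) [] = (\<lambda>u. 0)" by (rule ext) simp
    then show ?thesis
      using J_eq[of c w Z L, OF c that(2,1)] that(1) by (simp add: d_deriv_def fun_form_def)
  qed
  have SW: "S \<in> vf W" by (rule S_vfW[OF W(1)])
  note t = vf_TS[OF SW u]
  have nX: "near u (\<lambda>w. X w (xcoord c k))" for k by (rule vf_near[OF X W(1) u x_near[OF c uD]])
  have nL: "near u (\<lambda>w. dy c k w L)" for k by (rule near_vf[OF dy_vf[OF c] L uD])
  have "S u (d_deriv (slit_bundle A) J (fun_form L) [X]) = S u (\<lambda>w. \<Sum>k\<in>UNIV. X w (xcoord c k) * dy c k w L)"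
    by (rule tv_cong[OF t W(1) u]) (rule d[where Z = X, OF vf_TS[OF X]], use W in auto)
  also have "\<dots> = (\<Sum>k\<in>UNIV. S u (\<lambda>w. X w (xcoord c k) * dy c k w L))"
    by (rule tv_sum[OF t]) (intro near_mult nX nL)
  also have "\<dots> = (\<Sum>k\<in>UNIV. X u (xcoord c k) * S u (\<lambda>w. dy c k w L) + S u (\<lambda>w. X w (xcoord c k)) * dy c k u L)"
    by (intro sum.cong refl tv_mult[OF t nX nL])
  finally have 1: "S u (d_deriv (slit_bundle A) J (fun_form L) [X]) = \<dots>" .
  have "X u (\<lambda>w. S w (xcoord c k)) = X u (ycoord c k)" for k
    by (rule tv_cong[OF vf_TS[OF X u] W(1) u]) (rule S_x[OF c], use W in auto)
  then have 2: "d_deriv (slit_bundle A) J (fun_form L) [brk S X] u =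
      (\<Sum>k\<in>UNIV. (S u (\<lambda>w. X w (xcoord c k)) - X u (ycoord c k)) * dy c k u L)"
    by (simp add: d[where Z = "brk S X" and w = u, OF vf_TS[OF brk_vf[OF W(1) SW X] u] uD] brk_apply[OF x_near[OF c uD]])
  have 3: "ext_d (slit_bundle A) (fun_form L) [X] u =
      (\<Sum>k\<in>UNIV. X u (xcoord c k) * dx c k u L) + (\<Sum>k\<in>UNIV. X u (ycoord c k) * dy c k u L)"
    using tv_frame[OF c vf_TS[OF X u] uD, of L] by (simp add: fun_form_def)
  show ?thesis
    unfolding lagrange_diff_def lie_form_1 1 2 3
    by (simp add: euler_def sum.distrib sum_subtractf left_diff_distrib right_diff_distrib)
qed

text \<open>The tangent vector is left general so that the commutators of \<open>C\<close> with both
  kinds of coordinate field come from one computation.\<close>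

lemma C_deriv_sum:
  assumes t: "t \<in> TS u" and u: "u \<in> D c"
  shows "t (\<lambda>w. C w L) = (\<Sum>k\<in>UNIV. ycoord c k u * t (\<lambda>w. dy c k w L) + t (ycoord c k) * dy c k u L)"
proof -
  have nL: "near u (\<lambda>w. dy c k w L)" for k by (rule near_vf[OF dy_vf[OF c] L u])
  have "t (\<lambda>w. C w L) = t (\<lambda>w. \<Sum>k\<in>UNIV. ycoord c k w * dy c k w L)"
    by (rule tv_congD[OF c t u C_eq[OF c]])
  also have "\<dots> = (\<Sum>k\<in>UNIV. t (\<lambda>w. ycoord c k w * dy c k w L))"
    by (rule tv_sum[OF t]) (intro near_mult y_near[OF c u] nL)
  also have "\<dots> = (\<Sum>k\<in>UNIV. ycoord c k u * t (\<lambda>w. dy c k w L) + t (ycoord c k) * dy c k u L)"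
    by (intro sum.cong refl tv_mult[OF t y_near[OF c u] nL])
  finally show ?thesis .
qed

lemma C_dy: "u \<in> D c \<Longrightarrow> C u (\<lambda>w. dy c i w L) = dy c i u (\<lambda>w. C w L) - dy c i u L"
  by (simp add: C_deriv_sum[OF dyT[OF c]] C_eq[OF c] dy_y[OF c] sum.distrib
      dy_dy_commute[OF _ near_D[OF L], of _ i] if_distrib[of "\<lambda>x. x * _"] cong: if_cong)

lemma C_dx: "u \<in> D c \<Longrightarrow> C u (\<lambda>w. dx c i w L) = dx c i u (\<lambda>w. C w L)"
  by (simp add: C_deriv_sum[OF dxT[OF c]] C_eq[OF c] dx_y[OF c]
      dx_dy_commute[OF _ near_D[OF L]])

text \<open>The spray condition \<open>[C, S] = S\<close>: derivation along \<open>S\<close> raises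
  the order of homogeneity by one.\<close>

lemma C_S: "u \<in> D c \<Longrightarrow> C u (\<lambda>w. S w L) = S u (\<lambda>w. C w L) + S u L"
  using spray D_carrier[OF c, of u] brk_apply[OF near_D[OF L], of u C S] by (simp add: spray_def)

context
  fixes r :: real
  assumes hom: "\<And>w. w \<in> D c \<Longrightarrow> C w L = r * L w"
begin

lemma tv_hom: "t \<in> TS u \<Longrightarrow> u \<in> D c \<Longrightarrow> t (\<lambda>w. C w L) = r * t L"
  using tv_congD[OF c _ _ hom, of t u] tv_cmult[OF _ near_D[OF L], of t u r] by simp

lemma C_dy_hom: "u \<in> D c \<Longrightarrow> C u (\<lambda>w. dy c i w L) = (r - 1) * dy c i u L"
  by (simp add: C_dy tv_hom[OF dyT[OF c]] left_diff_distrib)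

lemma C_dx_hom: "u \<in> D c \<Longrightarrow> C u (\<lambda>w. dx c i w L) = r * dx c i u L"
  by (simp add: C_dx tv_hom[OF dxT[OF c]])

end

end

text \<open>The y-derivative lowers the order by one, \<open>S\<close> raises it by one and the
  x-derivative keeps it, so both terms of \<open>euler\<close> have order \<open>r\<close>.\<close>

lemma C_euler:
  assumes L: "smth (D c) L" and hom: "\<And>w. w \<in> D c \<Longrightarrow> C w L = r * L w" and u: "u \<in> D c"
  shows "C u (euler c L j) = r * euler c L j u"
proof -
  let ?M = "\<lambda>w. dy c j w L"
  have M: "smth (D c) ?M" by (rule smooth_fun_vf[OF dy_vf[OF c] L])
  have "C u (euler c L j) = C u (\<lambda>w. S w ?M) - C u (\<lambda>w. dx c j w L)"
    unfolding euler_def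
    by (rule tv_diff[OF CT[OF u] near_vf[OF S_D[OF c] M u] near_vf[OF dx_vf[OF c] L u]])
  \<comment> \<open>\<open>tv_hom\<close> is used for the y-derivative \<open>?M\<close> in place of
    \<open>L\<close>, with order \<open>r - 1\<close>.\<close>
  moreover have "C u (\<lambda>w. S w ?M) = (r - 1) * S u ?M + S u ?M"
    using C_S[OF M u] tv_hom[OF M C_dy_hom[OF L hom] ST[OF c u] u] by simp
  ultimately show ?thesis
    by (simp add: C_dx_hom[OF L hom u] euler_def algebra_simps)
qed

text \<open>Contracting the antisymmetric matrix \<open>\<partial>\<rho>\<^sub>j/\<partial>y\<^sup>i\<close> with \<open>y\<^sup>i y\<^sup>j\<close> gives \<open>y\<^sup>j \<rho>\<^sub>j = 0\<close> by Euler's identity;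
  differentiating this by \<open>y\<^sup>j\<close> and applying antisymmetry again gives \<open>r \<rho>\<^sub>j = \<rho>\<^sub>j\<close>.\<close>

lemma antisymmetric_homogeneous_zero:
  assumes \<rho>: "\<And>j. smth (D c) (\<rho> j)"
    and anti: "\<And>i j w. w \<in> D c \<Longrightarrow> dy c i w (\<rho> j) + dy c j w (\<rho> i) = 0"
    and hom: "\<And>j w. w \<in> D c \<Longrightarrow> C w (\<rho> j) = r * \<rho> j w" and r: "r > 1" and u: "u \<in> D c"
  shows "\<rho> j u = 0"
proof -
  let ?g = "\<lambda>w. \<Sum>k\<in>UNIV. ycoord c k w * \<rho> k w"
  have g0: "?g w = 0" if w: "w \<in> D c" for w
  proof -
    let ?s = "\<Sum>j\<in>UNIV. \<Sum>k\<in>UNIV. ycoord c j w * (ycoord c k w * dy c k w (\<rho> j))"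
    have "r * ?g w = (\<Sum>j\<in>UNIV. ycoord c j w * C w (\<rho> j))"
      by (simp add: hom[OF w] sum_distrib_left mult.left_commute)
    also have "\<dots> = ?s"
      by (simp add: C_eq[OF c w] sum_distrib_left)
    finally have 1: "r * ?g w = ?s" .
    have "?s = (\<Sum>j\<in>UNIV. \<Sum>k\<in>UNIV. ycoord c k w * (ycoord c j w * dy c j w (\<rho> k)))"
      by (rule sum.swap)
    also have "\<dots> = (\<Sum>j\<in>UNIV. \<Sum>k\<in>UNIV. - (ycoord c j w * (ycoord c k w * dy c k w (\<rho> j))))"
    proof (intro sum.cong refl)
      fix j k
      have "dy c j w (\<rho> k) = - dy c k w (\<rho> j)" using anti[OF w, of j k] by linarith
      then show "ycoord c k w * (ycoord c j w * dy c j w (\<rho> k)) =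
          - (ycoord c j w * (ycoord c k w * dy c k w (\<rho> j)))" by simp
    qed
    also have "\<dots> = - ?s" by (simp only: sum_negf)
    finally have "?s = - ?s" .
    then have "r * ?g w = 0" using 1 by linarith
    then show ?thesis using r by simp
  qed
  have n: "near u (\<rho> k)" for k by (rule near_D[OF \<rho> u])
  have "0 = dy c j u ?g"
    by (rule tv_constD[OF c dyT[OF c u] u g0, symmetric])
  also have "\<dots> = (\<Sum>k\<in>UNIV. dy c j u (\<lambda>w. ycoord c k w * \<rho> k w))"
    by (rule tv_sum[OF dyT[OF c u]]) (intro near_mult y_near[OF c u] n)
  also have "\<dots> = (\<Sum>k\<in>UNIV. ycoord c k u * dy c j u (\<rho> k) + dy c j u (ycoord c k) * \<rho> k u)"
    by (intro sum.cong refl tv_mult[OF dyT[OF c u] y_near[OF c u] n])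
  also have "\<dots> = (\<Sum>k\<in>UNIV. ycoord c k u * dy c j u (\<rho> k)) + \<rho> j u"
    by (simp add: sum.distrib dy_y[OF c u] if_distrib[of "\<lambda>x. x * _"] cong: if_cong)
  also have "(\<Sum>k\<in>UNIV. ycoord c k u * dy c j u (\<rho> k)) = - (\<Sum>k\<in>UNIV. ycoord c k u * dy c k u (\<rho> j))"
    unfolding sum_negf[symmetric]
  proof (intro sum.cong refl)
    fix k
    have "dy c j u (\<rho> k) = - dy c k u (\<rho> j)" using anti[OF u, of j k] by linarith
    then show "ycoord c k u * dy c j u (\<rho> k) = - (ycoord c k u * dy c k u (\<rho> j))" by simp
  qed
  also have "\<dots> = - (r * \<rho> j u)" using hom[OF u, of j] C_eq[OF c u, of "\<rho> j"] by simp
  finally have "(r - 1) * \<rho> j u = 0" by (simp add: algebra_simps)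
  then show ?thesis using r by simp
qed

end

section \<open>The two directions of the equivalence\<close>

lemma homogeneous_fun_iff:
  "homogeneous_form A 0 r (fun_form L) \<longleftrightarrow> (\<forall>u\<in>slit_points A. C u L = r * L u)"
proof
  assume "homogeneous_form A 0 r (fun_form L)"
  then show "\<forall>u\<in>slit_points A. C u L = r * L u"
    unfolding homogeneous_form_def form_eq_def
    using open_atlas_carrier by (auto simp: fun_form_def dest!: spec[where x = "slit_points A"])
next
  assume "\<forall>u\<in>slit_points A. C u L = r * L u"
  then show "homogeneous_form A 0 r (fun_form L)"
    unfolding homogeneous_form_def form_eq_def
    using open_atlas_subset_carrier by (auto simp: fun_form_def subset_iff)
qed

lemma lagrange_iff:
  assumes L: "smth (slit_points A) L" and \<sigma>: "k_form (slit_bundle A) 1 \<sigma>" "semi_basic A 1 \<sigma>"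
  shows "form_eq (slit_bundle A) 1 (lagrange_diff A S L) \<sigma> \<longleftrightarrow>
    (\<forall>c\<in>A. \<forall>u\<in>D c. \<forall>k. euler c L k u = \<sigma> [dx c k] u)"
proof (rule form_eq_1_iff)
  fix c W X u assume *: "c \<in> A" "opn W" "W \<subseteq> D c" "X \<in> vf W" "u \<in> W"
  have "smth (D c) L" by (rule smooth_fun_mono[OF L]) (use D_carrier[OF *(1)] in auto)
  then show "lagrange_diff A S L [X] u = (\<Sum>k\<in>UNIV. X u (xcoord c k) * euler c L k u)"
    using lagrange_expand[OF *(1) _ *(2-)] by blast
  show "\<sigma> [X] u = (\<Sum>k\<in>UNIV. X u (xcoord c k) * \<sigma> [dx c k] u)"
    by (rule semi_basic_expand[OF *(1) \<sigma> *(2-)])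
qed

text \<open>The form is \<open>d\<^sub>J L\<close>, since \<open>d\<^sub>J L(X) = (J X)(L)\<close>;
  \<open>hd\<close> selects the single argument. Written this way it is the witness for the passage
  from a Lagrangian to a 1-form.\<close>

lemma k_form_J:
  assumes L: "smth (slit_points A) L"
  shows "k_form (slit_bundle A) 1 (\<lambda>Xs u. J (hd Xs) u L)"
  unfolding k_form_1_iff list.sel
proof (intro allI impI conjI)
  fix W X assume W: "opn W \<and> X \<in> vf W"
  show "smth W (\<lambda>u. J X u L)"
    by (rule vf_smth[OF tensorial_vf[OF tensorial_J] _ order_refl smooth_fun_mono[OF L open_atlas_subset_carrier]]) (use W in auto)
next
  fix W X Y assume "opn W \<and> X \<in> vf W" "\<forall>u\<in>W. X u = Y u"
  then show "\<forall>u\<in>W. J X u L = J Y u L" using tensorial_cong[OF tensorial_J, of W X Y] by auto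
next
  fix W X Y f assume "opn W \<and> X \<in> vf W" "Y \<in> vf W \<and> smth W f"
  then show "\<forall>u\<in>W. J (\<lambda>w g. f w * X w g + Y w g) u L = f u * J X u L + J Y u L"
    using tensorial_lin[OF tensorial_J, of W X Y f] by auto
qed

lemma semi_basic_J: "semi_basic A 1 (\<lambda>Xs u. J (hd Xs) u L)"
  unfolding semi_basic_def
proof (intro allI impI ballI)
  fix W Xs u
  assume W: "opn W \<and> length Xs = 1 \<and> set Xs \<subseteq> vf W \<and> (\<exists>i<1. vertical A W (Xs ! i))" and u: "u \<in> W"
  then obtain X where X: "Xs = [X]" "X \<in> vf W" "vertical A W X" by (auto simp: length_Suc_conv)
  obtain c where c: "c \<in> A" "u \<in> D c" using chart_Int[OF conjunct1[OF W] u] by blast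
  have "X u (xcoord c k) = 0" for k using X(3) u unfolding vertical_def xcoord_comp by blast
  then show "J (hd Xs) u L = 0"
    using J_eq[of c u X L, OF c vf_TS[OF X(2) u]] by (simp add: X(1))
qed

lemma finslerian_imp_form:
  assumes \<sigma>: "k_form (slit_bundle A) 1 \<sigma>" "semi_basic A 1 \<sigma>"
    and L: "lagrangian A L" "homogeneous_form A 0 r (fun_form L)"
      "form_eq (slit_bundle A) 1 (lagrange_diff A S L) \<sigma>"
  defines "\<theta> \<equiv> (\<lambda>Xs u. J (hd Xs) u L)"
  shows "nontrivial_1form A \<theta>" "homogeneous_form A 1 (r - 1) \<theta>"
    "form_eq (slit_bundle A) 2 (d_deriv (slit_bundle A) J \<theta>) (\<lambda>Xs u. 0)"
    "form_eq (slit_bundle A) 2 (dyn_cov A S (d_deriv (slit_bundle A) vr \<theta>))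
      (\<lambda>Xs u. d_deriv (slit_bundle A) vr \<sigma> Xs u - 1 / 2 * i_deriv FJ (d_deriv (slit_bundle A) J \<sigma>) Xs u)"
proof -
  have Ls: "smth (slit_points A) L" using L(1) by (simp add: lagrangian_def)
  have LD: "smth (D c) L" if "c \<in> A" for c
    by (rule smooth_fun_mono[OF Ls]) (use D_carrier[OF that] in auto)
  have \<theta>: "k_form (slit_bundle A) 1 \<theta>" "semi_basic A 1 \<theta>"
    unfolding \<theta>_def by (rule k_form_J[OF Ls] semi_basic_J)+
  have th: "\<theta> [dx c k] u = dy c k u L" if "c \<in> A" "u \<in> D c" for c k u
    using J_dx[OF that] by (simp add: \<theta>_def)
  have tvth: "t (\<theta> [dx c k]) = t (\<lambda>w. dy c k w L)" if "c \<in> A" "u \<in> D c" "t \<in> TS u" for t c u k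
    by (rule tv_congD[OF that(1,3,2) th[OF that(1)]])
  have dyth: "dy c i u (\<theta> [dx c k]) = dy c i u (\<lambda>w. dy c k w L)" if "c \<in> A" "u \<in> D c" for i c u k
    by (rule tvth[OF that dyT[OF that]])
  have hom: "C u L = r * L u" if "c \<in> A" "u \<in> D c" for c u
    using L(2) D_carrier[OF that] by (simp add: homogeneous_fun_iff)
  have euler: "euler c L k u = \<sigma> [dx c k] u" if "c \<in> A" "u \<in> D c" for c u k
    using L(3) that unfolding lagrange_iff[OF Ls \<sigma>] by blast
  show "nontrivial_1form A \<theta>"
  proof -
    obtain c u i j where cu: "c \<in> A" "u \<in> D c" and "dy c j u (\<lambda>w. dy c i w L) \<noteq> 0"
      using L(1) unfolding lagrangian_def by blast
    then have "dy c j u (\<theta> [dx c i]) \<noteq> 0" using dyth[OF cu] by simp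
    then show ?thesis unfolding nontrivial_1form_def using cu by blast
  qed
  show "homogeneous_form A 1 (r - 1) \<theta>"
    unfolding homogeneous_iff[OF \<theta>]
  proof (intro ballI allI)
    fix c u k assume cu: "c \<in> A" "u \<in> D c"
    show "C u (\<theta> [dx c k]) = (r - 1) * \<theta> [dx c k] u"
      unfolding tvth[OF cu CT[OF cu]] th[OF cu]
      by (rule C_dy_hom[OF cu(1) LD[OF cu(1)] hom[OF cu(1)] cu(2)])
  qed
  show "form_eq (slit_bundle A) 2 (d_deriv (slit_bundle A) J \<theta>) (\<lambda>Xs u. 0)"
    unfolding d_J_zero_iff[OF \<theta>]
  proof (intro ballI allI)
    fix c u i j assume cu: "c \<in> A" "u \<in> D c"
    show "dy c i u (\<theta> [dx c j]) = dy c j u (\<theta> [dx c i])"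
      unfolding dyth[OF cu] by (rule dy_dy_commute[OF cu near_D[OF cu(1) LD[OF cu(1)] cu(2)]])
  qed
  show "form_eq (slit_bundle A) 2 (dyn_cov A S (d_deriv (slit_bundle A) vr \<theta>))
      (\<lambda>Xs u. d_deriv (slit_bundle A) vr \<sigma> Xs u - 1 / 2 * i_deriv FJ (d_deriv (slit_bundle A) J \<sigma>) Xs u)"
    unfolding nabla_d_v_iff[OF \<theta> \<sigma>]
  proof (intro ballI allI)
    fix c u i j assume cu: "c \<in> A" "u \<in> D c"
    have "S u (\<lambda>w. dy c i w (\<theta> [dx c j])) = S u (\<lambda>w. dy c i w (\<lambda>v. dy c j v L))"
      by (rule tv_congD[OF cu(1) ST[OF cu] cu(2) dyth[OF cu(1)]])
    moreover have "dy c i u (\<sigma> [dx c j]) = dy c i u (euler c L j)" for i j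
      by (rule tv_congD[OF cu(1) dyT[OF cu] cu(2) euler[OF cu(1), symmetric]])
    ultimately show "S u (\<lambda>w. dy c i w (\<theta> [dx c j])) -
        (\<Sum>k\<in>UNIV. N c i k u * dy c k u (\<theta> [dx c j])) - (\<Sum>k\<in>UNIV. N c j k u * dy c i u (\<theta> [dx c k])) =
      (dy c i u (\<sigma> [dx c j]) + dy c j u (\<sigma> [dx c i])) / 2"
      \<comment> \<open>As \<open>euler\<close> equals the coefficient of \<sigma>, the left side of
        this identity is the symmetrised derivative of \<sigma>; its factor 2 accounts for the
        division by 2 in the goal.\<close>
      using dy_euler_symmetrised[OF cu(1) LD[OF cu(1)] cu(2), of i j] by (simp add: dyth[OF cu])
  qed
qed

lemma form_imp_finslerian:
  assumes \<sigma>: "k_form (slit_bundle A) 1 \<sigma>" "semi_basic A 1 \<sigma>" "homogeneous_form A 1 r \<sigma>" and r: "r > 1"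
    and \<theta>: "k_form (slit_bundle A) 1 \<theta>" "semi_basic A 1 \<theta>" and nt: "nontrivial_1form A \<theta>"
    and h\<theta>: "homogeneous_form A 1 (r - 1) \<theta>"
    and dJ: "form_eq (slit_bundle A) 2 (d_deriv (slit_bundle A) J \<theta>) (\<lambda>Xs u. 0)"
    and nabla: "form_eq (slit_bundle A) 2 (dyn_cov A S (d_deriv (slit_bundle A) vr \<theta>))
      (\<lambda>Xs u. d_deriv (slit_bundle A) vr \<sigma> Xs u - 1 / 2 * i_deriv FJ (d_deriv (slit_bundle A) J \<sigma>) Xs u)"
  shows "finslerian_type A S r \<sigma>"
proof -
  \<comment> \<open>Euler's identity dictates the choice: a function of order \<open>r\<close> with
    \<open>\<partial>L/\<partial>y\<^sup>k = \<theta>\<^sub>k\<close> must satisfy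
    \<open>r L = y\<^sup>k \<theta>\<^sub>k\<close>, and the right side is
    \<open>\<theta>(S)\<close> because \<open>S\<close> has x components
    \<open>y\<^sup>k\<close>.\<close>
  define L where "L u = 1 / r * \<theta> [S] u" for u
  have Ls: "smth (slit_points A) L"
    unfolding L_def[abs_def] by (intro smooth_fun_mult open_atlas_carrier smooth_fun_const one_form_smth[OF \<theta>(1) open_atlas_carrier S_vf])
  have LD: "smth (D c) L" if "c \<in> A" for c
    by (rule smooth_fun_mono[OF Ls]) (use D_carrier[OF that] in auto)
  have Lc: "L u = (\<Sum>k\<in>UNIV. 1 / r * (ycoord c k u * \<theta> [dx c k] u))" if "c \<in> A" "u \<in> D c" for c u
    by (simp add: L_def semi_basic_D[OF that(1) \<theta> S_D[OF that(1)] that(2)] S_x[OF that] sum_distrib_left)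
  have symm: "dy c i u (\<theta> [dx c j]) = dy c j u (\<theta> [dx c i])" if "c \<in> A" "u \<in> D c" for c u i j
    using dJ that unfolding d_J_zero_iff[OF \<theta>] by blast
  have C\<theta>: "C u (\<theta> [dx c k]) = (r - 1) * \<theta> [dx c k] u" if "c \<in> A" "u \<in> D c" for c u k
    using h\<theta> that unfolding homogeneous_iff[OF \<theta>] by blast
  \<comment> \<open>Differentiating \<open>y\<^sup>k \<theta>\<^sub>k\<close> gives
    \<open>\<theta>\<^sub>j\<close> plus
    \<open>y\<^sup>k \<partial>\<theta>\<^sub>k/\<partial>y\<^sup>j\<close>. Condition (1) turns the
    second term into \<open>C(\<theta>\<^sub>j) = (r - 1) \<theta>\<^sub>j\<close>, so the total is
    \<open>r \<theta>\<^sub>j\<close>.\<close>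
  have dyL: "dy c j u L = \<theta> [dx c j] u" if cu: "c \<in> A" "u \<in> D c" for c u j
  proof -
    note t = dyT[OF cu] and y = y_near[OF cu] and n = semi_basic_near[OF cu(1) \<theta> cu(2)]
    have "dy c j u L = dy c j u (\<lambda>w. \<Sum>k\<in>UNIV. 1 / r * (ycoord c k w * \<theta> [dx c k] w))"
      by (rule tv_congD[OF cu(1) t cu(2) Lc[OF cu(1)]])
    also have "\<dots> = (\<Sum>k\<in>UNIV. dy c j u (\<lambda>w. 1 / r * (ycoord c k w * \<theta> [dx c k] w)))"
      by (rule tv_sum[OF t]) (intro near_cmult near_mult y n)
    also have "\<dots> = (\<Sum>k\<in>UNIV. 1 / r * (ycoord c k u * dy c j u (\<theta> [dx c k]) + dy c j u (ycoord c k) * \<theta> [dx c k] u))"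
      by (intro sum.cong refl) (simp only: tv_cmult[OF t near_mult[OF y n]] tv_mult[OF t y n])
    also have "\<dots> = 1 / r * ((\<Sum>k\<in>UNIV. ycoord c k u * dy c k u (\<theta> [dx c j])) + \<theta> [dx c j] u)"
      unfolding sum_distrib_left[symmetric]
      by (simp add: sum.distrib dy_y[OF cu] symm[OF cu, of j] if_distrib[of "\<lambda>x. x * _"] cong: if_cong)
    also have "\<dots> = 1 / r * (C u (\<theta> [dx c j]) + \<theta> [dx c j] u)"
      by (simp add: C_eq[OF cu])
    finally show ?thesis using r by (simp add: C\<theta>[OF cu] field_simps)
  qed
  have hom: "C u L = r * L u" if cu: "c \<in> A" "u \<in> D c" for c u
    using r by (simp add: C_eq[OF cu] dyL[OF cu] Lc[OF cu] sum_distrib_left)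
  have dydyL: "dy c i u (\<theta> [dx c j]) = dy c i u (\<lambda>w. dy c j w L)" if cu: "c \<in> A" "u \<in> D c" for c u i j
    by (rule tv_congD[OF cu(1) dyT[OF cu] cu(2) dyL[OF cu(1), symmetric]])
  have "lagrangian A L"
  proof -
    obtain c u i j where cu: "c \<in> A" "u \<in> D c" and "dy c j u (\<theta> [dx c i]) \<noteq> 0"
      using nt unfolding nontrivial_1form_def by blast
    then have "dy c j u (\<lambda>w. dy c i w L) \<noteq> 0" using dydyL[OF cu] by simp
    then show ?thesis unfolding lagrangian_def using cu Ls by blast
  qed
  moreover have "homogeneous_form A 0 r (fun_form L)"
    unfolding homogeneous_fun_iff using hom D_obtain by metis
  moreover have "form_eq (slit_bundle A) 1 (lagrange_diff A S L) \<sigma>"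
    unfolding lagrange_iff[OF Ls \<sigma>(1,2)]
  proof (intro ballI allI)
    fix c u k assume cu: "c \<in> A" "u \<in> D c"
    let ?\<rho> = "\<lambda>j w. euler c L j w - \<sigma> [dx c j] w"
    note es = euler_smth[OF cu(1) LD[OF cu(1)]] and ss = semi_basic_smth[OF cu(1) \<sigma>(1,2)]
    have tv: "t (?\<rho> j) = t (euler c L j) - t (\<sigma> [dx c j])" if "w \<in> D c" "t \<in> TS w" for w t j
      by (rule tv_diff[OF that(2) near_D[OF cu(1) es that(1)] near_D[OF cu(1) ss that(1)]])
    have "?\<rho> k u = 0"
    proof (rule antisymmetric_homogeneous_zero[OF cu(1), where r = r and \<rho> = ?\<rho>])
      show "smth (D c) (?\<rho> j)" for j by (intro smooth_fun_diff open_atlas_D[OF cu(1)] es ss)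
    next
      fix i j w assume w: "w \<in> D c"
      have "S w (\<lambda>w. dy c i w (\<theta> [dx c j])) = S w (\<lambda>w. dy c i w (\<lambda>v. dy c j v L))"
        by (rule tv_congD[OF cu(1) ST[OF cu(1) w] w dydyL[OF cu(1)]])
      moreover have "S w (\<lambda>w. dy c i w (\<theta> [dx c j])) -
          (\<Sum>k\<in>UNIV. N c i k w * dy c k w (\<theta> [dx c j])) - (\<Sum>k\<in>UNIV. N c j k w * dy c i w (\<theta> [dx c k])) =
          (dy c i w (\<sigma> [dx c j]) + dy c j w (\<sigma> [dx c i])) / 2"
        using nabla cu(1) w unfolding nabla_d_v_iff[OF \<theta> \<sigma>(1,2)] by blast
      \<comment> \<open>Condition (2) equates the symmetrised derivatives of \<open>euler\<close>
        and \<sigma>, which leaves an antisymmetric matrix for their difference.\<close>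
      ultimately show "dy c i w (?\<rho> j) + dy c j w (?\<rho> i) = 0"
        using dy_euler_symmetrised[OF cu(1) LD[OF cu(1)] w, of i j]
        by (simp add: tv[OF w dyT[OF cu(1) w]] dydyL[OF cu(1) w])
    next
      fix j w assume w: "w \<in> D c"
      have "C w (\<sigma> [dx c j]) = r * \<sigma> [dx c j] w"
        using \<sigma>(3) cu(1) w unfolding homogeneous_iff[OF \<sigma>(1,2)] by blast
      then show "C w (?\<rho> j) = r * ?\<rho> j w"
        using C_euler[OF cu(1) LD[OF cu(1)] hom[OF cu(1)] w, of j]
        by (simp add: tv[OF w CT[OF cu(1) w]] right_diff_distrib)
    qed (use r cu in auto)
    then show "euler c L k u = \<sigma> [dx c k] u" by simp
  qed
  ultimately show ?thesis unfolding finslerian_type_def by blast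
qed

end

theorem theorem6p3:
  fixes T :: "'m topology" and A :: "('m, real^'n) atlas"
    and S :: "'m tpt vfield" and \<sigma> :: "'m tpt form" and p :: int
  assumes "smooth_manifold T A"
    and "spray A S"
    and "p > 1"
    and "k_form (slit_bundle A) 1 \<sigma>"
    and "semi_basic A 1 \<sigma>"
    and "homogeneous_form A 1 (of_int p) \<sigma>"
  shows "finslerian_type A S (of_int p) \<sigma> \<longleftrightarrow>
    (\<exists>\<theta>. k_form (slit_bundle A) 1 \<theta> \<and> semi_basic A 1 \<theta> \<and> nontrivial_1form A \<theta> \<and>
       homogeneous_form A 1 (of_int (p - 1)) \<theta> \<and>
       form_eq (slit_bundle A) 2
         (d_deriv (slit_bundle A) (tangent_structure A) \<theta>) (\<lambda>Xs u. 0) \<and>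
       form_eq (slit_bundle A) 2
         (dyn_cov A S (d_deriv (slit_bundle A) (ver A S) \<theta>))
         (\<lambda>Xs u. d_deriv (slit_bundle A) (ver A S) \<sigma> Xs u -
            1 / 2 * i_deriv (F_plus_J A S)
              (d_deriv (slit_bundle A) (tangent_structure A) \<sigma>) Xs u))"
proof -
  interpret spray_geometry A S
    by (intro spray_geometry.intro slit_geometry.intro spray_geometry_axioms.intro
        smooth_manifold_atlas[OF assms(1)] assms(2))
  have p: "(of_int p :: real) > 1" "(of_int (p - 1) :: real) = of_int p - 1" using assms(3) by simp_all
  show ?thesis
    unfolding p(2)
  proof
    assume "finslerian_type A S (of_int p) \<sigma>"
    then obtain L where L: "lagrangian A L" "homogeneous_form A 0 (of_int p) (fun_form L)"
      "form_eq (slit_bundle A) 1 (lagrange_diff A S L) \<sigma>"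
      unfolding finslerian_type_def by blast
    have "smth (slit_points A) L" using L(1) by (simp add: lagrangian_def)
    from k_form_J[OF this] semi_basic_J[of L] finslerian_imp_form[OF assms(4,5) L]
    show "\<exists>\<theta>. k_form (slit_bundle A) 1 \<theta> \<and> semi_basic A 1 \<theta> \<and> nontrivial_1form A \<theta> \<and>
       homogeneous_form A 1 (of_int p - 1) \<theta> \<and>
       form_eq (slit_bundle A) 2
         (d_deriv (slit_bundle A) (tangent_structure A) \<theta>) (\<lambda>Xs u. 0) \<and>
       form_eq (slit_bundle A) 2
         (dyn_cov A S (d_deriv (slit_bundle A) (ver A S) \<theta>))
         (\<lambda>Xs u. d_deriv (slit_bundle A) (ver A S) \<sigma> Xs u -
            1 / 2 * i_deriv (F_plus_J A S)
              (d_deriv (slit_bundle A) (tangent_structure A) \<sigma>) Xs u)"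
      by (intro exI[of _ "\<lambda>Xs u. J (hd Xs) u L"] conjI)
  next
    assume "\<exists>\<theta>. k_form (slit_bundle A) 1 \<theta> \<and> semi_basic A 1 \<theta> \<and> nontrivial_1form A \<theta> \<and>
       homogeneous_form A 1 (of_int p - 1) \<theta> \<and>
       form_eq (slit_bundle A) 2
         (d_deriv (slit_bundle A) (tangent_structure A) \<theta>) (\<lambda>Xs u. 0) \<and>
       form_eq (slit_bundle A) 2
         (dyn_cov A S (d_deriv (slit_bundle A) (ver A S) \<theta>))
         (\<lambda>Xs u. d_deriv (slit_bundle A) (ver A S) \<sigma> Xs u -
            1 / 2 * i_deriv (F_plus_J A S)
              (d_deriv (slit_bundle A) (tangent_structure A) \<sigma>) Xs u)"
    then show "finslerian_type A S (of_int p) \<sigma>"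
      using form_imp_finslerian[OF assms(4-6) p(1)] by blast
  qed
qed

end
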